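(* Let $M$ be a smooth manifold and let $\varpi\in\Omega^{1,1}_{\Delta_M}(M\mid M)$ be a contrast bi-form on $M$, with induced metric $g^\varpi$ and induced affine connection $\nabla^\varpi$. (i) If $\varpi$ is bi-exact, i.e. there is $F\in\Omega^{0,0}(M\mid M)$ such that $\varpi=\mathrm d^L\mathrm d^RF$, then $(M,g^\varpi,\nabla^\varpi)$ is a statistical manifold. (ii) Conversely, if $(M,g^\varpi,\nabla^\varpi)$ is a statistical manifold, then there is $F\in\Omega^{0,0}(M\mid M)$ such that $\varpi$ and $\mathrm d^L\mathrm d^RF$ induce the same pseudo-Riemannian metric and the same affine connection, i.e. $\mathrm d^L\mathrm d^RF$ is a contrast bi-form with $g^{\mathrm d^L\mathrm d^RF}=g^\varpi$ and $\nabla^{\mathrm d^L\mathrm d^RF}=\nabla^\varpi$. Moreover, $F$ can be chosen in such a way that $\iota^\ast\mathrm d^LF=0$, $\iota^\ast\mathrm d^RF=0$ and $\iota^\ast F=0$.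
   Context: Let $M$ be a smooth manifold, $\pi_L,\pi_R\colon M\times M\to M$ the projections $\pi_L(m,n)=m$, $\pi_R(m,n)=n$, $\iota\colon M\to M\times M$, $\iota(m)=(m,m)$ the diagonal embedding with image $\Delta_M$, and $s\colon M\times M\to M\times M$, $s(m,n)=(n,m)$ the swap map. Bi-forms: for $p,q\in\mathbb N_0$, a $(p,q)$-bi-form on $M$ is a smooth section of the vector bundle $\bigwedge^p\pi_L^\ast T^\vee M\otimes\bigwedge^q\pi_R^\ast T^\vee M$ over $M\times M$, where $T^\vee M$ is the cotangent bundle. The space of these is $\Omega^{p,q}(M\mid M)$; in particular $\Omega^{0,0}(M\mid M)=C^\infty(M\times M)$. $\Omega^{p,q}_{\Delta_M}(M\mid M)$ denotes the space of $(p,q)$-bi-forms defined on an open neighborhood of $\Delta_M$ in $M\times M$; all operations below are local and apply to it as well, and an equality between such a bi-form and a globally defined one is understood on the domain of the former. For vector fields $X_1,\dots,X_p,Y_1,\dots,Y_q$ on $M$, one gets a smooth function $\varpi(X_1,\dots,X_p\mid Y_1,\dots,Y_q)(m,n)=\varpi(X_1(m),\dots,X_p(m)\mid Y_1(n),\dots,Y_q(n))$ on the domain of $\varpi$. Operators: (1) $\iota^\ast\varpi$ is the covariant tensor on $M$, i.e. the element of $\Omega^p(M)\otimes_{C^\infty(M)}\Omega^q(M)$, given by $(\iota^\ast\varpi)(Z_1,\dots,Z_{p+q})=\iota^\ast\big(\varpi(Z_1,\dots,Z_p\mid Z_{p+1},\dots,Z_{p+q})\big)$. (2) $s^\ast$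 maps $(p,q)$-bi-forms to $(q,p)$-bi-forms by $(s^\ast\varpi)(X_1,\dots,X_q\mid Y_1,\dots,Y_p)=s^\ast\big(\varpi(Y_1,\dots,Y_p\mid X_1,\dots,X_q)\big)$. (3) For a vector field $X$ on $M$, its $\pi_L$-horizontal lift $X^L$ is the vector field $X^L(m,n)=(X(m),0)$ on $M\times M$. The left differential $\mathrm d^L$ maps $(p,q)$-bi-forms to $(p+1,q)$-bi-forms by $$\mathrm d^L\varpi(X_0,\dots,X_p\mid Y_1,\dots,Y_q)=\sum_{i=0}^p(-1)^i\mathcal L_{X_i^L}\big(\varpi(X_0,\dots,\check X_i,\dots,X_p\mid Y_1,\dots,Y_q)\big)+\sum_{0\le a<b\le p}(-1)^{a+b}\varpi([X_a,X_b],X_0,\dots,\check X_a,\dots,\check X_b,\dots,X_p\mid Y_1,\dots,Y_q),$$ where a check denotes omission. (4) The right differential $\mathrm d^R$ maps $(p,q)$-bi-forms to $(p,q+1)$-bi-forms by $\mathrm d^R\varpi=s^\ast\big(\mathrm d^L(s^\ast\varpi)\big)$. Contrast bi-forms: a contrast bi-form on $M$ is an element $\varpi\in\Omega^{1,1}_{\Delta_M}(M\mid M)$ such that $g^\varpi:=\iota^\ast\varpi$ is a pseudo-Riemannian metric on $M$. Its induced affine connection $\nabla^\varpi$ is defined by $g^\varpi(\nabla^\varpi_ZX,Y)=\iota^\ast\big(\mathcal L_{Z^L}(\varpi(X\mid Y))\big)$ for all vector fields $X,Y,Z$ on $M$. Statistical manifold: a triple $(M,g,\nabla)$ with $g$ a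 pseudo-Riemannian metric on $M$ and $\nabla$ an affine connection on $M$ such that both $\nabla$ and its $g$-conjugate connection $\nabla^\dagger$, defined by $Z(g(X,Y))=g(\nabla_ZX,Y)+g(X,\nabla^\dagger_ZY)$, are torsion-free. *)

theory Defs
  imports "HOL-Analysis.Analysis"
begin

section \<open>Smooth manifolds\<close>

text \<open>Continuous differentiability of order \<open>k\<close> on an \<^emph>\<open>open\<close> subset of a
  finite-dimensional normed space, by iterated directional derivatives.\<close>

primrec Ck_on :: "nat \<Rightarrow> 'v::real_normed_vector set \<Rightarrow> ('v \<Rightarrow> 'w::real_normed_vector) \<Rightarrow> bool" where
  "Ck_on 0 S f \<longleftrightarrow> continuous_on S f"
| "Ck_on (Suc k) S f \<longleftrightarrow>
     f differentiable_on S \<and> (\<forall>v. Ck_on k S (\<lambda>x. frechet_derivative f (at x) v))"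

definition smooth_on :: "'v::real_normed_vector set \<Rightarrow> ('v \<Rightarrow> 'w::real_normed_vector) \<Rightarrow> bool" where
  "smooth_on S f \<longleftrightarrow> (\<forall>k. Ck_on k S f)"

type_synonym ('a, 'e) chart = "'a set \<times> ('a \<Rightarrow> 'e)"

text \<open>The manifold is the whole type \<open>'a\<close> with its (Hausdorff, second countable) topology,
  and its smooth structure is the one generated by the atlas. A real inner product space with
  the Heine-Borel property is the same as a finite-dimensional one; unlike the class
  \<^class>\<open>euclidean_space\<close>, which is contained in this sort, it does not exclude dimension 0.\<close>

locale smooth_manifold =
  fixes A :: "('a::{t2_space,second_countable_topology}, 'e::{real_inner,heine_borel}) chart set"
  assumes chart: "\<And>U \<phi>. (U, \<phi>) \<in> A \<Longrightarrow>
      open U \<and> open (\<phi> ` U) \<and> homeomorphism U (\<phi> ` U) \<phi> (inv_into U \<phi>)"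
    and compatible: "\<And>U \<phi> V \<psi>. (U, \<phi>) \<in> A \<Longrightarrow> (V, \<psi>) \<in> A \<Longrightarrow>
      smooth_on (\<phi> ` (U \<inter> V)) (\<psi> \<circ> inv_into U \<phi>)"
    and cover: "(\<Union>(U, \<phi>) \<in> A. U) = UNIV"

definition prod_atlas ::
  "('a, 'e) chart set \<Rightarrow> ('b, 'f) chart set \<Rightarrow> ('a \<times> 'b, 'e \<times> 'f) chart set" where
  "prod_atlas A B = {(U \<times> V, map_prod \<phi> \<psi>) | U \<phi> V \<psi>. (U, \<phi>) \<in> A \<and> (V, \<psi>) \<in> B}"

definition smooth_fun ::
  "('a::topological_space, 'e::real_normed_vector) chart set \<Rightarrow> 'a set \<Rightarrow> ('a \<Rightarrow> real) \<Rightarrow> bool" where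
  "smooth_fun A W f \<longleftrightarrow>
     open W \<and> (\<forall>(U, \<phi>) \<in> A. smooth_on (\<phi> ` (U \<inter> W)) (f \<circ> inv_into U \<phi>))"

definition smooth_at ::
  "('a::topological_space, 'e::real_normed_vector) chart set \<Rightarrow> 'a \<Rightarrow> ('a \<Rightarrow> real) \<Rightarrow> bool" where
  "smooth_at A m f \<longleftrightarrow> (\<exists>W. m \<in> W \<and> smooth_fun A W f)"


section \<open>Tangent vectors and vector fields\<close>

text \<open>Tangent vectors at \<open>m\<close> are the derivations of the algebra of germs at \<open>m\<close> of smooth
  functions. They are made total, and thereby extensional, by the value 0 on functions that are
  not smooth near \<open>m\<close>.\<close>

type_synonym 'a tangent = "('a \<Rightarrow> real) \<Rightarrow> real"

definition tangent_space ::
  "('a::topological_space, 'e::real_normed_vector) chart set \<Rightarrow> 'a \<Rightarrow> 'a tangent set" where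
  "tangent_space A m = {v.
     (\<forall>f. \<not> smooth_at A m f \<longrightarrow> v f = 0) \<and>
     (\<forall>f g. smooth_at A m f \<and> smooth_at A m g \<and> (\<forall>\<^sub>F x in nhds m. f x = g x) \<longrightarrow> v f = v g) \<and>
     (\<forall>f g a b. smooth_at A m f \<and> smooth_at A m g \<longrightarrow>
        v (\<lambda>x. a * f x + b * g x) = a * v f + b * v g) \<and>
     (\<forall>f g. smooth_at A m f \<and> smooth_at A m g \<longrightarrow>
        v (\<lambda>x. f x * g x) = v f * g m + f m * v g)}"

definition lincomb :: "real \<Rightarrow> 'a tangent \<Rightarrow> real \<Rightarrow> 'a tangent \<Rightarrow> 'a tangent" where
  "lincomb a u b v = (\<lambda>f. a * u f + b * v f)"

type_synonym 'a field = "'a \<Rightarrow> 'a tangent"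

definition vector_fields ::
  "('a::topological_space, 'e::real_normed_vector) chart set \<Rightarrow> 'a field set" where
  "vector_fields A = {X. (\<forall>m. X m \<in> tangent_space A m) \<and>
     (\<forall>U f. smooth_fun A U f \<longrightarrow> smooth_fun A U (\<lambda>m. X m f))}"

definition lie_deriv :: "'a field \<Rightarrow> ('a \<Rightarrow> real) \<Rightarrow> 'a \<Rightarrow> real" where
  "lie_deriv X f = (\<lambda>m. X m f)"

definition lie_bracket ::
  "('a::topological_space, 'e::real_normed_vector) chart set \<Rightarrow> 'a field \<Rightarrow> 'a field \<Rightarrow> 'a field" where
  "lie_bracket A X Y = (\<lambda>m f. if smooth_at A m f
     then X m (lie_deriv Y f) - Y m (lie_deriv X f) else 0)"

text \<open>The identification of the direct sum of the tangent spaces at \<open>m\<close> and \<open>n\<close> with the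
  tangent space of the product manifold at \<open>(m, n)\<close>.\<close>

definition tangent_pair ::
  "('a::topological_space, 'e::real_normed_vector) chart set \<Rightarrow> 'a \<times> 'a \<Rightarrow>
     'a tangent \<Rightarrow> 'a tangent \<Rightarrow> ('a \<times> 'a) tangent" where
  "tangent_pair A = (\<lambda>(m, n) v w h. if smooth_at (prod_atlas A A) (m, n) h
     then v (\<lambda>x. h (x, n)) + w (\<lambda>y. h (m, y)) else 0)"

definition left_lift ::
  "('a::topological_space, 'e::real_normed_vector) chart set \<Rightarrow> 'a field \<Rightarrow> ('a \<times> 'a) field" where
  "left_lift A X = (\<lambda>(m, n). tangent_pair A (m, n) (X m) (\<lambda>_. 0))"


section \<open>Bi-forms\<close>

text \<open>Multilinear functions of \<open>k\<close> arguments from \<open>T\<close> are functions on lists; only their values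
  on lists of length \<open>k\<close> with entries in \<open>T\<close> are meaningful.\<close>

definition args :: "nat \<Rightarrow> 'a tangent set \<Rightarrow> 'a tangent list set" where
  "args k T = {vs. length vs = k \<and> set vs \<subseteq> T}"

definition multilinear :: "nat \<Rightarrow> 'a tangent set \<Rightarrow> ('a tangent list \<Rightarrow> real) \<Rightarrow> bool" where
  "multilinear k T \<alpha> \<longleftrightarrow> (\<forall>vs \<in> args k T. \<forall>i<k. \<forall>u\<in>T. \<forall>w\<in>T. \<forall>a b.
     \<alpha> (vs[i := lincomb a u b w]) = a * \<alpha> (vs[i := u]) + b * \<alpha> (vs[i := w]))"

definition alternating :: "nat \<Rightarrow> 'a tangent set \<Rightarrow> ('a tangent list \<Rightarrow> real) \<Rightarrow> bool" where
  "alternating k T \<alpha> \<longleftrightarrow>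
     (\<forall>vs \<in> args k T. \<forall>j<k. \<forall>i<j. vs ! i = vs ! j \<longrightarrow> \<alpha> vs = 0)"

type_synonym 'a biform = "'a \<times> 'a \<Rightarrow> 'a tangent list \<Rightarrow> 'a tangent list \<Rightarrow> real"

definition biform_eval :: "'a biform \<Rightarrow> 'a field list \<Rightarrow> 'a field list \<Rightarrow> 'a \<times> 'a \<Rightarrow> real" where
  "biform_eval \<omega> Xs Ys = (\<lambda>(m, n). \<omega> (m, n) (map (\<lambda>X. X m) Xs) (map (\<lambda>Y. Y n) Ys))"

text \<open>The \<open>(p, q)\<close>-bi-forms with domain \<open>W\<close>; values outside \<open>W\<close> are irrelevant. Smoothness of
  the section is tested on vector fields, which is the same as smoothness of its components with
  respect to local frames.\<close>

definition biforms ::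
  "('a::topological_space, 'e::real_normed_vector) chart set \<Rightarrow> ('a \<times> 'a) set \<Rightarrow> nat \<Rightarrow> nat \<Rightarrow>
     'a biform set" where
  "biforms A W p q = {\<omega>. open W \<and>
     (\<forall>(m, n) \<in> W.
        (\<forall>ws \<in> args q (tangent_space A n).
           multilinear p (tangent_space A m) (\<lambda>vs. \<omega> (m, n) vs ws) \<and>
           alternating p (tangent_space A m) (\<lambda>vs. \<omega> (m, n) vs ws)) \<and>
        (\<forall>vs \<in> args p (tangent_space A m).
           multilinear q (tangent_space A n) (\<lambda>ws. \<omega> (m, n) vs ws) \<and>
           alternating q (tangent_space A n) (\<lambda>ws. \<omega> (m, n) vs ws))) \<and>
     (\<forall>Xs Ys. length Xs = p \<and> set Xs \<subseteq> vector_fields A \<and>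
        length Ys = q \<and> set Ys \<subseteq> vector_fields A \<longrightarrow>
        smooth_fun (prod_atlas A A) W (biform_eval \<omega> Xs Ys))}"

definition biform_eq_on ::
  "('a::topological_space, 'e::real_normed_vector) chart set \<Rightarrow> ('a \<times> 'a) set \<Rightarrow> nat \<Rightarrow> nat \<Rightarrow>
     'a biform \<Rightarrow> 'a biform \<Rightarrow> bool" where
  "biform_eq_on A W p q \<omega> \<eta> \<longleftrightarrow> (\<forall>(m, n) \<in> W.
     \<forall>vs \<in> args p (tangent_space A m). \<forall>ws \<in> args q (tangent_space A n).
       \<omega> (m, n) vs ws = \<eta> (m, n) vs ws)"

definition swap_biform :: "'a biform \<Rightarrow> 'a biform" where
  "swap_biform \<omega> = (\<lambda>(m, n) vs ws. \<omega> (n, m) ws vs)"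

text \<open>The defining formula of the left differential on vector fields is tensorial, so its value
  on tangent vectors is obtained from arbitrary vector fields through these. The degree \<open>p\<close> is
  read off from the number of left arguments, and \<open>nths Xs (- {i})\<close> omits the entry with
  index \<open>i\<close>.\<close>

definition left_diff_fields ::
  "('a::topological_space, 'e::real_normed_vector) chart set \<Rightarrow> 'a biform \<Rightarrow>
     'a field list \<Rightarrow> 'a field list \<Rightarrow> 'a \<times> 'a \<Rightarrow> real" where
  "left_diff_fields A \<omega> Xs Ys = (\<lambda>z.
     (\<Sum>i<length Xs. (-1) ^ i *
        lie_deriv (left_lift A (Xs ! i)) (biform_eval \<omega> (nths Xs (- {i})) Ys) z) +
     (\<Sum>b<length Xs. \<Sum>a<b. (-1) ^ (a + b) *
        biform_eval \<omega> (lie_bracket A (Xs ! a) (Xs ! b) # nths Xs (- {a, b})) Ys z))"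

definition field_through ::
  "('a::topological_space, 'e::real_normed_vector) chart set \<Rightarrow> 'a \<Rightarrow> 'a tangent \<Rightarrow> 'a field" where
  "field_through A m v = (SOME X. X \<in> vector_fields A \<and> X m = v)"

definition left_diff ::
  "('a::topological_space, 'e::real_normed_vector) chart set \<Rightarrow> 'a biform \<Rightarrow> 'a biform" where
  "left_diff A \<omega> = (\<lambda>(m, n) vs ws.
     left_diff_fields A \<omega> (map (field_through A m) vs) (map (field_through A n) ws) (m, n))"

definition right_diff ::
  "('a::topological_space, 'e::real_normed_vector) chart set \<Rightarrow> 'a biform \<Rightarrow> 'a biform" where
  "right_diff A \<omega> = swap_biform (left_diff A (swap_biform \<omega>))"


section \<open>Metrics, connections and statistical manifolds\<close>

type_synonym 'a cotensor = "'a \<Rightarrow> 'a tangent list \<Rightarrow> real"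

definition cotensors ::
  "('a::topological_space, 'e::real_normed_vector) chart set \<Rightarrow> nat \<Rightarrow> 'a cotensor set" where
  "cotensors A k = {g. (\<forall>m. multilinear k (tangent_space A m) (g m)) \<and>
     (\<forall>Xs. length Xs = k \<and> set Xs \<subseteq> vector_fields A \<longrightarrow>
        smooth_fun A UNIV (\<lambda>m. g m (map (\<lambda>X. X m) Xs)))}"

definition cotensor_eq ::
  "('a::topological_space, 'e::real_normed_vector) chart set \<Rightarrow> nat \<Rightarrow>
     'a cotensor \<Rightarrow> 'a cotensor \<Rightarrow> bool" where
  "cotensor_eq A k g h \<longleftrightarrow> (\<forall>m. \<forall>vs \<in> args k (tangent_space A m). g m vs = h m vs)"

definition diag_pullback :: "nat \<Rightarrow> 'a biform \<Rightarrow> 'a cotensor" where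
  "diag_pullback p \<omega> = (\<lambda>m vs. \<omega> (m, m) (take p vs) (drop p vs))"

definition pseudo_riemannian ::
  "('a::topological_space, 'e::real_normed_vector) chart set \<Rightarrow> 'a cotensor \<Rightarrow> bool" where
  "pseudo_riemannian A g \<longleftrightarrow> g \<in> cotensors A 2 \<and>
     (\<forall>m. \<forall>u \<in> tangent_space A m. \<forall>v \<in> tangent_space A m. g m [u, v] = g m [v, u]) \<and>
     (\<forall>m. \<forall>u \<in> tangent_space A m.
        (\<forall>v \<in> tangent_space A m. g m [u, v] = 0) \<longrightarrow> u = (\<lambda>_. 0))"

text \<open>\<open>N Z X\<close> is the covariant derivative of \<open>X\<close> along \<open>Z\<close>.\<close>

type_synonym 'a connection = "'a field \<Rightarrow> 'a field \<Rightarrow> 'a field"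

definition affine_connection ::
  "('a::topological_space, 'e::real_normed_vector) chart set \<Rightarrow> 'a connection \<Rightarrow> bool" where
  "affine_connection A N \<longleftrightarrow>
     (\<forall>Z \<in> vector_fields A. \<forall>X \<in> vector_fields A. N Z X \<in> vector_fields A) \<and>
     (\<forall>Z \<in> vector_fields A. \<forall>Z' \<in> vector_fields A. \<forall>X \<in> vector_fields A. \<forall>f h.
        smooth_fun A UNIV f \<and> smooth_fun A UNIV h \<longrightarrow>
        N (\<lambda>m. lincomb (f m) (Z m) (h m) (Z' m)) X =
          (\<lambda>m. lincomb (f m) (N Z X m) (h m) (N Z' X m))) \<and>
     (\<forall>Z \<in> vector_fields A. \<forall>X \<in> vector_fields A. \<forall>Y \<in> vector_fields A. \<forall>a b.
        N Z (\<lambda>m. lincomb a (X m) b (Y m)) = (\<lambda>m. lincomb a (N Z X m) b (N Z Y m))) \<and>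
     (\<forall>Z \<in> vector_fields A. \<forall>X \<in> vector_fields A. \<forall>f. smooth_fun A UNIV f \<longrightarrow>
        N Z (\<lambda>m v. f m * X m v) = (\<lambda>m. lincomb (f m) (N Z X m) (lie_deriv Z f m) (X m)))"

definition connection_eq ::
  "('a::topological_space, 'e::real_normed_vector) chart set \<Rightarrow>
     'a connection \<Rightarrow> 'a connection \<Rightarrow> bool" where
  "connection_eq A N N' \<longleftrightarrow>
     (\<forall>Z \<in> vector_fields A. \<forall>X \<in> vector_fields A. N Z X = N' Z X)"

definition torsion_free ::
  "('a::topological_space, 'e::real_normed_vector) chart set \<Rightarrow> 'a connection \<Rightarrow> bool" where
  "torsion_free A N \<longleftrightarrow> (\<forall>X \<in> vector_fields A. \<forall>Y \<in> vector_fields A.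
     (\<lambda>m. lincomb 1 (N X Y m) (-1) (N Y X m)) = lie_bracket A X Y)"

definition conjugate_connection ::
  "('a::topological_space, 'e::real_normed_vector) chart set \<Rightarrow> 'a cotensor \<Rightarrow>
     'a connection \<Rightarrow> 'a connection" where
  "conjugate_connection A g N Z Y = (THE V. V \<in> vector_fields A \<and>
     (\<forall>X \<in> vector_fields A. \<forall>m.
        lie_deriv Z (\<lambda>x. g x [X x, Y x]) m = g m [N Z X m, Y m] + g m [X m, V m]))"

definition statistical_manifold ::
  "('a::{t2_space,second_countable_topology}, 'e::{real_inner,heine_borel}) chart set \<Rightarrow>
     'a cotensor \<Rightarrow> 'a connection \<Rightarrow> bool" where
  "statistical_manifold A g N \<longleftrightarrow> smooth_manifold A \<and>
     pseudo_riemannian A g \<and> affine_connection A N \<and>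
     torsion_free A N \<and> torsion_free A (conjugate_connection A g N)"


section \<open>Contrast bi-forms\<close>

abbreviation (input) induced_metric :: "'a biform \<Rightarrow> 'a cotensor" where
  "induced_metric \<equiv> diag_pullback 1"

definition contrast_biform ::
  "('a::topological_space, 'e::real_normed_vector) chart set \<Rightarrow> ('a \<times> 'a) set \<Rightarrow>
     'a biform \<Rightarrow> bool" where
  "contrast_biform A W \<omega> \<longleftrightarrow> (\<forall>m. (m, m) \<in> W) \<and> \<omega> \<in> biforms A W 1 1 \<and>
     pseudo_riemannian A (induced_metric \<omega>)"

definition induced_connection ::
  "('a::topological_space, 'e::real_normed_vector) chart set \<Rightarrow> 'a biform \<Rightarrow> 'a connection" where
  "induced_connection A \<omega> Z X = (THE V. V \<in> vector_fields A \<and>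
     (\<forall>Y \<in> vector_fields A. \<forall>m. induced_metric \<omega> m [V m, Y m] =
        lie_deriv (left_lift A Z) (biform_eval \<omega> [X] [Y]) (m, m)))"

end

theory Submission
  imports Defs
begin

text \<open>For a bi-exact bi-form the induced connection and its conjugate are given by
  \<open>g(\<nabla>\<^sub>Z X, Y) = Z\<^sup>L X\<^sup>L Y\<^sup>R F\<close> and \<open>g(X, \<nabla>\<^sup>\<dagger>\<^sub>Z Y) = Z\<^sup>R Y\<^sup>R X\<^sup>L F\<close> on the diagonal, and both
  expressions are torsion-free because commutators of vector fields act as derivations in one
  variable.

  Conversely, let \<open>E\<^sub>i\<close> be coordinate fields. On the diagonal, torsion-freeness of the two
  connections makes \<open>E\<^sub>k\<^sup>L \<omega>(E\<^sub>i | E\<^sub>j)\<close> symmetric in \<open>k, i\<close> and \<open>E\<^sub>k\<^sup>R \<omega>(E\<^sub>i | E\<^sub>j)\<close> symmetric in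
  \<open>k, j\<close>, and their sum is symmetric in \<open>i, j\<close> because the metric is. With these symmetries a
  quadratic expression in the coordinate differences, with coefficients taken from \<open>\<omega>\<close>, has the
  required derivatives up to order three on the diagonal. Local solutions are patched with a partition of
  unity in the left variable: all of them have the same lower-order derivatives on the diagonal, so
  the derivatives of the partition functions enter only through their sum, which is constant.\<close>

section \<open>Smooth functions on finite-dimensional spaces\<close>

text \<open>Metric and connection see a bi-form only through its values on the diagonal and one left
  derivative there; the right derivative is then fixed by differentiating the metric along the
  diagonal, so the conjugate connection needs no separate matching. Hence part (ii) asks for a
  function with a prescribed third-order jet along the diagonal, and the torsion conditions are its
  integrability conditions: repeated derivatives in one variable are symmetric. The difference of
  the two connections is a totally symmetric cubic form; making this form drop out fixes the ratio
  of the weights in the quadratic expression.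

  Tangent vectors are abstract derivations, and the differentials and connections are obtained by
  choice or definite description. Before anything can be computed, derivations must be expanded in
  coordinates (Hadamard's lemma), tangent vectors extended to global fields (bump functions), and
  smooth fields recovered from their pairing with the metric (a linear system over germs).\<close>

definition onb :: "'e::{real_inner,heine_borel} set" where
  "onb = (SOME B. finite B \<and> (\<forall>b\<in>B. \<forall>c\<in>B. b \<bullet> c = (if b = c then 1 else 0)) \<and>
     (\<forall>x. (\<Sum>b\<in>B. (x \<bullet> b) *\<^sub>R b) = x))"

text \<open>An orthonormal set of largest cardinality works: if some x differed from its projection,
  the normalised difference would be one more orthonormal vector. Total boundedness of the unit ball
  bounds the cardinality. In dimension 0 the basis is empty.\<close>

lemma ex_orthonormal_basis:
  "\<exists>B::'e::{real_inner,heine_borel} set. finite B \<and>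
     (\<forall>b\<in>B. \<forall>c\<in>B. b \<bullet> c = (if b = c then 1 else 0)) \<and> (\<forall>x. (\<Sum>b\<in>B. (x \<bullet> b) *\<^sub>R b) = x)"
proof -
  define P where "P = (\<lambda>B::'e set. finite B \<and> (\<forall>b\<in>B. \<forall>c\<in>B. b \<bullet> c = (if b = c then 1 else 0)))"
  have "compact (cball (0::'e) 1)"
    by (simp add: compact_eq_bounded_closed)
  then obtain K where K: "finite K" "cball (0::'e) 1 \<subseteq> (\<Union>x\<in>K. ball x (1/2))"
    using compact_imp_seq_compact seq_compact_imp_totally_bounded by (metis zero_less_divide_1_iff zero_less_numeral)
  \<comment> \<open>Distinct orthonormal vectors have squared distance 2, whereas two points of one
    ball of radius 1/2 are less than 1 apart. So B injects into the finite net K.\<close>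
  have bound: "card B < Suc (card K)" if B: "P B" for B
  proof -
    have "\<forall>b\<in>B. \<exists>x\<in>K. dist x b < 1/2"
    proof
      fix b assume "b \<in> B"
      then have "b \<bullet> b = 1" using B by (auto simp: P_def)
      then have "norm b = 1" by (simp add: norm_eq_1)
      then have "b \<in> cball 0 1" by simp
      then show "\<exists>x\<in>K. dist x b < 1/2" using K(2) by (auto simp: subset_iff)
    qed
    then obtain h where h: "\<And>b. b \<in> B \<Longrightarrow> h b \<in> K \<and> dist (h b) b < 1/2" by metis
    have "inj_on h B"
    proof (rule inj_onI, rule ccontr)
      fix b c assume bc: "b \<in> B" "c \<in> B" "h b = h c" "b \<noteq> c"
      have "dist b c < 1"
        using h[OF bc(1)] h[OF bc(2)] bc(3) dist_triangle3[of b c "h b"] by simp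
      then have "norm (b - c) ^ 2 < 1"
        by (simp add: dist_norm power_less_one_iff)
      moreover have "norm (b - c) ^ 2 = 2"
        using B bc by (simp add: P_def power2_norm_eq_inner inner_diff)
      ultimately show False by simp
    qed
    then show ?thesis
      using card_inj_on_le[of h B K] h K(1) by (auto simp: less_Suc_eq_le)
  qed
  have "P {}" by (simp add: P_def)
  then obtain B where B: "P B" "\<And>C. P C \<Longrightarrow> card C \<le> card B"
    using ex_has_greatest_nat[of P "{}" card] bound by blast
  have fin: "finite B" and on: "\<And>b c. b \<in> B \<Longrightarrow> c \<in> B \<Longrightarrow> b \<bullet> c = (if b = c then 1 else 0)"
    using B(1) by (auto simp: P_def)
  have "(\<Sum>b\<in>B. (x \<bullet> b) *\<^sub>R b) = x" for x
  proof (rule ccontr)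
    define y where "y = x - (\<Sum>b\<in>B. (x \<bullet> b) *\<^sub>R b)"
    assume "\<not> ?thesis"
    then have y0: "y \<noteq> 0" by (simp add: y_def)
    have yb: "y \<bullet> c = 0" if "c \<in> B" for c
    proof -
      have "(\<Sum>b\<in>B. (x \<bullet> b) * (b \<bullet> c)) = (\<Sum>b\<in>B. if b = c then x \<bullet> b else 0)"
        by (rule sum.cong) (auto simp: on that)
      then show ?thesis using that fin by (simp add: y_def inner_diff_left inner_sum_left)
    qed
    define z where "z = (1 / norm y) *\<^sub>R y"
    have zz: "z \<bullet> z = 1" using y0 by (simp add: z_def dot_square_norm power2_eq_square)
    have zb: "z \<bullet> c = 0" "c \<bullet> z = 0" if "c \<in> B" for c
      using yb[OF that] by (auto simp: z_def inner_commute)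
    have nB: "z \<notin> B" using zb zz by force
    have "P (insert z B)" using fin on zz zb nB by (auto simp: P_def)
    then have "card (insert z B) \<le> card B" by (rule B(2))
    then show False using fin nB by simp
  qed
  then show ?thesis using fin on by blast
qed

lemma onb_props:
  shows finite_onb [simp, intro]: "finite (onb :: 'e::{real_inner,heine_borel} set)"
    and inner_onb: "\<And>b c. b \<in> onb \<Longrightarrow> c \<in> onb \<Longrightarrow> (b::'e) \<bullet> c = (if b = c then 1 else 0)"
    and onb_expansion: "\<And>x::'e. (\<Sum>b\<in>onb. (x \<bullet> b) *\<^sub>R b) = x"
  using someI_ex[OF ex_orthonormal_basis] unfolding onb_def[symmetric] by blast+

lemma linear_onb_expansion:
  fixes f :: "'e::{real_inner,heine_borel} \<Rightarrow> 'w::real_normed_vector"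
  assumes "linear f"
  shows "f x = (\<Sum>b\<in>onb. (x \<bullet> b) *\<^sub>R f b)"
  by (subst onb_expansion[of x, symmetric])
    (simp add: linear_sum[OF assms] linear_scale[OF assms])

section \<open>Calculus of iterated directional derivatives\<close>

lemma Ck_on_cong:
  assumes "open S" "\<And>x. x \<in> S \<Longrightarrow> f x = g x" "Ck_on k S f"
  shows "Ck_on k S g"
  using assms(2,3)
proof (induction k arbitrary: f g)
  case 0
  then have "continuous_on S f" by simp
  then have "continuous_on S g" by (rule continuous_on_eq) (rule 0)
  then show ?case by simp
next
  case (Suc k)
  have d: "f differentiable (at x)" if "x \<in> S" for x
    using Suc.prems(2) that assms(1) by (auto simp: differentiable_on_eq_differentiable_at)
  have fd: "frechet_derivative f (at x) = frechet_derivative g (at x)" if "x \<in> S" for x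
    using frechet_derivative_transform_within_open[OF d[OF that] assms(1) that] Suc.prems(1) by blast
  have "g differentiable (at x)" if "x \<in> S" for x
  proof -
    obtain D where "(f has_derivative D) (at x)" using d[OF \<open>x \<in> S\<close>] unfolding differentiable_def by blast
    then have "(g has_derivative D) (at x)"
      by (rule has_derivative_transform_within_open[OF _ assms(1) that Suc.prems(1)])
    then show ?thesis by (auto simp: differentiable_def)
  qed
  then have "g differentiable_on S"
    by (meson differentiable_at_imp_differentiable_on)
  moreover have "Ck_on k S (\<lambda>x. frechet_derivative g (at x) v)" for v
    by (rule Suc.IH[of "\<lambda>x. frechet_derivative f (at x) v"]) (use fd Suc.prems(2) in auto)
  ultimately show ?case by simp
qed

text \<open>Working form of the successor case: an explicit derivative, in whatever shape suits the
  induction, replaces \<open>frechet_derivative\<close>.\<close>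

lemma Ck_on_SucI:
  assumes "open S" "\<And>x. x \<in> S \<Longrightarrow> (f has_derivative f' x) (at x)"
    and "\<And>v. Ck_on k S (\<lambda>x. f' x v)"
  shows "Ck_on (Suc k) S f"
proof -
  have "f differentiable_on S"
    using assms(1,2) by (auto simp: differentiable_on_def differentiable_def intro: has_derivative_at_withinI)
  moreover have "f' x = frechet_derivative f (at x)" if "x \<in> S" for x
    using assms(2)[OF that] by (rule frechet_derivative_at)
  then have "Ck_on k S (\<lambda>x. frechet_derivative f (at x) v)" for v
    by (intro Ck_on_cong[OF assms(1) _ assms(3)[of v]]) simp
  ultimately show ?thesis by simp
qed

lemma Ck_on_subset: "Ck_on k S f \<Longrightarrow> T \<subseteq> S \<Longrightarrow> Ck_on k T f"
  by (induction k arbitrary: f) (auto intro: continuous_on_subset differentiable_on_subset)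

lemma Ck_on_Suc_imp: "Ck_on (Suc k) S f \<Longrightarrow> Ck_on k S f"
  by (induction k arbitrary: f) (auto intro: differentiable_imp_continuous_on)

lemma Ck_on_has_derivative:
  assumes "Ck_on (Suc k) S f" "open S" "x \<in> S"
  shows "(f has_derivative frechet_derivative f (at x)) (at x)"
  using assms by (auto simp: differentiable_on_eq_differentiable_at frechet_derivative_works)

lemma Ck_on_local:
  assumes "\<And>x. x \<in> S \<Longrightarrow> \<exists>T. open T \<and> x \<in> T \<and> Ck_on k T f"
  shows "Ck_on k S f"
  using assms
proof (induction k arbitrary: f)
  case 0
  then show ?case
    unfolding Ck_on.simps by (meson continuous_at_imp_continuous_on continuous_on_eq_continuous_at)
next
  case (Suc k)
  have "f differentiable (at x)" if "x \<in> S" for x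
    using Suc.prems[OF that] Ck_on_has_derivative by (metis differentiable_def)
  then have "f differentiable_on S" by (meson differentiable_at_imp_differentiable_on)
  moreover have "Ck_on k S (\<lambda>x. frechet_derivative f (at x) v)" for v
  proof (rule Suc.IH)
    fix x assume "x \<in> S"
    then obtain T where T: "open T" "x \<in> T" "Ck_on (Suc k) T f" using Suc.prems by blast
    then have "Ck_on k T (\<lambda>x. frechet_derivative f (at x) v)" by simp
    with T show "\<exists>T. open T \<and> x \<in> T \<and> Ck_on k T (\<lambda>x. frechet_derivative f (at x) v)" by blast
  qed
  ultimately show ?case by simp
qed

lemma Ck_on_const: "open S \<Longrightarrow> Ck_on k S (\<lambda>x. c)"
proof (induction k arbitrary: c)
  case (Suc k)
  show ?case
    by (rule Ck_on_SucI[where f' = "\<lambda>x v. 0"]) (use Suc in auto)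
qed simp

lemma Ck_on_bounded_linear:
  assumes "open S" "bounded_linear f"
  shows "Ck_on k S f"
proof (cases k)
  case 0
  then show ?thesis
    using assms(2) by (simp add: linear_continuous_on)
next
  case (Suc k)
  show ?thesis unfolding Suc
    by (rule Ck_on_SucI[where f' = "\<lambda>x. f"])
      (use assms in \<open>auto intro: Ck_on_const bounded_linear_imp_has_derivative\<close>)
qed

lemma Ck_on_add:
  assumes "open S" "Ck_on k S f" "Ck_on k S g"
  shows "Ck_on k S (\<lambda>x. f x + g x)"
  using assms(2,3)
proof (induction k arbitrary: f g)
  case 0
  then show ?case by (auto intro: continuous_on_add)
next
  case (Suc k)
  show ?case
    by (rule Ck_on_SucI[where f' = "\<lambda>x v. frechet_derivative f (at x) v + frechet_derivative g (at x) v"])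
      (use assms(1) Suc in \<open>auto intro!: has_derivative_add Ck_on_has_derivative\<close>)
qed

lemma Ck_on_sum:
  assumes "open S" "\<And>i. i \<in> I \<Longrightarrow> Ck_on k S (f i)"
  shows "Ck_on k S (\<lambda>x. \<Sum>i\<in>I. f i x)"
  using assms(2)
  by (induction I rule: infinite_finite_induct) (auto intro: Ck_on_const Ck_on_add assms(1))

text \<open>The Leibniz rule expresses the derivative by two terms of the same bilinear shape, so
  one induction serves products, scalar multiples and inner products alike.\<close>

lemma Ck_on_bilinear:
  assumes "open S" "bounded_bilinear pr" "Ck_on k S f" "Ck_on k S g"
  shows "Ck_on k S (\<lambda>x. pr (f x) (g x))"
  using assms(3,4)
proof (induction k arbitrary: f g)
  case 0
  then show ?case by (auto intro: bounded_bilinear.continuous_on[OF assms(2)])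
next
  case (Suc k)
  have f: "Ck_on k S f" "\<And>v. Ck_on k S (\<lambda>x. frechet_derivative f (at x) v)"
    and g: "Ck_on k S g" "\<And>v. Ck_on k S (\<lambda>x. frechet_derivative g (at x) v)"
    using Suc.prems by (blast intro: Ck_on_Suc_imp, simp, blast intro: Ck_on_Suc_imp, simp)
  show ?case
  proof (rule Ck_on_SucI[where f' = "\<lambda>x v. pr (f x) (frechet_derivative g (at x) v)
      + pr (frechet_derivative f (at x) v) (g x)"])
    show "((\<lambda>x. pr (f x) (g x)) has_derivative (\<lambda>v. pr (f x) (frechet_derivative g (at x) v)
        + pr (frechet_derivative f (at x) v) (g x))) (at x)" if "x \<in> S" for x
      using bounded_bilinear.FDERIV[OF assms(2) Ck_on_has_derivative[OF Suc.prems(1) assms(1) that]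
          Ck_on_has_derivative[OF Suc.prems(2) assms(1) that]] .
  qed (use assms(1) f g in \<open>auto intro!: Ck_on_add Suc.IH\<close>)
qed

lemmas Ck_on_mult = Ck_on_bilinear[OF _ bounded_bilinear_mult]
lemmas Ck_on_scaleR = Ck_on_bilinear[OF _ bounded_bilinear_scaleR]
lemmas Ck_on_inner = Ck_on_bilinear[OF _ bounded_bilinear_inner]

text \<open>The derivative of 1/f contains 1/f itself, but only order k of it is needed, and that is
  the induction hypothesis.\<close>

lemma Ck_on_inverse:
  fixes f :: "'v::real_normed_vector \<Rightarrow> real"
  assumes "open S" "\<And>x. x \<in> S \<Longrightarrow> f x \<noteq> 0" "Ck_on k S f"
  shows "Ck_on k S (\<lambda>x. inverse (f x))"
  using assms(3)
proof (induction k)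
  case 0
  then show ?case using assms(2) by (auto intro: continuous_on_inverse)
next
  case (Suc k)
  have f: "Ck_on k S f" "\<And>v. Ck_on k S (\<lambda>x. frechet_derivative f (at x) v)"
    using Suc.prems by (blast intro: Ck_on_Suc_imp, simp)
  have i: "Ck_on k S (\<lambda>x. inverse (f x))" by (rule Suc.IH[OF f(1)])
  show ?case
  proof (rule Ck_on_SucI[where f' = "\<lambda>x v. (-1) * (inverse (f x) * frechet_derivative f (at x) v * inverse (f x))"])
    show "((\<lambda>x. inverse (f x)) has_derivative
        (\<lambda>v. (-1) * (inverse (f x) * frechet_derivative f (at x) v * inverse (f x)))) (at x)" if "x \<in> S" for x
      using Deriv.has_derivative_inverse[OF assms(2)[OF that] Ck_on_has_derivative[OF Suc.prems assms(1) that]]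
      by simp
    show "Ck_on k S (\<lambda>x. (-1) * (inverse (f x) * frechet_derivative f (at x) v * inverse (f x)))" for v
      by (intro Ck_on_mult Ck_on_const f i assms(1))
  qed (rule assms(1))
qed

text \<open>In the chain rule the direction fed to the derivative of f moves with x, so the
  induction hypothesis does not apply directly. Expanding that direction in the orthonormal basis
  leaves finitely many fixed directions b, with coefficients that are of order k in x. This is where
  the middle space has to be finite-dimensional.\<close>

lemma Ck_on_compose:
  fixes g :: "'u::real_normed_vector \<Rightarrow> 'v::{real_inner,heine_borel}"
    and f :: "'v \<Rightarrow> 'w::real_normed_vector"
  assumes "open S" "open T" "g ` S \<subseteq> T" "Ck_on k S g" "Ck_on k T f"
  shows "Ck_on k S (\<lambda>x. f (g x))"
  using assms(4,5)
proof (induction k arbitrary: f)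
  case 0
  then show ?case using continuous_on_compose2[of T f S g] assms(3) by auto
next
  case (Suc k)
  have g: "Ck_on k S g" using Suc.prems by (blast intro: Ck_on_Suc_imp)
  have dg: "Ck_on k S (\<lambda>x. frechet_derivative g (at x) v)" for v using Suc.prems by simp
  have df: "Ck_on k S (\<lambda>x. frechet_derivative f (at (g x)) v)" for v
    by (rule Suc.IH[OF g]) (use Suc.prems in simp)
  have hd: "(f has_derivative frechet_derivative f (at (g x))) (at (g x))" if "x \<in> S" for x
  proof (rule Ck_on_has_derivative[OF Suc.prems(2) assms(2)])
    show "g x \<in> T" using assms(3) that by blast
  qed
  show ?case
  proof (rule Ck_on_SucI[where f' = "\<lambda>x v. \<Sum>b\<in>onb. (frechet_derivative g (at x) v \<bullet> b) *\<^sub>R frechet_derivative f (at (g x)) b"])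
    show "((\<lambda>x. f (g x)) has_derivative (\<lambda>v. \<Sum>b\<in>onb. (frechet_derivative g (at x) v \<bullet> b) *\<^sub>R frechet_derivative f (at (g x)) b)) (at x)"
      if "x \<in> S" for x
    proof -
      have "(\<Sum>b\<in>onb. (frechet_derivative g (at x) v \<bullet> b) *\<^sub>R frechet_derivative f (at (g x)) b)
          = frechet_derivative f (at (g x)) (frechet_derivative g (at x) v)" for v
        by (rule linear_onb_expansion[OF has_derivative_linear[OF hd[OF that]], symmetric])
      then show ?thesis
        using has_derivative_compose[OF Ck_on_has_derivative[OF Suc.prems(1) assms(1) that] hd[OF that]]
        by simp
    qed
    show "Ck_on k S (\<lambda>x. \<Sum>b\<in>onb. (frechet_derivative g (at x) v \<bullet> b) *\<^sub>R frechet_derivative f (at (g x)) b)" for v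
      by (intro Ck_on_sum Ck_on_scaleR Ck_on_inner Ck_on_const dg df assms(1))
  qed (rule assms(1))
qed

section \<open>Germs of smooth functions, so that domains need not be carried along\<close>

definition smooth_near :: "'v::real_normed_vector \<Rightarrow> ('v \<Rightarrow> 'w::real_normed_vector) \<Rightarrow> bool" where
  "smooth_near x f \<longleftrightarrow> (\<exists>S. open S \<and> x \<in> S \<and> smooth_on S f)"

lemma smooth_on_cong:
  assumes "open S" "\<And>x. x \<in> S \<Longrightarrow> f x = g x" "smooth_on S f"
  shows "smooth_on S g"
  using assms Ck_on_cong unfolding smooth_on_def by blast

lemma smooth_on_subset: "smooth_on S f \<Longrightarrow> T \<subseteq> S \<Longrightarrow> smooth_on T f"
  unfolding smooth_on_def using Ck_on_subset by blast

lemma smooth_on_iff_near: "open S \<Longrightarrow> smooth_on S f \<longleftrightarrow> (\<forall>x\<in>S. smooth_near x f)"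
proof
  assume "\<forall>x\<in>S. smooth_near x f"
  then show "smooth_on S f"
    unfolding smooth_on_def smooth_near_def by (meson Ck_on_local)
qed (auto simp: smooth_near_def)

lemma smooth_near_cong:
  assumes "smooth_near x f" "eventually (\<lambda>y. f y = g y) (nhds x)"
  shows "smooth_near x g"
proof -
  obtain S where S: "open S" "x \<in> S" "smooth_on S f" using assms(1) by (auto simp: smooth_near_def)
  obtain T where T: "open T" "x \<in> T" "\<forall>y\<in>T. f y = g y" using assms(2) by (auto simp: eventually_nhds)
  have "smooth_on (S \<inter> T) g"
    by (rule smooth_on_cong[of _ f]) (use S T in \<open>auto intro: smooth_on_subset\<close>)
  then show ?thesis using S T by (auto simp: smooth_near_def)
qed

lemma smooth_near_const: "smooth_near x (\<lambda>_. c)"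
  unfolding smooth_near_def smooth_on_def by (blast intro: Ck_on_const)

lemma smooth_near_bounded_linear: "bounded_linear f \<Longrightarrow> smooth_near x f"
  unfolding smooth_near_def smooth_on_def by (blast intro: Ck_on_bounded_linear)

lemma smooth_near2:
  assumes "smooth_near x f" "smooth_near x g"
  obtains S where "open S" "x \<in> S" "smooth_on S f" "smooth_on S g"
proof -
  obtain S where "open S" "x \<in> S" "smooth_on S f" using assms by (auto simp: smooth_near_def)
  moreover obtain T where "open T" "x \<in> T" "smooth_on T g" using assms by (auto simp: smooth_near_def)
  ultimately show thesis using that[of "S \<inter> T"] by (auto intro: smooth_on_subset)
qed

lemma smooth_near_add:
  assumes "smooth_near x f" "smooth_near x g"
  shows "smooth_near x (\<lambda>x. f x + g x)"
proof -
  obtain S where "open S" "x \<in> S" "smooth_on S f" "smooth_on S g" by (rule smooth_near2[OF assms])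
  then show ?thesis unfolding smooth_near_def smooth_on_def by (auto intro!: exI[of _ S] Ck_on_add)
qed

lemma smooth_near_bilinear:
  assumes "bounded_bilinear pr" "smooth_near x f" "smooth_near x g"
  shows "smooth_near x (\<lambda>x. pr (f x) (g x))"
proof -
  obtain S where "open S" "x \<in> S" "smooth_on S f" "smooth_on S g" by (rule smooth_near2[OF assms(2,3)])
  then show ?thesis unfolding smooth_near_def smooth_on_def by (auto intro!: exI[of _ S] Ck_on_bilinear[OF _ assms(1)])
qed

lemmas smooth_near_mult = smooth_near_bilinear[OF bounded_bilinear_mult]
lemmas smooth_near_inner = smooth_near_bilinear[OF bounded_bilinear_inner]

lemma smooth_near_imp_smooth_on_ball:
  assumes "smooth_near x f"
  obtains e where "e > 0" "smooth_on (ball x e) f"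
proof -
  obtain S where S: "open S" "x \<in> S" "smooth_on S f" using assms by (auto simp: smooth_near_def)
  obtain e where "e > 0" "ball x e \<subseteq> S" using S(1,2) by (auto simp: open_contains_ball)
  then show thesis using that smooth_on_subset[OF S(3)] by blast
qed

lemma smooth_nearE:
  assumes "smooth_near x f"
  obtains S where "open S" "x \<in> S" "\<And>k. Ck_on k S f"
  using assms unfolding smooth_near_def smooth_on_def by blast

lemma smooth_near_isCont: 
  assumes "smooth_near x f" shows "isCont f x"
proof -
  obtain S where S: "open S" "x \<in> S" "Ck_on 0 S f" using smooth_nearE[OF assms] by metis
  then show ?thesis by (simp add: continuous_on_eq_continuous_at)
qed

lemma smooth_near_has_derivative:
  assumes "smooth_near x f"
  shows "(f has_derivative frechet_derivative f (at x)) (at x)"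
proof -
  obtain S where S: "open S" "x \<in> S" "\<And>k. Ck_on k S f" using smooth_nearE[OF assms] by metis
  show ?thesis by (rule Ck_on_has_derivative[OF S(3,1,2)])
qed

lemma smooth_near_derivative:
  assumes "smooth_near x f"
  shows "smooth_near x (\<lambda>y. frechet_derivative f (at y) v)"
proof -
  obtain S where S: "open S" "x \<in> S" "\<And>k. Ck_on k S f" using smooth_nearE[OF assms] by metis
  have "Ck_on k S (\<lambda>y. frechet_derivative f (at y) v)" for k using S(3)[of "Suc k"] by simp
  then show ?thesis using S(1,2) unfolding smooth_near_def smooth_on_def by blast
qed

lemma smooth_near_inverse:
  fixes f :: "'v::real_normed_vector \<Rightarrow> real"
  assumes "smooth_near x f" "f x \<noteq> 0"
  shows "smooth_near x (\<lambda>x. inverse (f x))"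
proof -
  obtain S where S: "open S" "x \<in> S" "\<And>k. Ck_on k S f" using smooth_nearE[OF assms(1)] by metis
  have "continuous_on S f" using S(3)[of 0] by simp
  then have o: "open (f -` (- {0}) \<inter> S)"
    using continuous_on_open_vimage[OF S(1), of f] by (metis open_Compl closed_singleton)
  have "Ck_on k (f -` (- {0}) \<inter> S) (\<lambda>x. inverse (f x))" for k
    by (rule Ck_on_inverse[OF o _ Ck_on_subset[OF S(3)]]) auto
  then show ?thesis using o S(2) assms(2) unfolding smooth_near_def smooth_on_def
    by (intro exI[of _ "f -` (- {0}) \<inter> S"]) auto
qed

lemma smooth_near_compose:
  fixes g :: "'u::real_normed_vector \<Rightarrow> 'v::{real_inner,heine_borel}"
  assumes "smooth_near x g" "smooth_near (g x) f"
  shows "smooth_near x (\<lambda>x. f (g x))"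
proof -
  obtain S where S: "open S" "x \<in> S" "\<And>k. Ck_on k S g" using smooth_nearE[OF assms(1)] by metis
  obtain T where T: "open T" "g x \<in> T" "\<And>k. Ck_on k T f" using smooth_nearE[OF assms(2)] by metis
  have "continuous_on S g" using S(3)[of 0] by simp
  then have o: "open (g -` T \<inter> S)"
    using continuous_on_open_vimage[OF S(1), of g] T(1) by blast
  have "Ck_on k (g -` T \<inter> S) (\<lambda>x. f (g x))" for k
    by (rule Ck_on_compose[OF o T(1) _ Ck_on_subset[OF S(3)] T(3)]) auto
  then show ?thesis using o S(2) T(2) unfolding smooth_near_def smooth_on_def
    by (intro exI[of _ "g -` T \<inter> S"]) auto
qed

text \<open>The classical flat function exp(-1/t) is the case n = 0. The powers of 1/t make the
  family closed, up to linear combinations, under differentiation, which is what the induction on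
  the order of smoothness requires.\<close>

definition flat_exp :: "nat \<Rightarrow> real \<Rightarrow> real" where
  "flat_exp n t = (if t > 0 then inverse t ^ n / exp (inverse t) else 0)"

lemma DERIV_flat_exp:
  "(flat_exp n has_real_derivative flat_exp (n + 2) t - real n * flat_exp (n + 1) t) (at t)"
proof -
  consider "t > 0" | "t < 0" | "t = 0" by linarith
  then show ?thesis
  proof cases
    case 1
    have "((\<lambda>t. inverse t ^ n * exp (- inverse t)) has_real_derivative
        flat_exp (n + 2) t - real n * flat_exp (n + 1) t) (at t)"
    proof -
      have "m = 0" if "t * t ^ (m - Suc 0) \<noteq> t ^ m" for m
        using that by (cases m) auto
      then show ?thesis
        using 1 by (cases n)
          (auto simp: flat_exp_def exp_minus field_simps power2_eq_square intro!: derivative_eq_intros)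
    qed
    then show ?thesis
      by (rule has_field_derivative_transform_within_open[of _ _ _ "{0<..}"])
        (use 1 in \<open>auto simp: flat_exp_def exp_minus field_simps\<close>)
  next
    case 2
    have "((\<lambda>t. 0) has_real_derivative flat_exp (n + 2) t - real n * flat_exp (n + 1) t) (at t)"
      using 2 by (simp add: flat_exp_def)
    then show ?thesis
      by (rule has_field_derivative_transform_within_open[of _ _ _ "{..<0}"])
        (use 2 in \<open>auto simp: flat_exp_def\<close>)
  next
    case 3
    \<comment> \<open>From the right, the difference quotient at 0 is s^(n+1) / exp s with s = 1/t
      tending to infinity; from the left it is 0.\<close>
    have "((\<lambda>t. inverse t ^ Suc n / exp (inverse t)) \<longlongrightarrow> (0::real)) (at_right 0)"
      by (rule filterlim_compose[OF tendsto_power_div_exp_0 filterlim_inverse_at_top_right])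
    then have "((\<lambda>t. flat_exp n t / t) \<longlongrightarrow> 0) (at_right 0)"
      by (rule Lim_transform_eventually)
        (auto simp: eventually_at_right_field flat_exp_def field_simps intro!: exI[of _ 1])
    moreover have "((\<lambda>t. flat_exp n t / t) \<longlongrightarrow> 0) (at_left 0)"
      by (rule Lim_transform_eventually[OF tendsto_const])
        (auto simp: eventually_at_left_field flat_exp_def intro!: exI[of _ "-1"])
    ultimately have "((\<lambda>t. flat_exp n t / t) \<longlongrightarrow> 0) (at 0)"
      by (simp add: filterlim_split_at)
    then show ?thesis using 3 by (simp add: has_field_derivative_iff flat_exp_def)
  qed
qed

lemma Ck_on_flat_exp: "Ck_on k UNIV (flat_exp n)"
proof (induction k arbitrary: n)
  case 0
  show ?case by (simp add: continuous_on_eq_continuous_at DERIV_isCont[OF DERIV_flat_exp])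
next
  case (Suc k)
  show ?case
  proof (rule Ck_on_SucI[where f' = "\<lambda>t v. (flat_exp (n + 2) t + (- real n) * flat_exp (n + 1) t) * v"])
    show "(flat_exp n has_derivative (*) (flat_exp (n + 2) t + (- real n) * flat_exp (n + 1) t)) (at t)" for t
      using DERIV_flat_exp[of n t] by (simp add: has_field_derivative_def)
    show "Ck_on k UNIV (\<lambda>t. (flat_exp (n + 2) t + (- real n) * flat_exp (n + 1) t) * v)" for v
      by (intro Ck_on_mult Ck_on_add Ck_on_const Suc open_UNIV)
  qed simp
qed

text \<open>In terms of the squared distance, \<open>p\<close> is positive exactly within radius 2r
  and \<open>q\<close> exactly beyond radius r. Every point lies in one of these regions, so p / (p
  + q) is smooth; it is 1 where q vanishes and 0 where p does.\<close>

lemma ex_bump: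
  fixes a :: "'e::{real_inner,heine_borel}"
  assumes "r > 0"
  shows "\<exists>\<rho>::'e \<Rightarrow> real. (\<forall>x. smooth_near x \<rho>) \<and> (\<forall>x. dist a x \<le> r \<longrightarrow> \<rho> x = 1) \<and>
    (\<forall>x. dist a x \<ge> 2 * r \<longrightarrow> \<rho> x = 0)"
proof -
  define n where "n = (\<lambda>x::'e. (x + (- a)) \<bullet> (x + (- a)))"
  define p where "p = (\<lambda>x. flat_exp 0 (4 * r\<^sup>2 + (-1) * n x))"
  define q where "q = (\<lambda>x. flat_exp 0 (n x + (- (r\<^sup>2))))"
  have dn: "n x = (dist a x)\<^sup>2" for x
    by (simp add: n_def dist_norm power2_norm_eq_inner inner_diff inner_commute)
  have n: "smooth_near x n" for x
    unfolding n_def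
    by (intro smooth_near_inner smooth_near_add smooth_near_const smooth_near_bounded_linear bounded_linear_ident)
  have fe: "smooth_near t (flat_exp 0)" for t
    unfolding smooth_near_def smooth_on_def using Ck_on_flat_exp by blast
  have p: "smooth_near x p" and q: "smooth_near x q" for x
    unfolding p_def q_def
    by (intro smooth_near_compose[OF _ fe] smooth_near_add smooth_near_mult smooth_near_const n)+
  have nn: "flat_exp 0 t \<ge> 0" and pos: "t > 0 \<Longrightarrow> flat_exp 0 t > 0" for t
    by (auto simp: flat_exp_def)
  have pq: "p x + q x > 0" for x
  proof (cases "n x < 4 * r\<^sup>2")
    case True
    then have "p x > 0" unfolding p_def by (intro pos) simp
    then show ?thesis using nn[of "n x + (- (r\<^sup>2))"] by (simp add: q_def)
  next
    case False
    then have "n x > r\<^sup>2" using zero_less_power2[of r] assms by linarith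
    then have "q x > 0" unfolding q_def by (intro pos) simp
    then show ?thesis using nn[of "4 * r\<^sup>2 + (-1) * n x"] by (simp add: p_def)
  qed
  show ?thesis
  proof (intro exI[of _ "\<lambda>x. p x * inverse (p x + q x)"] conjI allI impI)
    show "smooth_near x (\<lambda>x. p x * inverse (p x + q x))" for x
      using pq[of x] by (intro smooth_near_mult smooth_near_inverse smooth_near_add p q) simp
    show "p x * inverse (p x + q x) = 1" if "dist a x \<le> r" for x
    proof -
      have "n x \<le> r\<^sup>2" unfolding dn using that by (simp add: power_mono)
      then have "q x = 0" by (simp add: q_def flat_exp_def)
      then show ?thesis using pq[of x] by simp
    qed
    show "p x * inverse (p x + q x) = 0" if "dist a x \<ge> 2 * r" for x
    proof -
      have "n x \<ge> (2 * r)\<^sup>2" unfolding dn using that assms by (intro power_mono) auto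
      then have "p x = 0" by (simp add: p_def flat_exp_def power2_eq_square)
      then show ?thesis by simp
    qed
  qed
qed

text \<open>Differentiation under the integral sign. Compactness of the interval makes the
  continuity of \<open>g'\<close> at \<open>x0\<close> uniform in t for each basis direction, and
  the mean value inequality for \<open>g z t - g' x0 t z\<close> turns this into a remainder bound
  that is uniform in t and can be integrated.\<close>

lemma has_derivative_param_integral:
  fixes g :: "'e::{real_inner,heine_borel} \<Rightarrow> real \<Rightarrow> real"
  assumes U: "open U" "x0 \<in> U"
    and d: "\<And>x t. x \<in> U \<Longrightarrow> t \<in> {0..1} \<Longrightarrow> ((\<lambda>x. g x t) has_derivative g' x t) (at x)"
    and c: "\<And>x. x \<in> U \<Longrightarrow> continuous_on {0..1} (g x)"
    and c': "\<And>b. continuous_on (U \<times> {0..1}) (\<lambda>(x, t). g' x t b)"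
  shows "((\<lambda>x. integral {0..1} (g x)) has_derivative (\<lambda>v. integral {0..1} (\<lambda>t. g' x0 t v))) (at x0)"
proof -
  have lin: "linear (g' x t)" if "x \<in> U" "t \<in> {0..1}" for x t
    using d[OF that] has_derivative_linear by blast
  have ct: "continuous_on {0..1} (\<lambda>t. g' x t v)" if "x \<in> U" for x v
    by (rule continuous_on_compose2[OF c'[of v], of _ "\<lambda>t. (x, t)", simplified])
      (use that in \<open>auto intro!: continuous_intros\<close>)
  have int: "(\<lambda>t. g' x0 t v) integrable_on {0..1}" for v
    using ct[OF U(2)] by (rule integrable_continuous_real)
  have expand: "integral {0..1} (\<lambda>t. g' x0 t v) = (\<Sum>b\<in>onb. (v \<bullet> b) * integral {0..1} (\<lambda>t. g' x0 t b))" for v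
  proof -
    have "integral {0..1} (\<lambda>t. g' x0 t v) = integral {0..1} (\<lambda>t. \<Sum>b\<in>onb. (v \<bullet> b) * g' x0 t b)"
      by (rule integral_cong) (use linear_onb_expansion[OF lin[OF U(2)]] in auto)
    also have "\<dots> = (\<Sum>b\<in>onb. integral {0..1} (\<lambda>t. (v \<bullet> b) * g' x0 t b))"
      by (rule integral_sum) (auto intro!: int integrable_on_mult_right)
    finally show ?thesis by simp
  qed
  have "bounded_linear (\<lambda>v. integral {0..1} (\<lambda>t. g' x0 t v))"
    by (subst ext[OF expand]) (intro bounded_linear_sum bounded_linear_mult_const bounded_linear_inner_left)
  moreover have "\<exists>\<delta>>0. \<forall>y. norm (y - x0) < \<delta> \<longrightarrow>
      norm (integral {0..1} (g y) - integral {0..1} (g x0) - integral {0..1} (\<lambda>t. g' x0 t (y - x0)))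
        \<le> e * norm (y - x0)" if "e > 0" for e
  proof -
    \<comment> \<open>Each of the basis directions contributes an error of at most
      \<open>\<eta>\<close>, so together they stay below e; the added 1 covers dimension 0.\<close>
    define \<eta> where "\<eta> = e / (real (card (onb :: 'e set)) + 1)"
    have \<eta>: "\<eta> > 0" "card (onb :: 'e set) * \<eta> \<le> e"
      using that by (auto simp: \<eta>_def field_simps)
    have "\<forall>b. \<exists>X. open X \<and> x0 \<in> X \<and> (\<forall>x\<in>X \<inter> U. \<forall>t\<in>{0..1}. dist (g' x t b) (g' x0 t b) \<le> \<eta>)"
    proof
      fix b
      obtain X where "x0 \<in> X" "open X" "\<forall>x\<in>X \<inter> U. \<forall>t\<in>{0..1}. dist (g' x t b) (g' x0 t b) \<le> \<eta>"
        by (rule continuous_on_prod_compactE[OF c'[of b] compact_Icc U(2) \<eta>(1)]) auto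
      then show "\<exists>X. open X \<and> x0 \<in> X \<and> (\<forall>x\<in>X \<inter> U. \<forall>t\<in>{0..1}. dist (g' x t b) (g' x0 t b) \<le> \<eta>)" by blast
    qed
    then obtain X where X: "\<And>b. open (X b)" "\<And>b. x0 \<in> X b"
      "\<And>b x t. x \<in> X b \<inter> U \<Longrightarrow> t \<in> {0..1} \<Longrightarrow> dist (g' x t b) (g' x0 t b) \<le> \<eta>" by metis
    have "open (U \<inter> (\<Inter>b\<in>onb. X b))" "x0 \<in> U \<inter> (\<Inter>b\<in>onb. X b)"
      using U X by auto
    then obtain \<delta> where \<delta>: "\<delta> > 0" "ball x0 \<delta> \<subseteq> U \<inter> (\<Inter>b\<in>onb. X b)"
      using open_contains_ball by metis
    have main: "norm (g y t - g x0 t - g' x0 t (y - x0)) \<le> e * norm (y - x0)"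
      if y: "y \<in> ball x0 \<delta>" and t: "t \<in> {0..1}" for y t
    proof -
      have x0t: "bounded_linear (g' x0 t)"
        using d[OF U(2) t] by (rule has_derivative_bounded_linear)
      have "norm ((g y t - g' x0 t y) - (g x0 t - g' x0 t x0)) \<le> e * norm (y - x0)"
      proof (rule differentiable_bound[where S = "ball x0 \<delta>" and f = "\<lambda>z. g z t - g' x0 t z"
            and f' = "\<lambda>z v. g' z t v - g' x0 t v"])
        fix z assume z: "z \<in> ball x0 \<delta>"
        then have zU: "z \<in> U" using \<delta>(2) by auto
        show "((\<lambda>z. g z t - g' x0 t z) has_derivative (\<lambda>v. g' z t v - g' x0 t v)) (at z within ball x0 \<delta>)"
          by (intro has_derivative_diff has_derivative_at_withinI[OF d[OF zU t]]
              bounded_linear_imp_has_derivative[OF x0t])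
        show "onorm (\<lambda>v. g' z t v - g' x0 t v) \<le> e"
        proof (rule onorm_bound)
          fix v
          have l: "linear (\<lambda>v. g' z t v - g' x0 t v)"
            using lin[OF zU t] lin[OF U(2) t] by (rule linear_compose_sub)
          have "norm (g' z t v - g' x0 t v) = norm (\<Sum>b\<in>onb. (v \<bullet> b) *\<^sub>R (g' z t b - g' x0 t b))"
            using linear_onb_expansion[OF l, of v] by simp
          also have "\<dots> \<le> (\<Sum>b\<in>(onb :: 'e set). norm v * \<eta>)"
          proof (rule order_trans[OF norm_sum sum_mono])
            fix b :: 'e assume b: "b \<in> onb"
            have "norm b = 1" using inner_onb[OF b b] by (simp add: norm_eq_1)
            then have "\<bar>v \<bullet> b\<bar> \<le> norm v" using Cauchy_Schwarz_ineq2[of v b] by simp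
            moreover have "\<bar>g' z t b - g' x0 t b\<bar> \<le> \<eta>" 
            proof -
              have "z \<in> X b \<inter> U" using z \<delta>(2) b by blast
              from X(3)[OF this t] show ?thesis by (simp add: dist_norm)
            qed
            ultimately show "norm ((v \<bullet> b) *\<^sub>R (g' z t b - g' x0 t b)) \<le> norm v * \<eta>"
              by (simp add: abs_mult mult_mono)
          qed
          also have "\<dots> \<le> e * norm v"
            using mult_right_mono[OF \<eta>(2) norm_ge_zero[of v]] by (simp add: mult_ac)
          finally show "norm (g' z t v - g' x0 t v) \<le> e * norm v" .
        qed (use \<open>e > 0\<close> in simp)
      qed (use y \<delta>(1) in auto)
      then show ?thesis
        using linear_diff[OF lin[OF U(2) t], of y x0] by (simp add: algebra_simps)
    qed
    have "norm (integral {0..1} (g y) - integral {0..1} (g x0) - integral {0..1} (\<lambda>t. g' x0 t (y - x0)))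
        \<le> e * norm (y - x0)" if y: "norm (y - x0) < \<delta>" for y
    proof -
      have yb: "y \<in> ball x0 \<delta>" using y by (simp add: dist_norm norm_minus_commute)
      then have yU: "y \<in> U" using \<delta>(2) by auto
      have "integral {0..1} (g y) - integral {0..1} (g x0) - integral {0..1} (\<lambda>t. g' x0 t (y - x0))
          = integral {0..1} (\<lambda>t. g y t - g x0 t - g' x0 t (y - x0))"
        using c[OF yU] c[OF U(2)] int
        by (simp add: integral_diff integrable_continuous_real integrable_diff)
      moreover have "norm (integral {0..1} (\<lambda>t. g y t - g x0 t - g' x0 t (y - x0))) \<le> e * norm (y - x0) * (1 - 0)"
        by (rule integral_bound) (auto intro!: continuous_intros c[OF yU] c[OF U(2)] ct[OF U(2)] main[OF yb, simplified])
      ultimately show ?thesis by simp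
    qed
    then show ?thesis using \<delta>(1) by blast
  qed
  ultimately show ?thesis by (simp add: has_derivative_at_alt)
qed

text \<open>Differentiating in x brings out one more factor t. Stating the lemma with an arbitrary
  weight \<open>t ^ j\<close> lets the induction hypothesis apply to the derivative, with j
  increased by one.\<close>

lemma Ck_on_radial_average:
  fixes q :: "'e::{real_inner,heine_borel} \<Rightarrow> real"
  assumes "\<And>k. Ck_on k (ball a r) q"
  shows "Ck_on k (ball a r) (\<lambda>x. integral {0..1} (\<lambda>t. t ^ j * q (a + t *\<^sub>R (x - a))))"
  using assms
proof (induction k arbitrary: q j)
  have mem: "a + t *\<^sub>R (x - a) \<in> ball a r" if "x \<in> ball a r" "t \<in> {0..1}" for x :: 'e and t :: real
  proof -
    have "norm (t *\<^sub>R (x - a)) \<le> 1 * norm (x - a)"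
      unfolding norm_scaleR by (rule mult_right_mono) (use that in auto)
    then show ?thesis using that(1) by (simp add: dist_norm norm_minus_commute)
  qed
  have cont: "continuous_on (ball a r \<times> {0..1}) (\<lambda>(x, t). t ^ j * q (a + t *\<^sub>R (x - a)))"
    if "continuous_on (ball a r) q" for q :: "'e \<Rightarrow> real" and j
  proof -
    have "continuous_on (ball a r \<times> {0..1}) (\<lambda>z. q (a + snd z *\<^sub>R (fst z - a)))"
      by (rule continuous_on_compose2[OF that]) (use mem in \<open>auto intro!: continuous_intros simp del: mem_ball\<close>)
    then show ?thesis unfolding split_beta by (intro continuous_intros)
  qed
  {
    case 0
    have "continuous_on (ball a r \<times> cbox 0 1) (\<lambda>(x, t). t ^ j * q (a + t *\<^sub>R (x - a)))"
      using cont[of q j] 0[of 0] by simp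
    then show ?case
      using integral_continuous_on_param[of "ball a r" 0 1 "\<lambda>x t. t ^ j * q (a + t *\<^sub>R (x - a))"]
      by simp
  next
    case (Suc k)
    have dq: "Ck_on k (ball a r) (\<lambda>x. frechet_derivative q (at x) v)" for k v
      using Suc.prems[of "Suc k"] by simp
    have cq: "continuous_on (ball a r) q" using Suc.prems[of 0] by simp
    show ?case
    proof (rule Ck_on_SucI[where f' = "\<lambda>x v. integral {0..1}
        (\<lambda>t. t ^ Suc j * frechet_derivative q (at (a + t *\<^sub>R (x - a))) v)"])
      fix x assume x: "x \<in> ball a r"
      show "((\<lambda>x. integral {0..1} (\<lambda>t. t ^ j * q (a + t *\<^sub>R (x - a)))) has_derivative
          (\<lambda>v. integral {0..1} (\<lambda>t. t ^ Suc j * frechet_derivative q (at (a + t *\<^sub>R (x - a))) v))) (at x)"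
      proof (rule has_derivative_param_integral[OF open_ball x])
        fix x and t :: real assume xt: "x \<in> ball a r" "t \<in> {0..1}"
        have hq: "(q has_derivative frechet_derivative q (at (a + t *\<^sub>R (x - a)))) (at (a + t *\<^sub>R (x - a)))"
          using Ck_on_has_derivative[OF Suc.prems open_ball mem[OF xt]] .
        have "((\<lambda>x. a + t *\<^sub>R (x - a)) has_derivative (\<lambda>v. t *\<^sub>R v)) (at x)"
          by (auto intro!: derivative_eq_intros)
        from has_derivative_compose[OF this hq]
        have "((\<lambda>x. q (a + t *\<^sub>R (x - a))) has_derivative
            (\<lambda>v. frechet_derivative q (at (a + t *\<^sub>R (x - a))) (t *\<^sub>R v))) (at x)" .
        from has_derivative_mult_right[OF this, of "t ^ j"]
        show "((\<lambda>x. t ^ j * q (a + t *\<^sub>R (x - a))) has_derivative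
            (\<lambda>v. t ^ Suc j * frechet_derivative q (at (a + t *\<^sub>R (x - a))) v)) (at x)"
          using linear_scale[OF has_derivative_linear[OF hq]] by (simp add: mult_ac)
      next
        fix x assume x: "x \<in> ball a r"
        show "continuous_on {0..1} (\<lambda>t. t ^ j * q (a + t *\<^sub>R (x - a)))"
        proof -
          have "continuous_on {0..1} (\<lambda>t. (\<lambda>(x, t). t ^ j * q (a + t *\<^sub>R (x - a))) (x, t))"
            by (rule continuous_on_compose2[OF cont[OF cq, of j]]) (use x in \<open>auto intro!: continuous_intros\<close>)
          then show ?thesis by (simp only: prod.case)
        qed
      next
        show "continuous_on (ball a r \<times> {0..1})
            (\<lambda>(x, t). t ^ Suc j * frechet_derivative q (at (a + t *\<^sub>R (x - a))) b)" for b
          using cont[of "\<lambda>x. frechet_derivative q (at x) b" "Suc j"] dq[of 0 b] by simp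
      qed
    next
      show "Ck_on k (ball a r) (\<lambda>x. integral {0..1}
          (\<lambda>t. t ^ Suc j * frechet_derivative q (at (a + t *\<^sub>R (x - a))) v))" for v
        by (rule Suc.IH[OF dq])
    qed simp
  }
qed

text \<open>Integrate the derivative along the segment from a to x and expand the direction x - a in
  the basis. The coefficients are radial averages of partial derivatives, hence smooth, so a
  derivation can later be applied to each term separately.\<close>

lemma Hadamard:
  fixes f :: "'e::{real_inner,heine_borel} \<Rightarrow> real"
  assumes "smooth_near a f"
  shows "\<exists>h. (\<forall>b. smooth_near a (h b)) \<and> (\<forall>b. h b a = frechet_derivative f (at a) b) \<and>
    (\<forall>\<^sub>F x in nhds a. f x = f a + (\<Sum>b\<in>onb. ((x - a) \<bullet> b) * h b x))"
proof -
  obtain r where r: "r > 0" "smooth_on (ball a r) f"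
    using smooth_near_imp_smooth_on_ball[OF assms] .
  have f: "Ck_on k (ball a r) f" for k using r(2) by (simp add: smooth_on_def)
  have df: "Ck_on k (ball a r) (\<lambda>x. frechet_derivative f (at x) b)" for b k
    using f[of "Suc k"] by simp
  \<comment> \<open>The trivial factor \<open>t ^ 0\<close> puts the integrand into the form treated
    by \<open>Ck_on_radial_average\<close>.\<close>
  define h where "h = (\<lambda>b x. integral {0..1} (\<lambda>t. t ^ 0 * frechet_derivative f (at (a + t *\<^sub>R (x - a))) b))"
  have h: "smooth_near a (h b)" "h b a = frechet_derivative f (at a) b" for b
    using Ck_on_radial_average[OF df[of _ b], of _ 0] r(1)
    by (auto simp: smooth_near_def smooth_on_def h_def intro!: exI[of _ "ball a r"])
  have expand: "f x = f a + (\<Sum>b\<in>onb. ((x - a) \<bullet> b) * h b x)" if x: "x \<in> ball a r" for x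
  proof -
    have mem: "a + t *\<^sub>R (x - a) \<in> ball a r" if "t \<in> {0..1}" for t :: real
    proof -
      have "norm (t *\<^sub>R (x - a)) \<le> 1 * norm (x - a)"
        unfolding norm_scaleR by (rule mult_right_mono) (use that in auto)
      then show ?thesis using x by (simp add: dist_norm norm_minus_commute)
    qed
    have hf: "(f has_derivative frechet_derivative f (at (a + t *\<^sub>R (x - a)))) (at (a + t *\<^sub>R (x - a)))"
      if "t \<in> {0..1}" for t
      using Ck_on_has_derivative[OF f open_ball mem[OF that]] .
    have "((\<lambda>t. frechet_derivative f (at (a + t *\<^sub>R (x - a))) (x - a)) has_integral
        f (a + 1 *\<^sub>R (x - a)) - f (a + 0 *\<^sub>R (x - a))) {0..1}"
    proof (rule fundamental_theorem_of_calculus)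
      fix t :: real assume t: "t \<in> {0..1}"
      have "((\<lambda>t. a + t *\<^sub>R (x - a)) has_derivative (\<lambda>s. s *\<^sub>R (x - a))) (at t)"
        by (auto intro!: derivative_eq_intros)
      from has_derivative_compose[OF this hf[OF t]]
      have "((\<lambda>t. f (a + t *\<^sub>R (x - a))) has_derivative
          (\<lambda>s. s *\<^sub>R frechet_derivative f (at (a + t *\<^sub>R (x - a))) (x - a))) (at t)"
        by (simp add: linear_scale[OF has_derivative_linear[OF hf[OF t]]])
      then show "((\<lambda>t. f (a + t *\<^sub>R (x - a))) has_vector_derivative
          frechet_derivative f (at (a + t *\<^sub>R (x - a))) (x - a)) (at t within {0..1})"
        unfolding has_vector_derivative_def by (rule has_derivative_at_withinI)
    qed simp
    then have "f x - f a = integral {0..1} (\<lambda>t. frechet_derivative f (at (a + t *\<^sub>R (x - a))) (x - a))"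
      by (simp add: integral_unique)
    also have "\<dots> = integral {0..1}
        (\<lambda>t. \<Sum>b\<in>onb. ((x - a) \<bullet> b) * frechet_derivative f (at (a + t *\<^sub>R (x - a))) b)"
      by (rule integral_cong) (use linear_onb_expansion[OF has_derivative_linear[OF hf]] in auto)
    also have "\<dots> = (\<Sum>b\<in>onb. integral {0..1}
        (\<lambda>t. ((x - a) \<bullet> b) * frechet_derivative f (at (a + t *\<^sub>R (x - a))) b))"
    proof (rule integral_sum[OF finite_onb])
      fix b
      have "continuous_on (ball a r) (\<lambda>x. frechet_derivative f (at x) b)" using df[of 0] by simp
      then have "continuous_on {0..1} (\<lambda>t. frechet_derivative f (at (a + t *\<^sub>R (x - a))) b)"
        by (rule continuous_on_compose2) (use mem in \<open>auto intro!: continuous_intros simp del: mem_ball\<close>)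
      then show "(\<lambda>t. ((x - a) \<bullet> b) * frechet_derivative f (at (a + t *\<^sub>R (x - a))) b) integrable_on {0..1}"
        by (intro integrable_continuous_real continuous_intros)
    qed
    finally show ?thesis by (simp add: h_def)
  qed
  have "\<forall>\<^sub>F x in nhds a. x \<in> ball a r"
    using r(1) by (intro eventually_nhds_in_open) auto
  then have "\<forall>\<^sub>F x in nhds a. f x = f a + (\<Sum>b\<in>onb. ((x - a) \<bullet> b) * h b x)"
    by (rule eventually_mono) (rule expand)
  with h show ?thesis by blast
qed

text \<open>The mean value theorem, applied once in direction u to the difference of two parallel
  edges and once in direction v, gives an exact identity at some point p of the
  parallelogram.\<close>

lemma second_difference:
  fixes f :: "'v::real_normed_vector \<Rightarrow> real"
  assumes f: "\<And>k. Ck_on k (ball x r) f" and h: "h > 0" "h * norm u + h * norm v < r"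
  obtains p where "norm (p - x) \<le> h * norm u + h * norm v"
    "f (x + h *\<^sub>R u + h *\<^sub>R v) - f (x + h *\<^sub>R u) - f (x + h *\<^sub>R v) + f x
      = h * h * frechet_derivative (\<lambda>y. frechet_derivative f (at y) u) (at p) v"
proof -
  have near: "norm (s *\<^sub>R u + t *\<^sub>R v) \<le> h * norm u + h * norm v"
    if "0 \<le> s" "s \<le> h" "0 \<le> t" "t \<le> h" for s t
    using norm_triangle_ineq[of "s *\<^sub>R u" "t *\<^sub>R v"] that h(1)
      mult_right_mono[of s h "norm u"] mult_right_mono[of t h "norm v"] by simp
  have mem: "x + s *\<^sub>R u + t *\<^sub>R v \<in> ball x r" if "0 \<le> s" "s \<le> h" "0 \<le> t" "t \<le> h" for s t
  proof -
    have "dist x (x + s *\<^sub>R u + t *\<^sub>R v) = norm (s *\<^sub>R u + t *\<^sub>R v)"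
      by (subst dist_commute) (simp add: dist_norm add.assoc)
    then show ?thesis using near[OF that] h(2) by simp
  qed
  have D: "((\<lambda>s. g (y s)) has_real_derivative frechet_derivative g (at (y s)) w) (at s)"
    if "\<And>k. Ck_on k (ball x r) g" "y s \<in> ball x r" "(y has_derivative (\<lambda>t. t *\<^sub>R w)) (at s)"
    for g :: "'v \<Rightarrow> real" and y :: "real \<Rightarrow> 'v" and s w
  proof -
    have hg: "(g has_derivative frechet_derivative g (at (y s))) (at (y s))"
      by (rule Ck_on_has_derivative[OF that(1) open_ball that(2)])
    have "(\<lambda>t. frechet_derivative g (at (y s)) (t *\<^sub>R w)) = (*) (frechet_derivative g (at (y s)) w)"
      by (simp add: linear_scale[OF has_derivative_linear[OF hg]] fun_eq_iff mult.commute)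
    then show ?thesis
      using has_derivative_compose[OF that(3) hg] by (simp add: has_field_derivative_def)
  qed
  have du: "\<And>k. Ck_on k (ball x r) (\<lambda>y. frechet_derivative f (at y) u)"
    using f[of "Suc k" for k] by simp
  define G where "G = (\<lambda>s. f (x + s *\<^sub>R u + h *\<^sub>R v) - f (x + s *\<^sub>R u + 0 *\<^sub>R v))"
  have "\<exists>\<xi>. 0 < \<xi> \<and> \<xi> < h \<and> G h - G 0 = (h - 0) *
      (frechet_derivative f (at (x + \<xi> *\<^sub>R u + h *\<^sub>R v)) u - frechet_derivative f (at (x + \<xi> *\<^sub>R u + 0 *\<^sub>R v)) u)"
    unfolding G_def
  proof (rule MVT2[OF h(1)])
    fix s assume s: "0 \<le> s" "s \<le> h"
    have "((\<lambda>s. f (x + s *\<^sub>R u + c *\<^sub>R v)) has_real_derivative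
        frechet_derivative f (at (x + s *\<^sub>R u + c *\<^sub>R v)) u) (at s)" if "0 \<le> c" "c \<le> h" for c
      by (rule D[where y = "\<lambda>s. x + s *\<^sub>R u + c *\<^sub>R v", OF f mem[OF s that]]) (auto intro!: derivative_eq_intros)
    from this[of h] this[of 0] h(1)
    show "((\<lambda>s. f (x + s *\<^sub>R u + h *\<^sub>R v) - f (x + s *\<^sub>R u + 0 *\<^sub>R v)) has_real_derivative
        frechet_derivative f (at (x + s *\<^sub>R u + h *\<^sub>R v)) u - frechet_derivative f (at (x + s *\<^sub>R u + 0 *\<^sub>R v)) u) (at s)"
      by (intro DERIV_diff) auto
  qed
  then obtain \<xi> where \<xi>: "0 < \<xi>" "\<xi> < h" "G h - G 0 = h *
      (frechet_derivative f (at (x + \<xi> *\<^sub>R u + h *\<^sub>R v)) u - frechet_derivative f (at (x + \<xi> *\<^sub>R u + 0 *\<^sub>R v)) u)"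
    by auto
  have "\<exists>\<eta>. 0 < \<eta> \<and> \<eta> < h \<and> frechet_derivative f (at (x + \<xi> *\<^sub>R u + h *\<^sub>R v)) u
      - frechet_derivative f (at (x + \<xi> *\<^sub>R u + 0 *\<^sub>R v)) u
      = (h - 0) * frechet_derivative (\<lambda>y. frechet_derivative f (at y) u) (at (x + \<xi> *\<^sub>R u + \<eta> *\<^sub>R v)) v"
  proof (rule MVT2[OF h(1)])
    fix s assume s: "0 \<le> s" "s \<le> h"
    show "((\<lambda>s. frechet_derivative f (at (x + \<xi> *\<^sub>R u + s *\<^sub>R v)) u) has_real_derivative
        frechet_derivative (\<lambda>y. frechet_derivative f (at y) u) (at (x + \<xi> *\<^sub>R u + s *\<^sub>R v)) v) (at s)"
      using mem[of \<xi> s] s \<xi>(1,2)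
      by (intro D[where y = "\<lambda>s. x + \<xi> *\<^sub>R u + s *\<^sub>R v", OF du]) (auto intro!: derivative_eq_intros)
  qed
  then obtain \<eta> where \<eta>: "0 < \<eta>" "\<eta> < h" "frechet_derivative f (at (x + \<xi> *\<^sub>R u + h *\<^sub>R v)) u
      - frechet_derivative f (at (x + \<xi> *\<^sub>R u + 0 *\<^sub>R v)) u
      = h * frechet_derivative (\<lambda>y. frechet_derivative f (at y) u) (at (x + \<xi> *\<^sub>R u + \<eta> *\<^sub>R v)) v"
    by auto
  show thesis
  proof (rule that[of "x + \<xi> *\<^sub>R u + \<eta> *\<^sub>R v"])
    show "norm (x + \<xi> *\<^sub>R u + \<eta> *\<^sub>R v - x) \<le> h * norm u + h * norm v"
      using near[of \<xi> \<eta>] \<xi>(1,2) \<eta>(1,2) by (simp add: add.assoc)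
    show "f (x + h *\<^sub>R u + h *\<^sub>R v) - f (x + h *\<^sub>R u) - f (x + h *\<^sub>R v) + f x
      = h * h * frechet_derivative (\<lambda>y. frechet_derivative f (at y) u) (at (x + \<xi> *\<^sub>R u + \<eta> *\<^sub>R v)) v"
      using \<xi>(3) unfolding \<eta>(3) by (simp add: G_def)
  qed
qed

text \<open>The second difference is symmetric in u and v. It therefore equates the two mixed
  derivatives at points p and q as close to x as desired, which contradicts continuity if they
  differ at x.\<close>

lemma second_derivative_commute:
  fixes f :: "'v::real_normed_vector \<Rightarrow> real"
  assumes "smooth_near x f"
  shows "frechet_derivative (\<lambda>y. frechet_derivative f (at y) u) (at x) v
    = frechet_derivative (\<lambda>y. frechet_derivative f (at y) v) (at x) u"
proof (rule ccontr)
  define A where "A = (\<lambda>p. frechet_derivative (\<lambda>y. frechet_derivative f (at y) u) (at p) v)"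
  define B where "B = (\<lambda>p. frechet_derivative (\<lambda>y. frechet_derivative f (at y) v) (at p) u)"
  assume "\<not> ?thesis"
  then have ne: "A x \<noteq> B x" by (simp add: A_def B_def)
  \<comment> \<open>Half the gap: two deviations, each strictly below e, cannot bridge it.\<close>
  define e where "e = \<bar>A x - B x\<bar> / 2"
  have e: "e > 0" using ne by (simp add: e_def)
  have "isCont A x" "isCont B x"
    unfolding A_def B_def
    by (intro smooth_near_isCont smooth_near_derivative assms)+
  then have "\<exists>d>0. \<forall>p. norm (p - x) < d \<longrightarrow> norm (A p - A x) < e"
    "\<exists>d>0. \<forall>p. norm (p - x) < d \<longrightarrow> norm (B p - B x) < e"
    using e by (simp_all add: continuous_at_eps_delta dist_norm)
  then obtain d1 d2 where d: "d1 > 0" "d2 > 0" "\<forall>p. norm (p - x) < d1 \<longrightarrow> norm (A p - A x) < e"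
    "\<forall>p. norm (p - x) < d2 \<longrightarrow> norm (B p - B x) < e"
    by (elim exE conjE)
  obtain r where r: "r > 0" "smooth_on (ball x r) f"
    using smooth_near_imp_smooth_on_ball[OF assms] .
  have f: "Ck_on k (ball x r) f" for k using r(2) by (simp add: smooth_on_def)
  define m where "m = min r (min d1 d2)"
  have m: "m > 0" "m \<le> r" "m \<le> d1" "m \<le> d2" using r d by (auto simp: m_def)
  \<comment> \<open>Keeps the whole parallelogram within distance m of x; the added 1 prevents
    division by zero when u and v vanish.\<close>
  define h where "h = m / (2 * (norm u + norm v + 1))"
  have n: "norm u + norm v + 1 > 0" by (smt (verit) norm_ge_zero)
  have h: "h > 0" using m(1) n by (simp add: h_def)
  have "h * (norm u + norm v) < h * (2 * (norm u + norm v + 1))"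
    using h n by (intro mult_strict_left_mono) (auto intro: add_nonneg_pos)
  also have "\<dots> = m" using n by (simp add: h_def)
  finally have hm: "h * norm u + h * norm v < m" by (simp add: distrib_left)
  obtain p where p: "norm (p - x) \<le> h * norm u + h * norm v"
    "f (x + h *\<^sub>R u + h *\<^sub>R v) - f (x + h *\<^sub>R u) - f (x + h *\<^sub>R v) + f x = h * h * A p"
    unfolding A_def by (rule second_difference[OF f h, of u v]) (use hm m in auto)
  obtain q where q: "norm (q - x) \<le> h * norm v + h * norm u"
    "f (x + h *\<^sub>R v + h *\<^sub>R u) - f (x + h *\<^sub>R v) - f (x + h *\<^sub>R u) + f x = h * h * B q"
    unfolding B_def by (rule second_difference[OF f h, of v u]) (use hm m in auto)
  have swap: "x + h *\<^sub>R v + h *\<^sub>R u = x + h *\<^sub>R u + h *\<^sub>R v" by (simp add: add_ac)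
  have "h * h * A p = h * h * B q"
    using p(2) q(2)[unfolded swap] by linarith
  then have "A p = B q" using h by simp
  moreover have "\<bar>A p - A x\<bar> < e" "\<bar>B q - B x\<bar> < e"
    using d(3)[rule_format, of p] d(4)[rule_format, of q] p(1) q(1) hm m by auto
  ultimately show False
    using abs_triangle_ineq[of "A x - A p" "B q - B x"] abs_minus_commute[of "A x" "A p"] by (simp add: e_def)
qed

section \<open>Smooth functions and tangent vectors in charts\<close>

text \<open>The direction b is any vector of the model space, not only a basis vector, so that on a
  product chart the directions (b, 0), (0, b) and (b, b) are covered as well.\<close>

definition chart_deriv ::
  "'a set \<Rightarrow> ('a \<Rightarrow> 'e::real_normed_vector) \<Rightarrow> 'e \<Rightarrow> ('a \<Rightarrow> real) \<Rightarrow> 'a \<Rightarrow> real" where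
  "chart_deriv U \<phi> b f m = frechet_derivative (f \<circ> inv_into U \<phi>) (at (\<phi> m)) b"

definition coord :: "('a \<Rightarrow> 'e::real_inner) \<Rightarrow> 'e \<Rightarrow> 'a \<Rightarrow> real" where
  "coord \<phi> b = (\<lambda>x. \<phi> x \<bullet> b)"

section \<open>Derivations at a point\<close>

lemma tangent_cong:
  assumes "v \<in> tangent_space A m" "smooth_at A m f" "smooth_at A m g" "\<forall>\<^sub>F x in nhds m. f x = g x"
  shows "v f = v g"
  using assms unfolding tangent_space_def by blast

lemma tangent_not_smooth: "v \<in> tangent_space A m \<Longrightarrow> \<not> smooth_at A m f \<Longrightarrow> v f = 0"
  unfolding tangent_space_def by blast

lemma tangent_lin:
  assumes "v \<in> tangent_space A m" "smooth_at A m f" "smooth_at A m g"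
  shows "v (\<lambda>x. a * f x + b * g x) = a * v f + b * v g"
  using assms unfolding tangent_space_def by blast

lemma tangent_mult:
  assumes "v \<in> tangent_space A m" "smooth_at A m f" "smooth_at A m g"
  shows "v (\<lambda>x. f x * g x) = v f * g m + f m * v g"
  using assms unfolding tangent_space_def by blast

lemma tangent_spaceI:
  assumes "\<And>f. \<not> smooth_at A m f \<Longrightarrow> v f = 0"
    and "\<And>f g. smooth_at A m f \<Longrightarrow> smooth_at A m g \<Longrightarrow> \<forall>\<^sub>F x in nhds m. f x = g x \<Longrightarrow> v f = v g"
    and "\<And>f g a b. smooth_at A m f \<Longrightarrow> smooth_at A m g \<Longrightarrow> v (\<lambda>x. a * f x + b * g x) = a * v f + b * v g"
    and "\<And>f g. smooth_at A m f \<Longrightarrow> smooth_at A m g \<Longrightarrow> v (\<lambda>x. f x * g x) = v f * g m + f m * v g"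
  shows "v \<in> tangent_space A m"
  using assms unfolding tangent_space_def by blast

lemma tangent_add:
  assumes "v \<in> tangent_space A m" "smooth_at A m f" "smooth_at A m g"
  shows "v (\<lambda>x. f x + g x) = v f + v g"
  using tangent_lin[OF assms, of 1 1] by simp

lemma tangent_diff:
  assumes "v \<in> tangent_space A m" "smooth_at A m f" "smooth_at A m g"
  shows "v (\<lambda>x. f x - g x) = v f - v g"
  using tangent_lin[OF assms, of 1 "-1"] by simp

lemma tangent_scale:
  assumes "v \<in> tangent_space A m" "smooth_at A m f"
  shows "v (\<lambda>x. c * f x) = c * v f"
  using tangent_lin[OF assms assms(2), of c 0] by simp

lemma zero_tangent [simp]: "(\<lambda>_. 0) \<in> tangent_space A m"
  by (rule tangent_spaceI) auto

lemma lincomb_tangent: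
  assumes "u \<in> tangent_space A m" "v \<in> tangent_space A m"
  shows "lincomb a u b v \<in> tangent_space A m"
  unfolding lincomb_def
proof (rule tangent_spaceI)
  fix f g assume fg: "smooth_at A m f" "smooth_at A m g"
  show "a * u f + b * v f = a * u g + b * v g" if "\<forall>\<^sub>F x in nhds m. f x = g x"
    using tangent_cong[OF assms(1) fg that] tangent_cong[OF assms(2) fg that] by simp
  show "a * u (\<lambda>x. c * f x + d * g x) + b * v (\<lambda>x. c * f x + d * g x)
      = c * (a * u f + b * v f) + d * (a * u g + b * v g)" for c d
    using tangent_lin[OF assms(1) fg] tangent_lin[OF assms(2) fg] by (simp add: algebra_simps)
  show "a * u (\<lambda>x. f x * g x) + b * v (\<lambda>x. f x * g x) = (a * u f + b * v f) * g m + f m * (a * u g + b * v g)"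
    using tangent_mult[OF assms(1) fg] tangent_mult[OF assms(2) fg] by (simp add: algebra_simps)
qed (simp add: tangent_not_smooth[OF assms(1)] tangent_not_smooth[OF assms(2)])

lemma sum_tangent:
  assumes "\<And>i. i \<in> I \<Longrightarrow> v i \<in> tangent_space A m"
  shows "(\<lambda>f. \<Sum>i\<in>I. c i * v i f) \<in> tangent_space A m"
  using assms
proof (induction I rule: infinite_finite_induct)
  case (insert i I)
  have "lincomb (c i) (v i) 1 (\<lambda>f. \<Sum>i\<in>I. c i * v i f) \<in> tangent_space A m"
    by (rule lincomb_tangent) (use insert in auto)
  then show ?case using insert(1,2) by (simp add: lincomb_def)
qed auto

lemma field_tangent: "X \<in> vector_fields A \<Longrightarrow> X m \<in> tangent_space A m"
  by (simp add: vector_fields_def)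

lemma smooth_fun_imp_smooth_at: "smooth_fun A W f \<Longrightarrow> m \<in> W \<Longrightarrow> smooth_at A m f"
  unfolding smooth_at_def by blast

lemma field_smooth_at:
  assumes "X \<in> vector_fields A" "smooth_at A m f"
  shows "smooth_at A m (\<lambda>x. X x f)"
proof -
  obtain W where W: "m \<in> W" "smooth_fun A W f" using assms(2) by (auto simp: smooth_at_def)
  then have "smooth_fun A W (\<lambda>x. X x f)" using assms(1) by (auto simp: vector_fields_def)
  with W(1) show ?thesis by (rule smooth_fun_imp_smooth_at[rotated])
qed

lemma eventually_smooth_at:
  assumes "smooth_at A m f"
  shows "\<forall>\<^sub>F x in nhds m. smooth_at A x f"
proof -
  obtain W where W: "m \<in> W" "smooth_fun A W f" using assms by (auto simp: smooth_at_def)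
  have "open W" using W(2) by (simp add: smooth_fun_def)
  have "\<forall>\<^sub>F x in nhds m. x \<in> W" using \<open>open W\<close> W(1) by (rule eventually_nhds_in_open)
  then show ?thesis by (rule eventually_mono) (rule smooth_fun_imp_smooth_at[OF W(2)])
qed

lemma has_derivative_eventually_cong:
  assumes "(f has_derivative f') (at x)" "\<forall>\<^sub>F y in nhds x. f y = g y"
  shows "(g has_derivative f') (at x)"
proof -
  obtain S where "open S" "x \<in> S" "\<And>y. y \<in> S \<Longrightarrow> f y = g y"
    using assms(2) by (auto simp: eventually_nhds)
  then show ?thesis by (rule has_derivative_transform_within_open[OF assms(1)])
qed

context smooth_manifold
begin

section \<open>Charts and germs of smooth functions on the manifold\<close>

lemma chartD:
  assumes "(U, \<phi>) \<in> A"
  shows chart_open: "open U" and chart_image_open: "open (\<phi> ` U)"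
    and chart_inv: "\<And>x. x \<in> U \<Longrightarrow> inv_into U \<phi> (\<phi> x) = x"
    and chart_inv': "\<And>y. y \<in> \<phi> ` U \<Longrightarrow> \<phi> (inv_into U \<phi> y) = y"
    and chart_inv_mem: "\<And>y. y \<in> \<phi> ` U \<Longrightarrow> inv_into U \<phi> y \<in> U"
    and chart_continuous: "continuous_on U \<phi>"
    and chart_inv_continuous: "continuous_on (\<phi> ` U) (inv_into U \<phi>)"
  using chart[OF assms] unfolding homeomorphism_def by (blast intro: inv_into_into)+

lemma ex_chart: "\<exists>U \<phi>. (U, \<phi>) \<in> A \<and> m \<in> U"
proof -
  have "m \<in> (\<Union>(U, \<phi>) \<in> A. U)" using cover by simp
  then show ?thesis by blast
qed

lemma open_chart_image:
  assumes "(U, \<phi>) \<in> A" "open T"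
  shows "open (\<phi> ` (U \<inter> T))"
proof -
  have "\<phi> ` (U \<inter> T) = inv_into U \<phi> -` T \<inter> \<phi> ` U"
    using chart_inv[OF assms(1)] chart_inv'[OF assms(1)] chart_inv_mem[OF assms(1)]
    by (auto simp: image_iff)
  moreover have "open (inv_into U \<phi> -` T \<inter> \<phi> ` U)"
    using continuous_on_open_vimage[OF chart_image_open[OF assms(1)]] chart_inv_continuous[OF assms(1)] assms(2)
    by blast
  ultimately show ?thesis by simp
qed

lemma open_chart_vimage:
  assumes "(U, \<phi>) \<in> A" "open S"
  shows "open (\<phi> -` S \<inter> U)"
  using continuous_on_open_vimage[OF chart_open[OF assms(1)]] chart_continuous[OF assms(1)] assms(2)
  by blast

lemma eventually_chart:
  assumes "(U, \<phi>) \<in> A" "m \<in> U" "\<forall>\<^sub>F x in nhds m. P x"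
  shows "\<forall>\<^sub>F y in nhds (\<phi> m). y \<in> \<phi> ` U \<and> P (inv_into U \<phi> y)"
proof -
  obtain T where T: "open T" "m \<in> T" "\<And>x. x \<in> T \<Longrightarrow> P x"
    using assms(3) by (auto simp: eventually_nhds)
  have "\<forall>\<^sub>F y in nhds (\<phi> m). y \<in> \<phi> ` (U \<inter> T)"
    using open_chart_image[OF assms(1) T(1)] assms(2) T(2) by (intro eventually_nhds_in_open) auto
  then show ?thesis
    by (rule eventually_mono) (use T(3) chart_inv[OF assms(1)] in auto)
qed

lemma smooth_at_imp_near:
  assumes "(U, \<phi>) \<in> A" "m \<in> U" "smooth_at A m f"
  shows "smooth_near (\<phi> m) (f \<circ> inv_into U \<phi>)"
proof -
  obtain W where W: "m \<in> W" "smooth_fun A W f" using assms(3) by (auto simp: smooth_at_def)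
  have o: "open W" using W(2) by (simp add: smooth_fun_def)
  have "smooth_on (\<phi> ` (U \<inter> W)) (f \<circ> inv_into U \<phi>)"
    using W(2) assms(1) by (auto simp: smooth_fun_def)
  then show ?thesis
    using open_chart_image[OF assms(1) o] W(1) assms(2) unfolding smooth_near_def by blast
qed

text \<open>One chart suffices to certify smoothness: near each point of the domain W the
  representative in any other chart is the given one composed with a smooth transition map.\<close>

lemma near_imp_smooth_at:
  assumes c: "(U, \<phi>) \<in> A" "m \<in> U" and n: "smooth_near (\<phi> m) (f \<circ> inv_into U \<phi>)"
  shows "smooth_at A m f"
proof -
  obtain S where S: "open S" "\<phi> m \<in> S" "smooth_on S (f \<circ> inv_into U \<phi>)"
    using n by (auto simp: smooth_near_def)
  define W where "W = \<phi> -` S \<inter> U"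
  have oW: "open W" unfolding W_def by (rule open_chart_vimage[OF c(1) S(1)])
  have "smooth_on (\<psi> ` (V \<inter> W)) (f \<circ> inv_into V \<psi>)" if d: "(V, \<psi>) \<in> A" for V \<psi>
  proof -
    have o: "open (\<psi> ` (V \<inter> W))" by (rule open_chart_image[OF d oW])
    have "smooth_near y (f \<circ> inv_into V \<psi>)" if y: "y \<in> \<psi> ` (V \<inter> W)" for y
    proof -
      obtain x where x: "y = \<psi> x" "x \<in> V" "x \<in> W" using y by blast
      have xU: "x \<in> U" "\<phi> x \<in> S" using x(3) by (auto simp: W_def)
      have "smooth_on (\<psi> ` (V \<inter> U)) (\<phi> \<circ> inv_into V \<psi>)" by (rule compatible[OF d c(1)])
      then have t: "smooth_near y (\<phi> \<circ> inv_into V \<psi>)"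
        using open_chart_image[OF d chart_open[OF c(1)]] x xU unfolding smooth_near_def by blast
      have "(\<phi> \<circ> inv_into V \<psi>) y = \<phi> x" using chart_inv[OF d x(2)] x(1) by simp
      then have "smooth_near ((\<phi> \<circ> inv_into V \<psi>) y) (f \<circ> inv_into U \<phi>)"
        using S xU(2) by (auto simp: smooth_near_def)
      from smooth_near_compose[OF t this]
      have "smooth_near y (\<lambda>z. (f \<circ> inv_into U \<phi>) ((\<phi> \<circ> inv_into V \<psi>) z))" .
      then show ?thesis
      proof (rule smooth_near_cong)
        have "\<forall>\<^sub>F z in nhds y. z \<in> \<psi> ` (V \<inter> W)" using o y by (rule eventually_nhds_in_open)
        then show "\<forall>\<^sub>F z in nhds y. (f \<circ> inv_into U \<phi>) ((\<phi> \<circ> inv_into V \<psi>) z) = (f \<circ> inv_into V \<psi>) z"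
          by (rule eventually_mono) (auto simp: W_def chart_inv[OF d] chart_inv[OF c(1)])
      qed
    qed
    then show ?thesis using smooth_on_iff_near[OF o] by blast
  qed
  then have "smooth_fun A W f" using oW by (auto simp: smooth_fun_def)
  moreover have "m \<in> W" using c(2) S(2) by (simp add: W_def)
  ultimately show ?thesis by (auto simp: smooth_at_def)
qed

lemma smooth_fun_iff: "smooth_fun A W f \<longleftrightarrow> open W \<and> (\<forall>m\<in>W. smooth_at A m f)"
proof
  assume "smooth_fun A W f"
  then show "open W \<and> (\<forall>m\<in>W. smooth_at A m f)"
    using smooth_fun_imp_smooth_at by (auto simp: smooth_fun_def)
next
  assume R: "open W \<and> (\<forall>m\<in>W. smooth_at A m f)"
  have "smooth_on (\<phi> ` (U \<inter> W)) (f \<circ> inv_into U \<phi>)" if c: "(U, \<phi>) \<in> A" for U \<phi>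
    using smooth_on_iff_near[OF open_chart_image[OF c]] R smooth_at_imp_near[OF c] by blast
  then show "smooth_fun A W f" using R by (auto simp: smooth_fun_def)
qed

lemma smooth_at_via:
  assumes "\<And>U \<phi>. (U, \<phi>) \<in> A \<Longrightarrow> m \<in> U \<Longrightarrow> smooth_near (\<phi> m) (f \<circ> inv_into U \<phi>)"
  shows "smooth_at A m f"
  using ex_chart[of m] near_imp_smooth_at assms by blast

lemma smooth_at_cong:
  assumes "smooth_at A m f" "\<forall>\<^sub>F x in nhds m. f x = g x"
  shows "smooth_at A m g"
proof (rule smooth_at_via)
  fix U \<phi> assume c: "(U, \<phi>) \<in> A" "m \<in> U"
  show "smooth_near (\<phi> m) (g \<circ> inv_into U \<phi>)"
    by (rule smooth_near_cong[OF smooth_at_imp_near[OF c assms(1)]],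
        rule eventually_mono[OF eventually_chart[OF c assms(2)]]) auto
qed

lemma smooth_at_const: "smooth_at A m (\<lambda>_. c)"
  by (rule smooth_at_via) (simp add: o_def smooth_near_const)

lemma smooth_at_add:
  assumes "smooth_at A m f" "smooth_at A m g"
  shows "smooth_at A m (\<lambda>x. f x + g x)"
proof (rule smooth_at_via)
  fix U \<phi> assume c: "(U, \<phi>) \<in> A" "m \<in> U"
  show "smooth_near (\<phi> m) ((\<lambda>x. f x + g x) \<circ> inv_into U \<phi>)"
    using smooth_near_add[OF smooth_at_imp_near[OF c assms(1)] smooth_at_imp_near[OF c assms(2)]]
    by (simp add: o_def)
qed

lemma smooth_at_mult:
  assumes "smooth_at A m f" "smooth_at A m g"
  shows "smooth_at A m (\<lambda>x. f x * g x)"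
proof (rule smooth_at_via)
  fix U \<phi> assume c: "(U, \<phi>) \<in> A" "m \<in> U"
  show "smooth_near (\<phi> m) ((\<lambda>x. f x * g x) \<circ> inv_into U \<phi>)"
    using smooth_near_mult[OF smooth_at_imp_near[OF c assms(1)] smooth_at_imp_near[OF c assms(2)]]
    by (simp add: o_def)
qed

lemma smooth_at_diff:
  assumes "smooth_at A m f" "smooth_at A m g"
  shows "smooth_at A m (\<lambda>x. f x - g x)"
  using smooth_at_add[OF assms(1) smooth_at_mult[OF smooth_at_const[of _ "-1"] assms(2)]] by simp

lemma smooth_at_inverse:
  assumes "smooth_at A m f" "f m \<noteq> 0"
  shows "smooth_at A m (\<lambda>x. inverse (f x))"
proof (rule smooth_at_via)
  fix U \<phi> assume c: "(U, \<phi>) \<in> A" "m \<in> U"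
  show "smooth_near (\<phi> m) ((\<lambda>x. inverse (f x)) \<circ> inv_into U \<phi>)"
    using smooth_near_inverse[OF smooth_at_imp_near[OF c assms(1)]] assms(2) chart_inv[OF c]
    by (simp add: o_def)
qed

lemma smooth_at_sum:
  assumes "\<And>i. i \<in> I \<Longrightarrow> smooth_at A m (f i)"
  shows "smooth_at A m (\<lambda>x. \<Sum>i\<in>I. f i x)"
  using assms
  by (induction I rule: infinite_finite_induct) (auto intro: smooth_at_const smooth_at_add)

lemma tangent_const:
  assumes "v \<in> tangent_space A m"
  shows "v (\<lambda>_. c) = 0"
proof -
  have "v (\<lambda>_. 1 * 1) = v (\<lambda>_. 1) * 1 + 1 * v (\<lambda>_. 1)"
    using tangent_mult[OF assms smooth_at_const smooth_at_const, of 1 1] by simp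
  then have "v (\<lambda>_. 1) = 0" by simp
  then show ?thesis using tangent_scale[OF assms smooth_at_const, of c 1] by simp
qed

lemma tangent_sum:
  assumes "v \<in> tangent_space A m" "\<And>i. i \<in> I \<Longrightarrow> smooth_at A m (f i)"
  shows "v (\<lambda>x. \<Sum>i\<in>I. f i x) = (\<Sum>i\<in>I. v (f i))"
  using assms(2)
proof (induction I rule: infinite_finite_induct)
  case (insert i I)
  have "v (\<lambda>x. f i x + (\<Sum>i\<in>I. f i x)) = v (f i) + v (\<lambda>x. \<Sum>i\<in>I. f i x)"
    by (rule tangent_add[OF assms(1)]) (use insert in \<open>auto intro: smooth_at_sum\<close>)
  then show ?case using insert by simp
qed (use tangent_const[OF assms(1)] in auto)

lemma smooth_at_chart:
  assumes c: "(U, \<phi>) \<in> A" "m \<in> U" and h: "smooth_near (\<phi> m) h"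
  shows "smooth_at A m (\<lambda>x. h (\<phi> x))"
proof (rule near_imp_smooth_at[OF c])
  show "smooth_near (\<phi> m) ((\<lambda>x. h (\<phi> x)) \<circ> inv_into U \<phi>)"
    by (rule smooth_near_cong[OF h], rule eventually_mono[OF eventually_chart[OF c eventually_True]])
      (simp add: chart_inv'[OF c(1)])
qed

lemma smooth_at_coord:
  assumes "(U, \<phi>) \<in> A" "m \<in> U"
  shows "smooth_at A m (coord \<phi> b)"
  unfolding coord_def
  by (rule smooth_at_chart[OF assms, where h = "\<lambda>y. y \<bullet> b"])
    (intro smooth_near_bounded_linear bounded_linear_inner_left)

lemma chart_has_derivative:
  assumes "(U, \<phi>) \<in> A" "m \<in> U" "smooth_at A m f"
  shows "(f \<circ> inv_into U \<phi> has_derivative (\<lambda>b. chart_deriv U \<phi> b f m)) (at (\<phi> m))"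
  using smooth_near_has_derivative[OF smooth_at_imp_near[OF assms]]
  by (simp add: chart_deriv_def[abs_def])

lemma chart_derivI:
  assumes "(f \<circ> inv_into U \<phi> has_derivative f') (at (\<phi> m))"
  shows "chart_deriv U \<phi> b f m = f' b"
  using frechet_derivative_at[OF assms] by (simp add: chart_deriv_def)

lemma chart_deriv_cong:
  assumes c: "(U, \<phi>) \<in> A" "m \<in> U" and f: "smooth_at A m f" "\<forall>\<^sub>F x in nhds m. f x = g x"
  shows "chart_deriv U \<phi> b f m = chart_deriv U \<phi> b g m"
proof -
  have "(g \<circ> inv_into U \<phi> has_derivative (\<lambda>b. chart_deriv U \<phi> b f m)) (at (\<phi> m))"
    by (rule has_derivative_eventually_cong[OF chart_has_derivative[OF c f(1)]],
        rule eventually_mono[OF eventually_chart[OF c f(2)]]) auto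
  from chart_derivI[OF this] show ?thesis by simp
qed

lemma smooth_at_chart_deriv:
  assumes c: "(U, \<phi>) \<in> A" "m \<in> U" and f: "smooth_at A m f"
  shows "smooth_at A m (chart_deriv U \<phi> b f)"
  unfolding chart_deriv_def[abs_def]
  by (rule smooth_at_chart[OF c, where h = "\<lambda>y. frechet_derivative (f \<circ> inv_into U \<phi>) (at y) b"])
    (rule smooth_near_derivative[OF smooth_at_imp_near[OF c f]])

lemma chart_deriv_commute:
  assumes c: "(U, \<phi>) \<in> A" "m \<in> U" and f: "smooth_at A m f"
  shows "chart_deriv U \<phi> b (chart_deriv U \<phi> d f) m = chart_deriv U \<phi> d (chart_deriv U \<phi> b f) m"
proof -
  define F where "F = f \<circ> inv_into U \<phi>"
  have F: "smooth_near (\<phi> m) F" unfolding F_def by (rule smooth_at_imp_near[OF c f])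
  have "chart_deriv U \<phi> b (chart_deriv U \<phi> d f) m = frechet_derivative (\<lambda>y. frechet_derivative F (at y) d) (at (\<phi> m)) b"
    for b d
  proof (rule chart_derivI)
    show "(chart_deriv U \<phi> d f \<circ> inv_into U \<phi> has_derivative
        frechet_derivative (\<lambda>y. frechet_derivative F (at y) d) (at (\<phi> m))) (at (\<phi> m))"
      by (rule has_derivative_eventually_cong[OF smooth_near_has_derivative[OF smooth_near_derivative[OF F]]],
          rule eventually_mono[OF eventually_chart[OF c eventually_True]])
        (simp add: chart_deriv_def F_def chart_inv'[OF c(1)])
  qed
  then show ?thesis using second_derivative_commute[OF F] by simp
qed

lemma chart_deriv_coord:
  assumes c: "(U, \<phi>) \<in> A" "m \<in> U"
  shows "chart_deriv U \<phi> b (coord \<phi> d) m = b \<bullet> d"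
proof (rule chart_derivI)
  show "(coord \<phi> d \<circ> inv_into U \<phi> has_derivative (\<lambda>b. b \<bullet> d)) (at (\<phi> m))"
    by (rule has_derivative_eventually_cong[OF bounded_linear_imp_has_derivative[OF bounded_linear_inner_left]],
        rule eventually_mono[OF eventually_chart[OF c eventually_True]])
      (simp add: coord_def chart_inv'[OF c(1)])
qed

lemma chart_deriv_tangent:
  assumes c: "(U, \<phi>) \<in> A" "m \<in> U"
  shows "(\<lambda>f. if smooth_at A m f then chart_deriv U \<phi> b f m else 0) \<in> tangent_space A m"
proof (rule tangent_spaceI)
  fix f g assume fg: "smooth_at A m f" "smooth_at A m g"
  note d = chart_has_derivative[OF c fg(1)] chart_has_derivative[OF c fg(2)]
  show "(if smooth_at A m f then chart_deriv U \<phi> b f m else 0) = (if smooth_at A m g then chart_deriv U \<phi> b g m else 0)"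
    if "\<forall>\<^sub>F x in nhds m. f x = g x"
    using chart_deriv_cong[OF c fg(1) that] fg by simp
  fix a e
  have "chart_deriv U \<phi> b (\<lambda>x. a * f x + e * g x) m = a * chart_deriv U \<phi> b f m + e * chart_deriv U \<phi> b g m"
    using has_derivative_add[OF has_derivative_mult_right[OF d(1), of a] has_derivative_mult_right[OF d(2), of e]]
    by (intro chart_derivI) (simp add: o_def)
  moreover have "smooth_at A m (\<lambda>x. a * f x + e * g x)"
    by (intro smooth_at_add smooth_at_mult smooth_at_const fg)
  ultimately show "(if smooth_at A m (\<lambda>x. a * f x + e * g x) then chart_deriv U \<phi> b (\<lambda>x. a * f x + e * g x) m else 0)
    = a * (if smooth_at A m f then chart_deriv U \<phi> b f m else 0) + e * (if smooth_at A m g then chart_deriv U \<phi> b g m else 0)"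
    using fg by simp
next
  fix f g assume fg: "smooth_at A m f" "smooth_at A m g"
  note d = chart_has_derivative[OF c fg(1)] chart_has_derivative[OF c fg(2)]
  have "((\<lambda>x. f x * g x) \<circ> inv_into U \<phi> has_derivative
      (\<lambda>b. f m * chart_deriv U \<phi> b g m + chart_deriv U \<phi> b f m * g m)) (at (\<phi> m))"
    using has_derivative_mult[OF d] by (simp add: o_def chart_inv[OF c])
  then have "chart_deriv U \<phi> b (\<lambda>x. f x * g x) m = f m * chart_deriv U \<phi> b g m + chart_deriv U \<phi> b f m * g m"
    by (rule chart_derivI)
  then show "(if smooth_at A m (\<lambda>x. f x * g x) then chart_deriv U \<phi> b (\<lambda>x. f x * g x) m else 0)
    = (if smooth_at A m f then chart_deriv U \<phi> b f m else 0) * g m + f m * (if smooth_at A m g then chart_deriv U \<phi> b g m else 0)"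
    using fg smooth_at_mult[OF fg] by simp
qed auto

text \<open>Apply v to the Hadamard form of f. Constants are killed, and since the coordinate
  differences vanish at m, the Leibniz rule retains only the values at m of the Hadamard
  coefficients, which are the partial derivatives of f. Thus a derivation is determined by its
  values on coordinates.\<close>

lemma tangent_expansion:
  assumes c: "(U, \<phi>) \<in> A" "m \<in> U" and v: "v \<in> tangent_space A m" and f: "smooth_at A m f"
  shows "v f = (\<Sum>b\<in>onb. v (coord \<phi> b) * chart_deriv U \<phi> b f m)"
proof -
  obtain h where h: "\<And>b. smooth_near (\<phi> m) (h b)"
    "\<And>b. h b (\<phi> m) = frechet_derivative (f \<circ> inv_into U \<phi>) (at (\<phi> m)) b"
    "\<forall>\<^sub>F y in nhds (\<phi> m). (f \<circ> inv_into U \<phi>) y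
      = (f \<circ> inv_into U \<phi>) (\<phi> m) + (\<Sum>b\<in>onb. ((y - \<phi> m) \<bullet> b) * h b y)"
    using Hadamard[OF smooth_at_imp_near[OF c f]] by blast
  obtain S where S: "open S" "\<phi> m \<in> S" "\<And>y. y \<in> S \<Longrightarrow> (f \<circ> inv_into U \<phi>) y
      = (f \<circ> inv_into U \<phi>) (\<phi> m) + (\<Sum>b\<in>onb. ((y - \<phi> m) \<bullet> b) * h b y)"
    using h(3) unfolding eventually_nhds by blast
  \<comment> \<open>The Hadamard form pulled back along the chart. It equals f only near m, but v
    depends only on the germ.\<close>
  define g where "g = (\<lambda>x. f m + (\<Sum>b\<in>onb. (coord \<phi> b x - coord \<phi> b m) * h b (\<phi> x)))"
  have eq: "\<forall>\<^sub>F x in nhds m. f x = g x"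
  proof -
    have "\<forall>\<^sub>F x in nhds m. x \<in> \<phi> -` S \<inter> U"
      by (rule eventually_nhds_in_open[OF open_chart_vimage[OF c(1) S(1)]]) (use c(2) S(2) in simp)
    then show ?thesis
    proof (rule eventually_mono)
      fix x assume x: "x \<in> \<phi> -` S \<inter> U"
      then show "f x = g x"
        using S(3)[of "\<phi> x"] chart_inv[OF c(1)] c(2) by (simp add: g_def coord_def inner_diff_left)
    qed
  qed
  have hs: "smooth_at A m (\<lambda>x. h b (\<phi> x))" for b by (rule smooth_at_chart[OF c h(1)])
  have cs: "smooth_at A m (\<lambda>x. coord \<phi> b x - coord \<phi> b m)" for b
    by (intro smooth_at_diff smooth_at_coord[OF c] smooth_at_const)
  have ts: "smooth_at A m (\<lambda>x. (coord \<phi> b x - coord \<phi> b m) * h b (\<phi> x))" for b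
    by (intro smooth_at_mult cs hs)
  have "v f = v g"
    by (rule tangent_cong[OF v f smooth_at_cong[OF f eq] eq])
  also have "\<dots> = (\<Sum>b\<in>onb. v (\<lambda>x. (coord \<phi> b x - coord \<phi> b m) * h b (\<phi> x)))"
    unfolding g_def
    by (subst tangent_add[OF v smooth_at_const smooth_at_sum[OF ts]])
      (simp add: tangent_const[OF v] tangent_sum[OF v ts])
  also have "\<dots> = (\<Sum>b\<in>onb. v (coord \<phi> b) * chart_deriv U \<phi> b f m)"
  proof (rule sum.cong[OF refl])
    fix b
    have "v (\<lambda>x. coord \<phi> b x - coord \<phi> b m) = v (coord \<phi> b)"
      using tangent_diff[OF v smooth_at_coord[OF c] smooth_at_const] tangent_const[OF v] by simp
    then show "v (\<lambda>x. (coord \<phi> b x - coord \<phi> b m) * h b (\<phi> x)) = v (coord \<phi> b) * chart_deriv U \<phi> b f m"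
      using tangent_mult[OF v cs hs, of b b] by (simp add: h(2) chart_deriv_def)
  qed
  finally show ?thesis .
qed

section \<open>Vector fields, brackets and local frames\<close>

lemma vector_fieldsI:
  assumes "\<And>m. X m \<in> tangent_space A m"
    and "\<And>m f. smooth_at A m f \<Longrightarrow> smooth_at A m (\<lambda>x. X x f)"
  shows "X \<in> vector_fields A"
  using assms by (auto simp: vector_fields_def smooth_fun_iff)

lemma sum_vector_fields:
  assumes "\<And>i. i \<in> I \<Longrightarrow> X i \<in> vector_fields A" "\<And>i m. i \<in> I \<Longrightarrow> smooth_at A m (a i)"
  shows "(\<lambda>m f. \<Sum>i\<in>I. a i m * X i m f) \<in> vector_fields A"
  by (rule vector_fieldsI)
    (use assms in \<open>auto intro!: sum_tangent smooth_at_sum smooth_at_mult intro: field_tangent field_smooth_at\<close>)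

lemma lincomb_vector_fields:
  assumes "X \<in> vector_fields A" "Y \<in> vector_fields A" "\<And>m. smooth_at A m a" "\<And>m. smooth_at A m b"
  shows "(\<lambda>m. lincomb (a m) (X m) (b m) (Y m)) \<in> vector_fields A"
  by (rule vector_fieldsI)
    (use assms in \<open>auto simp: lincomb_def[abs_def] intro!: lincomb_tangent[unfolded lincomb_def]
      smooth_at_add smooth_at_mult intro: field_tangent field_smooth_at\<close>)

lemma lie_bracket_tangent:
  assumes X: "X \<in> vector_fields A" and Y: "Y \<in> vector_fields A"
  shows "lie_bracket A X Y m \<in> tangent_space A m"
proof (rule tangent_spaceI)
  note Xm = field_tangent[OF X, of m] and Ym = field_tangent[OF Y, of m]
  show "lie_bracket A X Y m f = 0" if "\<not> smooth_at A m f" for f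
    using that by (simp add: lie_bracket_def)
  fix f g assume fg: "smooth_at A m f" "smooth_at A m g"
  note fs = field_smooth_at[OF X fg(1)] field_smooth_at[OF X fg(2)]
    field_smooth_at[OF Y fg(1)] field_smooth_at[OF Y fg(2)]
  have ev: "\<forall>\<^sub>F x in nhds m. smooth_at A x f \<and> smooth_at A x g"
    by (rule eventually_conj[OF eventually_smooth_at[OF fg(1)] eventually_smooth_at[OF fg(2)]])
  show "lie_bracket A X Y m f = lie_bracket A X Y m g" if eq: "\<forall>\<^sub>F x in nhds m. f x = g x"
  proof -
    \<comment> \<open>Equality at m alone would not do, since the other field differentiates the
      result again. If f and g agree near m, they also agree near every point close to m, so the
      functions \<open>Z x f\<close> and \<open>Z x g\<close> have the same germ.\<close>
    have "\<forall>\<^sub>F x in nhds m. Z x f = Z x g" if Z: "Z \<in> vector_fields A" for Z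
    proof -
      have "\<forall>\<^sub>F x in nhds m. \<forall>\<^sub>F y in nhds x. f y = g y" using eq by (simp add: eventually_eventually)
      then show ?thesis using ev
        by eventually_elim (auto intro: tangent_cong[OF field_tangent[OF Z]])
    qed
    then show ?thesis
      using tangent_cong[OF Xm fs(3,4)] tangent_cong[OF Ym fs(1,2)] X Y fg
      by (simp add: lie_bracket_def lie_deriv_def)
  qed
  show "lie_bracket A X Y m (\<lambda>x. a * f x + b * g x) = a * lie_bracket A X Y m f + b * lie_bracket A X Y m g" for a b
  proof -
    have s: "smooth_at A m (\<lambda>x. a * f x + b * g x)"
      by (intro smooth_at_add smooth_at_mult smooth_at_const fg)
    have Z: "\<forall>\<^sub>F x in nhds m. Z x (\<lambda>x. a * f x + b * g x) = a * Z x f + b * Z x g"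
      if Z: "Z \<in> vector_fields A" for Z
      using ev by eventually_elim (auto intro: tangent_lin[OF field_tangent[OF Z]])
    have s': "smooth_at A m (\<lambda>x. a * Z x f + b * Z x g)" if Z: "Z \<in> vector_fields A" for Z
      by (intro smooth_at_add smooth_at_mult smooth_at_const field_smooth_at[OF Z] fg)
    have "X m (\<lambda>x. Y x (\<lambda>x. a * f x + b * g x)) = a * X m (\<lambda>x. Y x f) + b * X m (\<lambda>x. Y x g)"
      using tangent_cong[OF Xm field_smooth_at[OF Y s] s'[OF Y] Z[OF Y]] tangent_lin[OF Xm fs(3,4)] by simp
    moreover have "Y m (\<lambda>x. X x (\<lambda>x. a * f x + b * g x)) = a * Y m (\<lambda>x. X x f) + b * Y m (\<lambda>x. X x g)"
      using tangent_cong[OF Ym field_smooth_at[OF X s] s'[OF X] Z[OF X]] tangent_lin[OF Ym fs(1,2)] by simp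
    ultimately show ?thesis
      using fg s by (simp add: lie_bracket_def lie_deriv_def algebra_simps)
  qed
  show "lie_bracket A X Y m (\<lambda>x. f x * g x) = lie_bracket A X Y m f * g m + f m * lie_bracket A X Y m g"
  proof -
    have s: "smooth_at A m (\<lambda>x. f x * g x)" by (intro smooth_at_mult fg)
    have Z: "\<forall>\<^sub>F x in nhds m. Z x (\<lambda>x. f x * g x) = Z x f * g x + f x * Z x g"
      if Z: "Z \<in> vector_fields A" for Z
      using ev by eventually_elim (auto intro: tangent_mult[OF field_tangent[OF Z]])
    have s': "smooth_at A m (\<lambda>x. Z x f * g x)" "smooth_at A m (\<lambda>x. f x * Z x g)"
      "smooth_at A m (\<lambda>x. Z x f * g x + f x * Z x g)" if Z: "Z \<in> vector_fields A" for Z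
      by (intro smooth_at_add smooth_at_mult smooth_at_const field_smooth_at[OF Z] fg)+
    have "X m (\<lambda>x. Y x (\<lambda>x. f x * g x))
        = X m (\<lambda>x. Y x f) * g m + Y m f * X m g + (X m f * Y m g + f m * X m (\<lambda>x. Y x g))"
      using tangent_cong[OF Xm field_smooth_at[OF Y s] s'(3)[OF Y] Z[OF Y]] tangent_add[OF Xm s'(1,2)[OF Y]]
        tangent_mult[OF Xm fs(3) fg(2)] tangent_mult[OF Xm fg(1) fs(4)] by simp
    moreover have "Y m (\<lambda>x. X x (\<lambda>x. f x * g x))
        = Y m (\<lambda>x. X x f) * g m + X m f * Y m g + (Y m f * X m g + f m * Y m (\<lambda>x. X x g))"
      using tangent_cong[OF Ym field_smooth_at[OF X s] s'(3)[OF X] Z[OF X]] tangent_add[OF Ym s'(1,2)[OF X]]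
        tangent_mult[OF Ym fs(1) fg(2)] tangent_mult[OF Ym fg(1) fs(2)] by simp
    ultimately show ?thesis
      using fg s by (simp add: lie_bracket_def lie_deriv_def algebra_simps)
  qed
qed

text \<open>The set K is the preimage of a closed ball in the chart: it is compact, hence closed
  because the manifold is Hausdorff. This is what makes the extension by zero beyond the chart
  smooth. P is the open ball of half the radius.\<close>

lemma manifold_bump:
  assumes c: "(U, \<phi>) \<in> A" "m \<in> U" and N: "open N" "m \<in> N"
  obtains \<rho> P K where "\<And>x. smooth_at A x \<rho>" "open P" "m \<in> P" "\<And>x. x \<in> P \<Longrightarrow> \<rho> x = 1"
    "closed K" "P \<subseteq> K" "K \<subseteq> N \<inter> U" "\<And>x. x \<notin> K \<Longrightarrow> \<rho> x = 0"
proof -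
  have "open (\<phi> ` (U \<inter> N))" "\<phi> m \<in> \<phi> ` (U \<inter> N)"
    using open_chart_image[OF c(1) N(1)] c(2) N(2) by auto
  then obtain e where e: "e > 0" "cball (\<phi> m) e \<subseteq> \<phi> ` (U \<inter> N)"
    using open_contains_cball by metis
  obtain \<rho>0 :: "'e \<Rightarrow> real" where \<rho>0: "\<And>x. smooth_near x \<rho>0"
    "\<And>x. dist (\<phi> m) x \<le> e / 2 \<Longrightarrow> \<rho>0 x = 1" "\<And>x. dist (\<phi> m) x \<ge> e \<Longrightarrow> \<rho>0 x = 0"
    using ex_bump[of "e / 2" "\<phi> m"] e(1) by auto
  define K where "K = inv_into U \<phi> ` cball (\<phi> m) e"
  define \<rho> where "\<rho> = (\<lambda>x. if x \<in> U then \<rho>0 (\<phi> x) else 0)"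
  define P where "P = \<phi> -` ball (\<phi> m) (e / 2) \<inter> U"
  have "compact K"
    unfolding K_def
  proof (rule compact_continuous_image)
    show "continuous_on (cball (\<phi> m) e) (inv_into U \<phi>)"
      by (rule continuous_on_subset[OF chart_inv_continuous[OF c(1)]]) (use e(2) in blast)
    show "compact (cball (\<phi> m) e)" by (simp add: compact_eq_bounded_closed)
  qed
  then have closed: "closed K" by (rule compact_imp_closed)
  have memK: "x \<in> K" if "x \<in> U" "dist (\<phi> m) (\<phi> x) \<le> e" for x
    unfolding K_def by (rule image_eqI[of _ _ "\<phi> x"]) (use that chart_inv[OF c(1)] in auto)
  have KU: "K \<subseteq> N \<inter> U"
  proof
    fix x assume "x \<in> K"
    then obtain y where y: "x = inv_into U \<phi> y" "y \<in> cball (\<phi> m) e" by (auto simp: K_def)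
    then obtain x' where "y = \<phi> x'" "x' \<in> U" "x' \<in> N" using e(2) by blast
    then show "x \<in> N \<inter> U" using y(1) chart_inv[OF c(1)] by simp
  qed
  have zero: "\<rho> x = 0" if "x \<notin> K" for x
    using memK[of x] that \<rho>0(3)[of "\<phi> x"] by (force simp: \<rho>_def)
  have "smooth_at A x \<rho>" for x
  proof (cases "x \<in> U")
    case True
    show ?thesis
    proof (rule smooth_at_cong[OF smooth_at_chart[OF c(1) True \<rho>0(1)]])
      show "\<forall>\<^sub>F x in nhds x. \<rho>0 (\<phi> x) = \<rho> x"
        by (rule eventually_mono[OF eventually_nhds_in_open[OF chart_open[OF c(1)] True]]) (simp add: \<rho>_def)
    qed
  next
    case False
    then have "x \<in> - K" using KU by blast
    show ?thesis
      by (rule smooth_at_cong[OF smooth_at_const[of _ 0]],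
          rule eventually_mono[OF eventually_nhds_in_open[OF open_Compl[OF closed] \<open>x \<in> - K\<close>]])
        (simp add: zero)
  qed
  moreover have "open P" unfolding P_def by (rule open_chart_vimage[OF c(1) open_ball])
  moreover have "m \<in> P" using c(2) e(1) by (simp add: P_def)
  moreover have "\<rho> x = 1" if "x \<in> P" for x using \<rho>0(2) that by (simp add: P_def \<rho>_def)
  moreover have "P \<subseteq> K" using memK e(1) by (auto simp: P_def)
  ultimately show thesis by (intro that[of \<rho> P K] closed KU zero)
qed

text \<open>Coordinate fields and coordinate functions of a chart, made global by one and the same
  bump function. On P, where the bump is 1, duality, expansion and commutation are inherited from
  the chart. The support set K inside a prescribed N is what later permits components of a locally
  defined bi-form to be extended by zero.\<close>

lemma local_frame:
  assumes N: "open N" "m0 \<in> N"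
  obtains P K and E :: "'e \<Rightarrow> 'a field" and u :: "'e \<Rightarrow> 'a \<Rightarrow> real" where
    "open P" "m0 \<in> P" "closed K" "P \<subseteq> K" "K \<subseteq> N"
    "\<And>b. E b \<in> vector_fields A" "\<And>b x. x \<notin> K \<Longrightarrow> E b x = (\<lambda>_. 0)"
    "\<And>b x. smooth_at A x (u b)"
    "\<And>x b c. x \<in> P \<Longrightarrow> b \<in> onb \<Longrightarrow> c \<in> onb \<Longrightarrow> E b x (u c) = (if b = c then 1 else 0)"
    "\<And>x v f. x \<in> P \<Longrightarrow> v \<in> tangent_space A x \<Longrightarrow> v f = (\<Sum>b\<in>onb. v (u b) * E b x f)"
    "\<And>x b c. x \<in> P \<Longrightarrow> lie_bracket A (E b) (E c) x = (\<lambda>_. 0)"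
proof -
  obtain U \<phi> where c: "(U, \<phi>) \<in> A" "m0 \<in> U" using ex_chart by blast
  obtain \<rho> P K where r: "\<And>x. smooth_at A x \<rho>" "open P" "m0 \<in> P" "\<And>x. x \<in> P \<Longrightarrow> \<rho> x = 1"
    "closed K" "P \<subseteq> K" "K \<subseteq> N \<inter> U" "\<And>x. x \<notin> K \<Longrightarrow> \<rho> x = 0"
    by (rule manifold_bump[OF c N]) (rule that)
  define E where "E = (\<lambda>b x f. if x \<in> U \<and> smooth_at A x f then \<rho> x * chart_deriv U \<phi> b f x else 0)"
  define u where "u = (\<lambda>b x. if x \<in> U then \<rho> x * coord \<phi> b x else 0)"
  have PU: "P \<subseteq> U" using r by blast
  \<comment> \<open>Gluing rule for functions vanishing off the closed set K: a point outside U has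
    a neighbourhood on which g is zero, so smoothness needs checking at points of U only.\<close>
  have ext: "smooth_at A x g" if "\<And>y. y \<notin> K \<Longrightarrow> g y = 0" "x \<in> U \<Longrightarrow> smooth_at A x g" for g x
  proof (cases "x \<in> U")
    case False
    then have "x \<in> - K" using r(7) by blast
    show ?thesis
      by (rule smooth_at_cong[OF smooth_at_const[of _ 0]],
          rule eventually_mono[OF eventually_nhds_in_open[OF open_Compl[OF r(5)] \<open>x \<in> - K\<close>]])
        (simp add: that(1))
  qed (rule that(2))
  have inU: "\<forall>\<^sub>F y in nhds x. y \<in> U" if "x \<in> U" for x
    by (rule eventually_nhds_in_open[OF chart_open[OF c(1)] that])
  have inP: "\<forall>\<^sub>F y in nhds x. y \<in> P" if "x \<in> P" for x
    by (rule eventually_nhds_in_open[OF r(2) that])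
  have EK: "E b x = (\<lambda>_. 0)" if "x \<notin> K" for b x using r(8)[OF that] by (simp add: E_def fun_eq_iff)
  have E: "E b \<in> vector_fields A" for b
  proof (rule vector_fieldsI)
    fix x
    show "E b x \<in> tangent_space A x"
    proof (cases "x \<in> U")
      case True
      have "lincomb (\<rho> x) (\<lambda>f. if smooth_at A x f then chart_deriv U \<phi> b f x else 0) 0 (\<lambda>_. 0) \<in> tangent_space A x"
        by (intro lincomb_tangent chart_deriv_tangent[OF c(1) True] zero_tangent)
      moreover have "E b x = lincomb (\<rho> x) (\<lambda>f. if smooth_at A x f then chart_deriv U \<phi> b f x else 0) 0 (\<lambda>_. 0)"
        using True by (simp add: E_def lincomb_def fun_eq_iff)
      ultimately show ?thesis by simp
    next
      case False
      then have "E b x = (\<lambda>_. 0)" by (simp add: E_def)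
      then show ?thesis by simp
    qed
    fix f assume f: "smooth_at A x f"
    show "smooth_at A x (\<lambda>x. E b x f)"
    proof (rule ext)
      show "E b y f = 0" if "y \<notin> K" for y using EK[OF that] by simp
      assume x: "x \<in> U"
      have "smooth_at A x (\<lambda>y. \<rho> y * chart_deriv U \<phi> b f y)"
        by (intro smooth_at_mult r(1) smooth_at_chart_deriv[OF c(1) x f])
      then show "smooth_at A x (\<lambda>x. E b x f)"
        by (rule smooth_at_cong)
          (rule eventually_mono[OF eventually_conj[OF inU[OF x] eventually_smooth_at[OF f]]], simp add: E_def)
    qed
  qed
  have u: "smooth_at A x (u b)" for b x
  proof (rule ext)
    show "u b y = 0" if "y \<notin> K" for y using r(8)[OF that] by (simp add: u_def)
    assume x: "x \<in> U"
    have "smooth_at A x (\<lambda>y. \<rho> y * coord \<phi> b y)"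
      by (intro smooth_at_mult r(1) smooth_at_coord[OF c(1) x])
    then show "smooth_at A x (u b)"
      by (rule smooth_at_cong) (rule eventually_mono[OF inU[OF x]], simp add: u_def)
  qed
  have uc: "\<forall>\<^sub>F y in nhds x. coord \<phi> b y = u b y" if "x \<in> P" for b x
    by (rule eventually_mono[OF inP[OF that]]) (use PU r(4) in \<open>auto simp: u_def\<close>)
  have EP: "E b x f = chart_deriv U \<phi> b f x" if "x \<in> P" "smooth_at A x f" for b x f
    using that PU r(4)[OF that(1)] by (auto simp: E_def)
  show thesis
  proof (rule that[of P K E u])
    fix x assume x: "x \<in> P"
    then have xU: "x \<in> U" using PU by blast
    show "E b x (u d) = (if b = d then 1 else 0)" if "b \<in> onb" "d \<in> onb" for b d
      using EP[OF x u] chart_deriv_cong[OF c(1) xU smooth_at_coord[OF c(1) xU] uc[OF x]]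
        chart_deriv_coord[OF c(1) xU] inner_onb[OF that] by metis
    show "v f = (\<Sum>b\<in>onb. v (u b) * E b x f)" if v: "v \<in> tangent_space A x" for v f
    proof (cases "smooth_at A x f")
      case True
      have "v (coord \<phi> b) = v (u b)" for b
        by (rule tangent_cong[OF v smooth_at_coord[OF c(1) xU] u uc[OF x]])
      then show ?thesis using tangent_expansion[OF c(1) xU v True] EP[OF x True] by simp
    next
      case False
      then show ?thesis
        using tangent_not_smooth[OF v False] tangent_not_smooth[OF field_tangent[OF E] False] by simp
    qed
    show "lie_bracket A (E b) (E d) x = (\<lambda>_. 0)" for b d
    proof
      fix f
      show "lie_bracket A (E b) (E d) x f = 0"
      proof (cases "smooth_at A x f")
        case True
        have "E b x (\<lambda>y. E d y f) = chart_deriv U \<phi> b (chart_deriv U \<phi> d f) x" for b d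
        proof -
          have ev: "\<forall>\<^sub>F y in nhds x. E d y f = chart_deriv U \<phi> d f y"
            by (rule eventually_mono[OF eventually_conj[OF inP[OF x] eventually_smooth_at[OF True]]]) (use EP in auto)
          show ?thesis
            using EP[OF x field_smooth_at[OF E True]] chart_deriv_cong[OF c(1) xU field_smooth_at[OF E True] ev]
            by simp
        qed
        then show ?thesis
          using chart_deriv_commute[OF c(1) xU True] by (simp add: lie_bracket_def lie_deriv_def)
      qed (simp add: lie_bracket_def)
    qed
  qed (use r E EK u in auto)
qed

text \<open>Take constant coefficients with respect to the global fields of a local frame. Without
  this existence statement the choice in \<open>field_through\<close>, and with it
  \<open>left_diff\<close>, would carry no information.\<close>

lemma ex_field_through:
  assumes "v \<in> tangent_space A m"
  shows "\<exists>X. X \<in> vector_fields A \<and> X m = v"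
proof -
  obtain P K and E :: "'e \<Rightarrow> 'a field" and u where F: "m \<in> P" "\<And>b. E b \<in> vector_fields A"
    "\<And>x v f. x \<in> P \<Longrightarrow> v \<in> tangent_space A x \<Longrightarrow> v f = (\<Sum>b\<in>onb. v (u b) * E b x f)"
    by (rule local_frame[OF open_UNIV UNIV_I, of m]) blast
  show ?thesis
  proof (intro exI conjI)
    show "(\<lambda>x f. \<Sum>b\<in>onb. v (u b) * E b x f) \<in> vector_fields A"
      by (intro sum_vector_fields F smooth_at_const)
    show "(\<lambda>f. \<Sum>b\<in>onb. v (u b) * E b m f) = v"
      by (rule ext) (rule F(3)[OF F(1) assms, symmetric])
  qed
qed

lemma field_through:
  assumes "v \<in> tangent_space A m"
  shows "field_through A m v \<in> vector_fields A" "field_through A m v m = v"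
  using someI_ex[OF ex_field_through[OF assms]] unfolding field_through_def by blast+

end

section \<open>Product manifolds\<close>

lemma smooth_near_Pair:
  fixes f :: "'u::real_normed_vector \<Rightarrow> 'v::{real_inner,heine_borel}"
    and g :: "'u \<Rightarrow> 'w::{real_inner,heine_borel}"
  assumes "smooth_near x f" "smooth_near x g"
  shows "smooth_near x (\<lambda>x. (f x, g x))"
proof -
  have "smooth_near x (\<lambda>x. (f x, 0::'w))"
    by (rule smooth_near_compose[OF assms(1), where f = "\<lambda>a. (a, 0)"])
      (intro smooth_near_bounded_linear bounded_linear_Pair bounded_linear_ident bounded_linear_zero)
  moreover have "smooth_near x (\<lambda>x. (0::'v, g x))"
    by (rule smooth_near_compose[OF assms(2), where f = "\<lambda>a. (0, a)"])
      (intro smooth_near_bounded_linear bounded_linear_Pair bounded_linear_ident bounded_linear_zero)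
  ultimately have "smooth_near x (\<lambda>x. (f x, 0) + (0, g x))" by (rule smooth_near_add)
  then show ?thesis by simp
qed

lemma map_prod_Times: "map_prod \<phi> \<psi> ` (U \<times> V) = \<phi> ` U \<times> \<psi> ` V"
  by (auto simp: image_iff)

lemma prod_atlas_memI: "(U, \<phi>) \<in> A \<Longrightarrow> (V, \<psi>) \<in> B \<Longrightarrow> (U \<times> V, map_prod \<phi> \<psi>) \<in> prod_atlas A B"
  by (auto simp: prod_atlas_def)

context smooth_manifold
begin

lemma prod_chart_inv:
  assumes c: "(U, \<phi>) \<in> A" "(V, \<psi>) \<in> A" and z: "z \<in> \<phi> ` U \<times> \<psi> ` V"
  shows "inv_into (U \<times> V) (map_prod \<phi> \<psi>) z = (inv_into U \<phi> (fst z), inv_into V \<psi> (snd z))"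
proof (rule inv_into_f_eq)
  show "inj_on (map_prod \<phi> \<psi>) (U \<times> V)"
    by (rule map_prod_inj_on; rule inj_on_inverseI) (erule chart_inv[OF c(1)] chart_inv[OF c(2)])+
qed (use z chart_inv_mem[OF c(1)] chart_inv_mem[OF c(2)] chart_inv'[OF c(1)] chart_inv'[OF c(2)] in auto)

text \<open>Makes every result about one point available for functions of two points, by
  instantiating the locale with the product atlas.\<close>

lemma prod_manifold: "smooth_manifold (prod_atlas A A)"
proof (rule smooth_manifold.intro)
  fix UV :: "('a \<times> 'a) set" and \<Phi> :: "'a \<times> 'a \<Rightarrow> 'e \<times> 'e"
  assume "(UV, \<Phi>) \<in> prod_atlas A A"
  then obtain U \<phi> V \<psi> where eq: "UV = U \<times> V" "\<Phi> = map_prod \<phi> \<psi>" and c: "(U, \<phi>) \<in> A" "(V, \<psi>) \<in> A"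
    by (auto simp: prod_atlas_def)
  have img: "\<Phi> ` UV = \<phi> ` U \<times> \<psi> ` V" unfolding eq by (rule map_prod_Times)
  have inv: "inv_into UV \<Phi> z = (inv_into U \<phi> (fst z), inv_into V \<psi> (snd z))" if "z \<in> \<phi> ` U \<times> \<psi> ` V" for z
    unfolding eq by (rule prod_chart_inv[OF c that])
  have "continuous_on (U \<times> V) (\<lambda>z. (\<phi> (fst z), \<psi> (snd z)))"
    by (intro continuous_on_Pair continuous_on_compose2[OF chart_continuous[OF c(1)]]
        continuous_on_compose2[OF chart_continuous[OF c(2)]] continuous_intros) auto
  then have cont: "continuous_on UV \<Phi>" unfolding eq by (simp add: map_prod_def case_prod_beta')
  have "continuous_on (\<phi> ` U \<times> \<psi> ` V) (\<lambda>z. (inv_into U \<phi> (fst z), inv_into V \<psi> (snd z)))"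
    by (intro continuous_on_Pair continuous_on_compose2[OF chart_inv_continuous[OF c(1)]]
        continuous_on_compose2[OF chart_inv_continuous[OF c(2)]] continuous_intros) auto
  then have cont': "continuous_on (\<phi> ` U \<times> \<psi> ` V) (inv_into UV \<Phi>)"
    by (rule continuous_on_eq) (rule inv[symmetric])
  have l: "inv_into UV \<Phi> (\<Phi> z) = z" if "z \<in> UV" for z
    using that inv[of "\<Phi> z"] chart_inv[OF c(1)] chart_inv[OF c(2)] by (auto simp: eq)
  have r: "\<Phi> (inv_into UV \<Phi> y) = y" if "y \<in> \<phi> ` U \<times> \<psi> ` V" for y
    using that chart_inv'[OF c(1)] chart_inv'[OF c(2)] by (subst inv[OF that]) (auto simp: eq)
  have "inv_into UV \<Phi> ` (\<phi> ` U \<times> \<psi> ` V) = (\<lambda>z. z) ` UV"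
    unfolding img[symmetric] image_image by (rule image_cong[OF refl l])
  then show "open UV \<and> open (\<Phi> ` UV) \<and> homeomorphism UV (\<Phi> ` UV) \<Phi> (inv_into UV \<Phi>)"
    unfolding homeomorphism_def img
    using l r cont cont' img chart_open[OF c(1)] chart_open[OF c(2)] chart_image_open[OF c(1)] chart_image_open[OF c(2)]
    by (simp add: eq(1) open_Times)
next
  fix UV UV' :: "('a \<times> 'a) set" and \<Phi> \<Psi> :: "'a \<times> 'a \<Rightarrow> 'e \<times> 'e"
  assume "(UV, \<Phi>) \<in> prod_atlas A A" "(UV', \<Psi>) \<in> prod_atlas A A"
  then obtain U \<phi> V \<psi> U' \<phi>' V' \<psi>' where eq: "UV = U \<times> V" "\<Phi> = map_prod \<phi> \<psi>" "UV' = U' \<times> V'" "\<Psi> = map_prod \<phi>' \<psi>'"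
    and c: "(U, \<phi>) \<in> A" "(V, \<psi>) \<in> A" "(U', \<phi>') \<in> A" "(V', \<psi>') \<in> A"
    by (auto simp: prod_atlas_def)
  have img: "\<Phi> ` (UV \<inter> UV') = \<phi> ` (U \<inter> U') \<times> \<psi> ` (V \<inter> V')"
    unfolding eq Times_Int_Times by (rule map_prod_Times)
  note o = open_chart_image[OF c(1) chart_open[OF c(3)]] open_chart_image[OF c(2) chart_open[OF c(4)]]
  have op: "open (\<phi> ` (U \<inter> U') \<times> \<psi> ` (V \<inter> V'))" by (rule open_Times[OF o])
  have "smooth_near z (\<Psi> \<circ> inv_into UV \<Phi>)" if z: "z \<in> \<phi> ` (U \<inter> U') \<times> \<psi> ` (V \<inter> V')" for z
  proof -
    have "smooth_near (fst z) (\<phi>' \<circ> inv_into U \<phi>)" "smooth_near (snd z) (\<psi>' \<circ> inv_into V \<psi>)"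
      using compatible[OF c(1,3)] compatible[OF c(2,4)] o z by (auto simp: smooth_on_iff_near)
    note n = smooth_near_compose[OF smooth_near_bounded_linear[OF bounded_linear_fst] this(1)]
      smooth_near_compose[OF smooth_near_bounded_linear[OF bounded_linear_snd] this(2)]
    have "smooth_near z (\<lambda>z. ((\<phi>' \<circ> inv_into U \<phi>) (fst z), (\<psi>' \<circ> inv_into V \<psi>) (snd z)))"
      by (rule smooth_near_Pair[OF n])
    then show ?thesis
    proof (rule smooth_near_cong)
      show "\<forall>\<^sub>F z in nhds z. ((\<phi>' \<circ> inv_into U \<phi>) (fst z), (\<psi>' \<circ> inv_into V \<psi>) (snd z)) = (\<Psi> \<circ> inv_into UV \<Phi>) z"
      proof (rule eventually_mono[OF eventually_nhds_in_open[OF op z]])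
        fix y assume "y \<in> \<phi> ` (U \<inter> U') \<times> \<psi> ` (V \<inter> V')"
        then have "y \<in> \<phi> ` U \<times> \<psi> ` V" by auto
        from prod_chart_inv[OF c(1,2) this]
        show "((\<phi>' \<circ> inv_into U \<phi>) (fst y), (\<psi>' \<circ> inv_into V \<psi>) (snd y)) = (\<Psi> \<circ> inv_into UV \<Phi>) y"
          by (simp add: eq)
      qed
    qed
  qed
  then show "smooth_on (\<Phi> ` (UV \<inter> UV')) (\<Psi> \<circ> inv_into UV \<Phi>)"
    unfolding img using smooth_on_iff_near[OF op] by blast
next
  have "\<exists>c\<in>prod_atlas A A. z \<in> fst c" for z
  proof -
    obtain U \<phi> V \<psi> where "(U, \<phi>) \<in> A" "(V, \<psi>) \<in> A" "fst z \<in> U" "snd z \<in> V" using ex_chart by metis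
    then show ?thesis
      by (intro bexI[of _ "(U \<times> V, map_prod \<phi> \<psi>)"]) (auto simp: mem_Times_iff intro: prod_atlas_memI)
  qed
  then show "(\<Union>(U, \<phi>) \<in> prod_atlas A A. U) = UNIV" by (auto simp: case_prod_beta')
qed

end

section \<open>Functions of two points: slices, diagonal and derivatives in one variable\<close>

lemma eventually_slice_left:
  assumes "\<forall>\<^sub>F z in nhds (m, n). Q z"
  shows "\<forall>\<^sub>F x in nhds m. Q (x, n)"
  by (rule eventually_compose_filterlim[OF assms tendsto_Pair[OF filterlim_ident tendsto_const]])

lemma eventually_slice_right:
  assumes "\<forall>\<^sub>F z in nhds (m, n). Q z"
  shows "\<forall>\<^sub>F y in nhds n. Q (m, y)"
  by (rule eventually_compose_filterlim[OF assms tendsto_Pair[OF tendsto_const filterlim_ident]])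

text \<open>A single chain rule for every map between the manifold and its square that is used
  below. Slices, the diagonal, the first projection and the swap are all represented in product
  charts by an affine map L.\<close>

lemma chart_pullback:
  fixes A :: "('a::{t2_space,second_countable_topology}, 'e::{real_inner,heine_borel}) chart set"
    and B :: "('b::{t2_space,second_countable_topology}, 'f::{real_inner,heine_borel}) chart set"
  assumes A: "smooth_manifold A" and B: "smooth_manifold B"
    and c: "(U, \<phi>) \<in> A" "m \<in> U" and d: "(V, \<psi>) \<in> B"
    and L: "smooth_near (\<phi> m) L" "(L has_derivative L') (at (\<phi> m))"
    and \<Phi>: "\<forall>\<^sub>F x in nhds m. \<Phi> x \<in> V \<and> \<psi> (\<Phi> x) = L (\<phi> x)"
    and h: "smooth_at B (\<Phi> m) h"
  shows "smooth_at A m (\<lambda>x. h (\<Phi> x))"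
    and "chart_deriv U \<phi> b (\<lambda>x. h (\<Phi> x)) m = chart_deriv V \<psi> (L' b) h (\<Phi> m)"
proof -
  interpret A: smooth_manifold A by (rule A)
  interpret B: smooth_manifold B by (rule B)
  have m: "\<Phi> m \<in> V" "\<psi> (\<Phi> m) = L (\<phi> m)" using eventually_nhds_x_imp_x[OF \<Phi>] by auto
  have ev: "\<forall>\<^sub>F y in nhds (\<phi> m). (h \<circ> inv_into V \<psi>) (L y) = ((\<lambda>x. h (\<Phi> x)) \<circ> inv_into U \<phi>) y"
  proof (rule eventually_mono[OF A.eventually_chart[OF c \<Phi>]])
    fix y assume y: "y \<in> \<phi> ` U \<and> \<Phi> (inv_into U \<phi> y) \<in> V \<and> \<psi> (\<Phi> (inv_into U \<phi> y)) = L (\<phi> (inv_into U \<phi> y))"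
    then have "L y = \<psi> (\<Phi> (inv_into U \<phi> y))" using A.chart_inv'[OF c(1)] by auto
    moreover have "inv_into V \<psi> (\<psi> (\<Phi> (inv_into U \<phi> y))) = \<Phi> (inv_into U \<phi> y)"
      by (rule B.chart_inv[OF d]) (use y in blast)
    ultimately have "inv_into V \<psi> (L y) = \<Phi> (inv_into U \<phi> y)" by (simp only:)
    then show "(h \<circ> inv_into V \<psi>) (L y) = ((\<lambda>x. h (\<Phi> x)) \<circ> inv_into U \<phi>) y" by simp
  qed
  have hn: "smooth_near (L (\<phi> m)) (h \<circ> inv_into V \<psi>)"
    using B.smooth_at_imp_near[OF d m(1) h] m(2) by simp
  show "smooth_at A m (\<lambda>x. h (\<Phi> x))"
    by (rule A.near_imp_smooth_at[OF c smooth_near_cong[OF smooth_near_compose[OF L(1) hn] ev]])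
  have hd: "(h \<circ> inv_into V \<psi> has_derivative (\<lambda>b. chart_deriv V \<psi> b h (\<Phi> m))) (at (L (\<phi> m)))"
    using B.chart_has_derivative[OF d m(1) h] m(2) by simp
  show "chart_deriv U \<phi> b (\<lambda>x. h (\<Phi> x)) m = chart_deriv V \<psi> (L' b) h (\<Phi> m)"
    by (rule A.chart_derivI[OF has_derivative_eventually_cong[OF has_derivative_compose[OF L(2) hd] ev]])
qed

context smooth_manifold
begin

abbreviation smooth2 :: "'a \<times> 'a \<Rightarrow> ('a \<times> 'a \<Rightarrow> real) \<Rightarrow> bool" where
  "smooth2 \<equiv> smooth_at (prod_atlas A A)"

lemma eventually_in_chart: "(U, \<phi>) \<in> A \<Longrightarrow> x \<in> U \<Longrightarrow> \<forall>\<^sub>F y in nhds x. y \<in> U"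
  by (rule eventually_nhds_in_open[OF chart_open])

lemma slice_left_aux:
  assumes c: "(U, \<phi>) \<in> A" "(V, \<psi>) \<in> A" "x \<in> U" "y \<in> V" and h: "smooth2 (x, y) h"
  shows "smooth_at A x (\<lambda>x'. h (x', y))"
    and "chart_deriv U \<phi> b (\<lambda>x'. h (x', y)) x = chart_deriv (U \<times> V) (map_prod \<phi> \<psi>) (b, 0) h (x, y)"
proof -
  have 1: "smooth_near (\<phi> x) (\<lambda>a. (a, \<psi> y))"
    by (intro smooth_near_Pair smooth_near_const smooth_near_bounded_linear bounded_linear_ident)
  have 2: "((\<lambda>a. (a, \<psi> y)) has_derivative (\<lambda>b. (b, 0))) (at (\<phi> x))"
    by (auto intro!: derivative_eq_intros)
  have 3: "\<forall>\<^sub>F x' in nhds x. (x', y) \<in> U \<times> V \<and> map_prod \<phi> \<psi> (x', y) = (\<phi> x', \<psi> y)"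
    using eventually_in_chart[OF c(1,3)] by (rule eventually_mono) (use c(4) in auto)
  note p = chart_pullback[OF smooth_manifold_axioms prod_manifold c(1,3) prod_atlas_memI[OF c(1,2)] 1 2 3 h]
  show "smooth_at A x (\<lambda>x'. h (x', y))" by (rule p(1))
  show "chart_deriv U \<phi> b (\<lambda>x'. h (x', y)) x = chart_deriv (U \<times> V) (map_prod \<phi> \<psi>) (b, 0) h (x, y)"
    by (rule p(2))
qed

lemma slice_right_aux:
  assumes c: "(U, \<phi>) \<in> A" "(V, \<psi>) \<in> A" "x \<in> U" "y \<in> V" and h: "smooth2 (x, y) h"
  shows "smooth_at A y (\<lambda>y'. h (x, y'))"
    and "chart_deriv V \<psi> b (\<lambda>y'. h (x, y')) y = chart_deriv (U \<times> V) (map_prod \<phi> \<psi>) (0, b) h (x, y)"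
proof -
  have 1: "smooth_near (\<psi> y) (\<lambda>a. (\<phi> x, a))"
    by (intro smooth_near_Pair smooth_near_const smooth_near_bounded_linear bounded_linear_ident)
  have 2: "((\<lambda>a. (\<phi> x, a)) has_derivative (\<lambda>b. (0, b))) (at (\<psi> y))"
    by (auto intro!: derivative_eq_intros)
  have 3: "\<forall>\<^sub>F y' in nhds y. (x, y') \<in> U \<times> V \<and> map_prod \<phi> \<psi> (x, y') = (\<phi> x, \<psi> y')"
    using eventually_in_chart[OF c(2,4)] by (rule eventually_mono) (use c(3) in auto)
  note p = chart_pullback[OF smooth_manifold_axioms prod_manifold c(2,4) prod_atlas_memI[OF c(1,2)] 1 2 3 h]
  show "smooth_at A y (\<lambda>y'. h (x, y'))" by (rule p(1))
  show "chart_deriv V \<psi> b (\<lambda>y'. h (x, y')) y = chart_deriv (U \<times> V) (map_prod \<phi> \<psi>) (0, b) h (x, y)"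
    by (rule p(2))
qed

lemma diag_aux:
  assumes c: "(U, \<phi>) \<in> A" "x \<in> U" and h: "smooth2 (x, x) h"
  shows "smooth_at A x (\<lambda>x'. h (x', x'))"
    and "chart_deriv U \<phi> b (\<lambda>x'. h (x', x')) x = chart_deriv (U \<times> U) (map_prod \<phi> \<phi>) (b, b) h (x, x)"
proof -
  have 1: "smooth_near (\<phi> x) (\<lambda>a. (a, a))"
    by (intro smooth_near_Pair smooth_near_bounded_linear bounded_linear_ident)
  have 2: "((\<lambda>a. (a, a)) has_derivative (\<lambda>b. (b, b))) (at (\<phi> x))"
    by (auto intro!: derivative_eq_intros)
  have 3: "\<forall>\<^sub>F x' in nhds x. (x', x') \<in> U \<times> U \<and> map_prod \<phi> \<phi> (x', x') = (\<phi> x', \<phi> x')"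
    using eventually_in_chart[OF c] by (rule eventually_mono) auto
  note p = chart_pullback[OF smooth_manifold_axioms prod_manifold c prod_atlas_memI[OF c(1,1)] 1 2 3 h]
  show "smooth_at A x (\<lambda>x'. h (x', x'))" by (rule p(1))
  show "chart_deriv U \<phi> b (\<lambda>x'. h (x', x')) x = chart_deriv (U \<times> U) (map_prod \<phi> \<phi>) (b, b) h (x, x)"
    by (rule p(2))
qed

lemma smooth2_charts:
  obtains U \<phi> V \<psi> where "(U, \<phi>) \<in> A" "(V, \<psi>) \<in> A" "fst z \<in> U" "snd z \<in> V"
    "\<forall>\<^sub>F y in nhds z. fst y \<in> U \<and> snd y \<in> V"
proof -
  obtain U \<phi> V \<psi> where c: "(U, \<phi>) \<in> A" "(V, \<psi>) \<in> A" "fst z \<in> U" "snd z \<in> V" using ex_chart by metis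
  have "\<forall>\<^sub>F y in nhds z. y \<in> U \<times> V"
    by (rule eventually_nhds_in_open[OF open_Times[OF chart_open[OF c(1)] chart_open[OF c(2)]]])
      (use c in \<open>simp add: mem_Times_iff\<close>)
  then have "\<forall>\<^sub>F y in nhds z. fst y \<in> U \<and> snd y \<in> V"
    by (rule eventually_mono) (simp add: mem_Times_iff)
  with c show thesis by (rule that)
qed

lemma smooth2_fst:
  assumes "smooth_at A (fst z) f"
  shows "smooth2 z (\<lambda>z. f (fst z))"
proof -
  obtain U \<phi> V \<psi> where c: "(U, \<phi>) \<in> A" "(V, \<psi>) \<in> A" "fst z \<in> U" "snd z \<in> V"
    and ev: "\<forall>\<^sub>F y in nhds z. fst y \<in> U \<and> snd y \<in> V" by (rule smooth2_charts)
  show ?thesis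
  proof (rule chart_pullback(1)[OF prod_manifold smooth_manifold_axioms prod_atlas_memI[OF c(1,2)] _ c(1), where L = fst and L' = fst])
    show "\<forall>\<^sub>F x in nhds z. fst x \<in> U \<and> \<phi> (fst x) = fst (map_prod \<phi> \<psi> x)"
      by (rule eventually_mono[OF ev]) (simp add: map_prod_def case_prod_beta')
  qed (use c assms in \<open>auto simp: mem_Times_iff intro: smooth_near_bounded_linear bounded_linear_fst
      bounded_linear_imp_has_derivative\<close>)
qed

lemma smooth2_swap:
  assumes "smooth2 (snd z, fst z) h"
  shows "smooth2 z (\<lambda>z. h (snd z, fst z))"
proof -
  obtain U \<phi> V \<psi> where c: "(U, \<phi>) \<in> A" "(V, \<psi>) \<in> A" "fst z \<in> U" "snd z \<in> V"
    and ev: "\<forall>\<^sub>F y in nhds z. fst y \<in> U \<and> snd y \<in> V" by (rule smooth2_charts)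
  have bl: "bounded_linear (\<lambda>a::'e \<times> 'e. (snd a, fst a))"
    by (intro bounded_linear_Pair bounded_linear_fst bounded_linear_snd)
  show ?thesis
  proof (rule chart_pullback(1)[OF prod_manifold prod_manifold prod_atlas_memI[OF c(1,2)] _ prod_atlas_memI[OF c(2,1)]
        smooth_near_bounded_linear[OF bl] bounded_linear_imp_has_derivative[OF bl]])
    show "\<forall>\<^sub>F x in nhds z. (snd x, fst x) \<in> V \<times> U \<and>
        map_prod \<psi> \<phi> (snd x, fst x) = (snd (map_prod \<phi> \<psi> x), fst (map_prod \<phi> \<psi> x))"
      by (rule eventually_mono[OF ev]) (simp add: map_prod_def case_prod_beta')
  qed (use c assms in \<open>auto simp: mem_Times_iff\<close>)
qed

lemma smooth2_snd:
  assumes "smooth_at A (snd z) f"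
  shows "smooth2 z (\<lambda>z. f (snd z))"
  using smooth2_swap[of z "\<lambda>z. f (fst z)"] smooth2_fst[of "(snd z, fst z)" f] assms by simp

lemma smooth_slice_left: "smooth2 (x, y) h \<Longrightarrow> smooth_at A x (\<lambda>x'. h (x', y))"
  using slice_left_aux(1) ex_chart by metis

lemma smooth_slice_right: "smooth2 (x, y) h \<Longrightarrow> smooth_at A y (\<lambda>y'. h (x, y'))"
  using slice_right_aux(1) ex_chart by metis

lemma smooth_diag: "smooth2 (x, x) h \<Longrightarrow> smooth_at A x (\<lambda>x'. h (x', x'))"
  using diag_aux(1) ex_chart by metis

lemmas smooth2_cong = smooth_manifold.smooth_at_cong[OF prod_manifold]
lemmas smooth2_const = smooth_manifold.smooth_at_const[OF prod_manifold]
lemmas smooth2_add = smooth_manifold.smooth_at_add[OF prod_manifold]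
lemmas smooth2_diff = smooth_manifold.smooth_at_diff[OF prod_manifold]
lemmas smooth2_mult = smooth_manifold.smooth_at_mult[OF prod_manifold]
lemmas smooth2_sum = smooth_manifold.smooth_at_sum[OF prod_manifold]
lemmas smooth2_chart_deriv = smooth_manifold.smooth_at_chart_deriv[OF prod_manifold]

text \<open>Differentiation of the left variable along X must be smooth jointly in both points. In a
  product chart it is a finite sum of coefficients of X times partial derivatives of h in the
  directions (b, 0), and these are jointly smooth.\<close>

lemma smooth2_field_left:
  assumes X: "X \<in> vector_fields A" and h: "smooth2 z h"
  shows "smooth2 z (\<lambda>z. X (fst z) (\<lambda>x. h (x, snd z)))"
proof -
  obtain U \<phi> V \<psi> where c: "(U, \<phi>) \<in> A" "(V, \<psi>) \<in> A" "fst z \<in> U" "snd z \<in> V"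
    and ev: "\<forall>\<^sub>F y in nhds z. fst y \<in> U \<and> snd y \<in> V" by (rule smooth2_charts)
  have "smooth2 z (\<lambda>z. \<Sum>b\<in>onb. X (fst z) (coord \<phi> b) * chart_deriv (U \<times> V) (map_prod \<phi> \<psi>) (b, 0) h z)"
    by (intro smooth2_sum smooth2_mult smooth2_fst[where f = "\<lambda>x. X x (coord \<phi> b)" for b]
        field_smooth_at[OF X] smooth_at_coord[OF c(1,3)] smooth2_chart_deriv[OF prod_atlas_memI[OF c(1,2)] _ h])
      (use c in \<open>simp add: mem_Times_iff\<close>)
  then show ?thesis
  proof (rule smooth2_cong)
    show "\<forall>\<^sub>F y in nhds z. (\<Sum>b\<in>onb. X (fst y) (coord \<phi> b) * chart_deriv (U \<times> V) (map_prod \<phi> \<psi>) (b, 0) h y)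
        = X (fst y) (\<lambda>x. h (x, snd y))"
    proof (rule eventually_mono[OF eventually_conj[OF ev eventually_smooth_at[OF h]]])
      fix y assume y: "(fst y \<in> U \<and> snd y \<in> V) \<and> smooth2 y h"
      then have h': "smooth2 (fst y, snd y) h" by simp
      note s = slice_left_aux[OF c(1,2) _ _ h']
      show "(\<Sum>b\<in>onb. X (fst y) (coord \<phi> b) * chart_deriv (U \<times> V) (map_prod \<phi> \<psi>) (b, 0) h y)
          = X (fst y) (\<lambda>x. h (x, snd y))"
        using tangent_expansion[OF c(1) _ field_tangent[OF X] s(1)] s(2) y by simp
    qed
  qed
qed

lemma smooth2_field_right:
  assumes Y: "Y \<in> vector_fields A" and h: "smooth2 z h"
  shows "smooth2 z (\<lambda>z. Y (snd z) (\<lambda>y. h (fst z, y)))"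
proof -
  have "smooth2 (snd z, fst z) (\<lambda>z. h (snd z, fst z))"
    by (rule smooth2_swap) (use h in simp)
  from smooth2_field_left[OF Y this]
  have "smooth2 (snd z, fst z) (\<lambda>z. Y (fst z) (\<lambda>x. h (snd z, x)))" by simp
  from smooth2_swap[OF this] show ?thesis by simp
qed

text \<open>Extend w to a field, use joint smoothness, and then freeze the right point at n.\<close>

lemma smooth_tangent_right:
  assumes w: "w \<in> tangent_space A n" and h: "smooth2 (m, n) h"
  shows "smooth_at A m (\<lambda>x. w (\<lambda>y. h (x, y)))"
  using smooth_slice_left[OF smooth2_field_right[OF field_through(1)[OF w] h]] by (simp add: field_through(2)[OF w])

lemma smooth_tangent_left:
  assumes v: "v \<in> tangent_space A m" and h: "smooth2 (m, n) h"
  shows "smooth_at A n (\<lambda>y. v (\<lambda>x. h (x, y)))"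
  using smooth_slice_right[OF smooth2_field_left[OF field_through(1)[OF v] h]] by (simp add: field_through(2)[OF v])

text \<open>Expanding v and w in coordinates reduces the claim to the symmetry of second partial
  derivatives on the product chart, in the directions (b, 0) and (0, a).\<close>

lemma tangent_commute:
  assumes v: "v \<in> tangent_space A m" and w: "w \<in> tangent_space A n" and h: "smooth2 (m, n) h"
  shows "v (\<lambda>x. w (\<lambda>y. h (x, y))) = w (\<lambda>y. v (\<lambda>x. h (x, y)))"
proof -
  obtain U \<phi> V \<psi> where c': "(U, \<phi>) \<in> A" "(V, \<psi>) \<in> A" "fst (m, n) \<in> U" "snd (m, n) \<in> V"
    and ev: "\<forall>\<^sub>F y in nhds (m, n). fst y \<in> U \<and> snd y \<in> V" by (rule smooth2_charts)
  note c = c'[unfolded fst_conv snd_conv]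
  define D where "D = chart_deriv (U \<times> V) (map_prod \<phi> \<psi>)"
  have p: "(U \<times> V, map_prod \<phi> \<psi>) \<in> prod_atlas A A" "(m, n) \<in> U \<times> V"
    using prod_atlas_memI[OF c(1,2)] c(3,4) by auto
  have D: "smooth2 (m, n) (D b h)" for b unfolding D_def by (rule smooth2_chart_deriv[OF p h])
  note DL = smooth_slice_left[OF D] and DR = smooth_slice_right[OF D]
  note ev2 = eventually_conj[OF ev eventually_smooth_at[OF h]]
  have "v (\<lambda>x. w (\<lambda>y. h (x, y))) = v (\<lambda>x. \<Sum>a\<in>onb. w (coord \<psi> a) * D (0, a) h (x, n))"
  proof (rule tangent_cong[OF v smooth_tangent_right[OF w h]])
    show "smooth_at A m (\<lambda>x. \<Sum>a\<in>onb. w (coord \<psi> a) * D (0, a) h (x, n))"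
      by (intro smooth_at_sum smooth_at_mult smooth_at_const DL)
    show "\<forall>\<^sub>F x in nhds m. w (\<lambda>y. h (x, y)) = (\<Sum>a\<in>onb. w (coord \<psi> a) * D (0, a) h (x, n))"
    proof (rule eventually_mono[OF eventually_slice_left[OF ev2]])
      fix x assume x: "(fst (x, n) \<in> U \<and> snd (x, n) \<in> V) \<and> smooth2 (x, n) h"
      note s = slice_right_aux[OF c(1,2) _ c(4), of x h]
      show "w (\<lambda>y. h (x, y)) = (\<Sum>a\<in>onb. w (coord \<psi> a) * D (0, a) h (x, n))"
        using tangent_expansion[OF c(2,4) w s(1)] s(2) x by (simp add: D_def)
    qed
  qed
  also have "\<dots> = (\<Sum>a\<in>onb. w (coord \<psi> a) * v (\<lambda>x. D (0, a) h (x, n)))"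
    by (subst tangent_sum[OF v]) (auto intro!: smooth_at_mult smooth_at_const DL sum.cong tangent_scale[OF v])
  also have "\<dots> = (\<Sum>a\<in>onb. \<Sum>b\<in>onb. w (coord \<psi> a) * (v (coord \<phi> b) * D (b, 0) (D (0, a) h) (m, n)))"
    using tangent_expansion[OF c(1,3) v smooth_slice_left[OF D]] slice_left_aux(2)[OF c D]
    by (simp add: D_def sum_distrib_left)
  also have "\<dots> = (\<Sum>b\<in>onb. \<Sum>a\<in>onb. v (coord \<phi> b) * (w (coord \<psi> a) * D (0, a) (D (b, 0) h) (m, n)))"
    using smooth_manifold.chart_deriv_commute[OF prod_manifold p h]
    by (subst sum.swap) (simp add: D_def mult.left_commute)
  also have "\<dots> = (\<Sum>b\<in>onb. v (coord \<phi> b) * w (\<lambda>y. D (b, 0) h (m, y)))"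
    using tangent_expansion[OF c(2,4) w smooth_slice_right[OF D]] slice_right_aux(2)[OF c D]
    by (simp add: D_def sum_distrib_left)
  also have "\<dots> = w (\<lambda>y. \<Sum>b\<in>onb. v (coord \<phi> b) * D (b, 0) h (m, y))"
    by (subst tangent_sum[OF w]) (auto intro!: smooth_at_mult smooth_at_const DR sum.cong tangent_scale[OF w, symmetric])
  also have "\<dots> = w (\<lambda>y. v (\<lambda>x. h (x, y)))"
  proof (rule tangent_cong[OF w _ smooth_tangent_left[OF v h]])
    show "smooth_at A n (\<lambda>y. \<Sum>b\<in>onb. v (coord \<phi> b) * D (b, 0) h (m, y))"
      by (intro smooth_at_sum smooth_at_mult smooth_at_const DR)
    show "\<forall>\<^sub>F y in nhds n. (\<Sum>b\<in>onb. v (coord \<phi> b) * D (b, 0) h (m, y)) = v (\<lambda>x. h (x, y))"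
    proof (rule eventually_mono[OF eventually_slice_right[OF ev2]])
      fix y assume y: "(fst (m, y) \<in> U \<and> snd (m, y) \<in> V) \<and> smooth2 (m, y) h"
      note s = slice_left_aux[OF c(1,2,3), of y h]
      show "(\<Sum>b\<in>onb. v (coord \<phi> b) * D (b, 0) h (m, y)) = v (\<lambda>x. h (x, y))"
        using tangent_expansion[OF c(1,3) v s(1)] s(2) y by (simp add: D_def)
    qed
  qed
  finally show ?thesis .
qed

text \<open>By linearity of the derivative, the diagonal direction (b, b) splits into (b, 0) and (0,
  b). This splitting is what relates a metric restricted from the product to a pair of conjugate
  connections.\<close>

lemma tangent_diag:
  assumes v: "v \<in> tangent_space A m" and h: "smooth2 (m, m) h"
  shows "v (\<lambda>x. h (x, x)) = v (\<lambda>x. h (x, m)) + v (\<lambda>y. h (m, y))"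
proof -
  obtain U \<phi> where c: "(U, \<phi>) \<in> A" "m \<in> U" using ex_chart by blast
  have p: "(U \<times> U, map_prod \<phi> \<phi>) \<in> prod_atlas A A" "(m, m) \<in> U \<times> U"
    using prod_atlas_memI[OF c(1,1)] c(2) by auto
  define D where "D = (\<lambda>b. chart_deriv (U \<times> U) (map_prod \<phi> \<phi>) b h (m, m))"
  have "linear D"
    unfolding D_def by (rule has_derivative_linear[OF smooth_manifold.chart_has_derivative[OF prod_manifold p h]])
  then have "D (b, b) = D (b, 0) + D (0, b)" for b
    using linear_add[of D "(b, 0)" "(0, b)"] by simp
  then have "(\<Sum>b\<in>onb. v (coord \<phi> b) * D (b, b)) = (\<Sum>b\<in>onb. v (coord \<phi> b) * D (b, 0)) + (\<Sum>b\<in>onb. v (coord \<phi> b) * D (0, b))"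
    by (simp add: distrib_left sum.distrib)
  then show ?thesis
    using tangent_expansion[OF c v diag_aux(1)[OF c h]] tangent_expansion[OF c v slice_left_aux(1)[OF c(1,1,2,2) h]]
      tangent_expansion[OF c v slice_right_aux(1)[OF c(1,1,2,2) h]]
      diag_aux(2)[OF c h] slice_left_aux(2)[OF c(1,1,2,2) h] slice_right_aux(2)[OF c(1,1,2,2) h]
    by (simp add: D_def)
qed

lemma lie_deriv_left_lift:
  assumes "smooth2 (m, n) h"
  shows "lie_deriv (left_lift A X) h (m, n) = X m (\<lambda>x. h (x, n))"
  using assms by (simp add: lie_deriv_def left_lift_def tangent_pair_def)

end

section \<open>Contrast bi-forms and their connections\<close>

context smooth_manifold
begin

lemma smooth_at_eventually_nonzero:
  assumes "smooth_at A m f" "f m \<noteq> 0"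
  shows "\<forall>\<^sub>F x in nhds m. f x \<noteq> 0"
proof -
  obtain U \<phi> where c: "(U, \<phi>) \<in> A" "m \<in> U" using ex_chart by blast
  have "isCont (f \<circ> inv_into U \<phi>) (\<phi> m)"
    by (rule smooth_near_isCont[OF smooth_at_imp_near[OF c assms(1)]])
  moreover have "isCont \<phi> m"
    using chart_continuous[OF c(1)] chart_open[OF c(1)] c(2) by (simp add: continuous_on_eq_continuous_at)
  ultimately have "isCont (\<lambda>x. (f \<circ> inv_into U \<phi>) (\<phi> x)) m" by (rule isCont_o2[rotated])
  then have "((\<lambda>x. (f \<circ> inv_into U \<phi>) (\<phi> x)) \<longlongrightarrow> (f \<circ> inv_into U \<phi>) (\<phi> m)) (nhds m)"
    unfolding isCont_def by (subst (asm) tendsto_at_iff_tendsto_nhds)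
  then have "((\<lambda>x. (f \<circ> inv_into U \<phi>) (\<phi> x)) \<longlongrightarrow> f m) (nhds m)"
    by (simp add: chart_inv[OF c])
  from tendsto_imp_eventually_ne[OF this assms(2)]
  have "\<forall>\<^sub>F x in nhds m. (f \<circ> inv_into U \<phi>) (\<phi> x) \<noteq> 0" .
  with eventually_in_chart[OF c] show ?thesis
    by eventually_elim (simp add: chart_inv[OF c(1)])
qed

text \<open>Gaussian elimination in the ring of germs of smooth functions.\<close>

lemma smooth_linear_system:
  assumes "finite J" "finite I" "card I = card J"
    and "\<And>i j. i \<in> I \<Longrightarrow> j \<in> J \<Longrightarrow> smooth_at A m (G i j)"
    and "\<And>c. (\<And>i. i \<in> I \<Longrightarrow> (\<Sum>j\<in>J. G i j m * c j) = 0) \<Longrightarrow> (\<And>j. j \<in> J \<Longrightarrow> c j = 0)"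
    and "\<And>i. i \<in> I \<Longrightarrow> smooth_at A m (a i)"
  shows "\<exists>c. (\<forall>j\<in>J. smooth_at A m (c j)) \<and> (\<forall>i\<in>I. \<forall>\<^sub>F x in nhds m. (\<Sum>j\<in>J. G i j x * c j x) = a i x)"
  using assms
proof (induction J arbitrary: I G a rule: finite_induct)
  case empty
  then show ?case by simp
next
  case (insert j J)
  \<comment> \<open>The pivot: were column j zero at m, its indicator vector would be a nontrivial
    kernel vector there. Invertibility is known at m only, but a nonzero pivot is an invertible
    germ.\<close>
  have "\<exists>i\<in>I. G i j m \<noteq> 0"
  proof (rule ccontr)
    assume "\<not> ?thesis"
    then have "(\<Sum>k\<in>insert j J. G i k m * (if k = j then 1 else 0)) = 0" if "i \<in> I" for i
      using that by (intro sum.neutral) auto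
    from insert.prems(4)[OF this, of j] show False by simp
  qed
  then obtain i where i: "i \<in> I" "G i j m \<noteq> 0" by blast
  define I' where "I' = I - {i}"
  define r where "r = (\<lambda>x. inverse (G i j x))"
  define G' where "G' = (\<lambda>k l x. G k l x - G k j x * (G i l x * r x))"
  define a' where "a' = (\<lambda>k x. a k x - G k j x * (a i x * r x))"
  have I': "finite I'" "card I' = card J" "I' \<subseteq> I"
    using insert.prems(1,2) insert.hyps i(1) by (auto simp: I'_def)
  have Gs: "smooth_at A m (G k l)" if "k \<in> I" "l \<in> insert j J" for k l using insert.prems(3) that by blast
  have r: "smooth_at A m r" "G i j m * r m = 1"
    using smooth_at_inverse[OF Gs[OF i(1)] i(2)] i(2) by (auto simp: r_def)
  have "\<exists>c. (\<forall>l\<in>J. smooth_at A m (c l)) \<and> (\<forall>k\<in>I'. \<forall>\<^sub>F x in nhds m. (\<Sum>l\<in>J. G' k l x * c l x) = a' k x)"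
  proof (rule insert.IH[OF I'(1,2)])
    show "smooth_at A m (G' k l)" if "k \<in> I'" "l \<in> J" for k l
      unfolding G'_def using that I'(3) i(1)
      by (intro smooth_at_diff smooth_at_mult r Gs) auto
    show "smooth_at A m (a' k)" if "k \<in> I'" for k
      unfolding a'_def using that I'(3) i(1)
      by (intro smooth_at_diff smooth_at_mult r Gs insert.prems(5)) auto
    fix c l assume c: "\<And>k. k \<in> I' \<Longrightarrow> (\<Sum>l\<in>J. G' k l m * c l) = 0" and l: "l \<in> J"
    \<comment> \<open>Back substitution extends a kernel vector of the reduced system to one of the
      full system, so injectivity at m is inherited by the induction hypothesis.\<close>
    define d where "d = c(j := - r m * (\<Sum>l\<in>J. G i l m * c l))"
    have sumd: "(\<Sum>l\<in>insert j J. G k l m * d l) = G k j m * d j + (\<Sum>l\<in>J. G k l m * c l)" for k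
      using insert.hyps by (auto simp: d_def intro!: sum.cong)
    have "d l = 0"
    proof (rule insert.prems(4))
      fix k assume k: "k \<in> I"
      show "(\<Sum>l\<in>insert j J. G k l m * d l) = 0"
      proof (cases "k = i")
        case True
        have "G i j m * d j = - (G i j m * r m) * (\<Sum>l\<in>J. G i l m * c l)" by (simp add: d_def)
        then show ?thesis using r(2) unfolding sumd True by simp
      next
        case False
        then have "k \<in> I'" using k by (simp add: I'_def)
        from c[OF this] have "(\<Sum>l\<in>J. G k l m * c l) - G k j m * (r m * (\<Sum>l\<in>J. G i l m * c l)) = 0"
          by (simp add: G'_def algebra_simps sum_subtractf sum_distrib_left)
        then show ?thesis unfolding sumd by (simp add: d_def)
      qed
    qed (use l in simp)
    then show "c l = 0" using l insert.hyps by (auto simp: d_def split: if_splits)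
  qed
  then obtain c where c: "\<And>l. l \<in> J \<Longrightarrow> smooth_at A m (c l)"
    "\<And>k. k \<in> I' \<Longrightarrow> \<forall>\<^sub>F x in nhds m. (\<Sum>l\<in>J. G' k l x * c l x) = a' k x" by blast
  define d where "d = c(j := (\<lambda>x. r x * (a i x - (\<Sum>l\<in>J. G i l x * c l x))))"
  have sumd: "(\<Sum>l\<in>insert j J. G k l x * d l x) = G k j x * d j x + (\<Sum>l\<in>J. G k l x * c l x)" for k x
    using insert.hyps by (auto simp: d_def intro!: sum.cong)
  have nz: "\<forall>\<^sub>F x in nhds m. G i j x \<noteq> 0" using smooth_at_eventually_nonzero[OF Gs[OF i(1)] i(2)] by simp
  show ?case
  proof (intro exI[of _ d] conjI ballI)
    have "smooth_at A m (d j)"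
      unfolding d_def fun_upd_same
      by (intro smooth_at_mult smooth_at_diff smooth_at_sum r Gs[OF i(1)] c insert.prems(5)[OF i(1)]) auto
    then show "smooth_at A m (d l)" if "l \<in> insert j J" for l
      using that c by (auto simp: d_def)
    fix k assume k: "k \<in> I"
    show "\<forall>\<^sub>F x in nhds m. (\<Sum>l\<in>insert j J. G k l x * d l x) = a k x"
    proof (cases "k = i")
      case True
      from nz show ?thesis
        unfolding sumd by eventually_elim (simp add: True d_def r_def mult.assoc[symmetric])
    next
      case False
      then have "k \<in> I'" using k by (simp add: I'_def)
      from c(2)[OF this] show ?thesis
        unfolding sumd
      proof eventually_elim
        case (elim x)
        have "(\<Sum>l\<in>J. G' k l x * c l x) = (\<Sum>l\<in>J. G k l x * c l x) - G k j x * r x * (\<Sum>l\<in>J. G i l x * c l x)"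
          by (simp add: G'_def algebra_simps sum_subtractf sum_distrib_left)
        with elim show ?case by (simp add: a'_def d_def algebra_simps)
      qed
    qed
  qed
qed

end

lemma functional_sum:
  assumes lin: "\<And>u v a b. u \<in> tangent_space A m \<Longrightarrow> v \<in> tangent_space A m \<Longrightarrow>
      \<alpha> (lincomb a u b v) = a * \<alpha> u + b * \<alpha> v"
    and "finite I" "\<And>i. i \<in> I \<Longrightarrow> v i \<in> tangent_space A m"
  shows "\<alpha> (\<lambda>f. \<Sum>i\<in>I. c i * v i f) = (\<Sum>i\<in>I. c i * \<alpha> (v i))"
  using assms(2,3)
proof (induction I rule: finite_induct)
  case empty
  show ?case using lin[OF zero_tangent zero_tangent, of 0 0] by (simp add: lincomb_def)
next
  case (insert i I)
  have "\<alpha> (lincomb (c i) (v i) 1 (\<lambda>f. \<Sum>i\<in>I. c i * v i f)) = c i * \<alpha> (v i) + 1 * \<alpha> (\<lambda>f. \<Sum>i\<in>I. c i * v i f)"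
    by (rule lin) (use insert in \<open>auto intro: sum_tangent\<close>)
  then show ?case using insert by (simp add: lincomb_def)
qed

locale contrast = smooth_manifold A
  for A :: "('a::{t2_space,second_countable_topology}, 'e::{real_inner,heine_borel}) chart set" +
  fixes W :: "('a \<times> 'a) set" and \<omega> :: "'a biform"
  assumes contrast: "contrast_biform A W \<omega>"
begin

abbreviation \<beta> :: "'a \<times> 'a \<Rightarrow> 'a tangent \<Rightarrow> 'a tangent \<Rightarrow> real" where
  "\<beta> z v w \<equiv> \<omega> z [v] [w]"

section \<open>Linearity, smoothness and nondegeneracy of the contrast bi-form\<close>

lemma diag_mem: "(m, m) \<in> W" and open_W: "open W" and biform: "\<omega> \<in> biforms A W 1 1"
  and metric: "pseudo_riemannian A (induced_metric \<omega>)"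
  using contrast by (auto simp: contrast_biform_def biforms_def)

lemma \<beta>_lin_left:
  assumes "(m, n) \<in> W" "u \<in> tangent_space A m" "v \<in> tangent_space A m" "w \<in> tangent_space A n"
  shows "\<beta> (m, n) (lincomb a u b v) w = a * \<beta> (m, n) u w + b * \<beta> (m, n) v w"
proof -
  have "[w] \<in> args 1 (tangent_space A n)" "[u] \<in> args 1 (tangent_space A m)"
    using assms by (auto simp: args_def)
  moreover have "multilinear 1 (tangent_space A m) (\<lambda>vs. \<omega> (m, n) vs [w])"
    using biform assms(1) calculation(1) by (auto simp: biforms_def)
  ultimately have "\<forall>u'\<in>tangent_space A m. \<forall>w'\<in>tangent_space A m. \<forall>a b.
      \<omega> (m, n) ([u][0 := lincomb a u' b w']) [w] = a * \<omega> (m, n) ([u][0 := u']) [w] + b * \<omega> (m, n) ([u][0 := w']) [w]"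
    unfolding multilinear_def using less_one by blast
  then show ?thesis using assms(2,3) by simp
qed

lemma \<beta>_lin_right:
  assumes "(m, n) \<in> W" "u \<in> tangent_space A n" "v \<in> tangent_space A n" "w \<in> tangent_space A m"
  shows "\<beta> (m, n) w (lincomb a u b v) = a * \<beta> (m, n) w u + b * \<beta> (m, n) w v"
proof -
  have "[w] \<in> args 1 (tangent_space A m)" "[u] \<in> args 1 (tangent_space A n)"
    using assms by (auto simp: args_def)
  moreover have "multilinear 1 (tangent_space A n) (\<lambda>ws. \<omega> (m, n) [w] ws)"
    using biform assms(1) calculation(1) by (auto simp: biforms_def)
  ultimately have "\<forall>u'\<in>tangent_space A n. \<forall>w'\<in>tangent_space A n. \<forall>a b.
      \<omega> (m, n) [w] ([u][0 := lincomb a u' b w']) = a * \<omega> (m, n) [w] ([u][0 := u']) + b * \<omega> (m, n) [w] ([u][0 := w'])"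
    unfolding multilinear_def using less_one by blast
  then show ?thesis using assms(2,3) by simp
qed

lemma \<beta>_sum_left:
  assumes "(m, n) \<in> W" "w \<in> tangent_space A n" "finite I" "\<And>i. i \<in> I \<Longrightarrow> v i \<in> tangent_space A m"
  shows "\<beta> (m, n) (\<lambda>f. \<Sum>i\<in>I. c i * v i f) w = (\<Sum>i\<in>I. c i * \<beta> (m, n) (v i) w)"
  by (rule functional_sum[where \<alpha> = "\<lambda>v. \<beta> (m, n) v w", OF _ assms(3,4)])
    (use \<beta>_lin_left assms(1,2) in blast)+

lemma \<beta>_sum_right:
  assumes "(m, n) \<in> W" "w \<in> tangent_space A m" "finite I" "\<And>i. i \<in> I \<Longrightarrow> v i \<in> tangent_space A n"
  shows "\<beta> (m, n) w (\<lambda>f. \<Sum>i\<in>I. c i * v i f) = (\<Sum>i\<in>I. c i * \<beta> (m, n) w (v i))"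
  by (rule functional_sum[where \<alpha> = "\<lambda>v. \<beta> (m, n) w v", OF _ assms(3,4)])
    (use \<beta>_lin_right assms(1,2) in blast)+

lemma smooth_\<beta>:
  assumes "X \<in> vector_fields A" "Y \<in> vector_fields A" "z \<in> W"
  shows "smooth2 z (\<lambda>z. \<beta> z (X (fst z)) (Y (snd z)))"
proof -
  have "smooth_fun (prod_atlas A A) W (biform_eval \<omega> [X] [Y])"
    using biform assms by (simp add: biforms_def)
  from smooth_fun_imp_smooth_at[OF this assms(3)] show ?thesis
    by (simp add: biform_eval_def case_prod_beta')
qed

lemma \<beta>_sym: "u \<in> tangent_space A m \<Longrightarrow> v \<in> tangent_space A m \<Longrightarrow> \<beta> (m, m) u v = \<beta> (m, m) v u"
  using metric by (auto simp: pseudo_riemannian_def diag_pullback_def)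

lemma \<beta>_nondegenerate:
  assumes "u \<in> tangent_space A m" "\<And>v. v \<in> tangent_space A m \<Longrightarrow> \<beta> (m, m) u v = 0"
  shows "u = (\<lambda>_. 0)"
  using metric assms by (auto simp: pseudo_riemannian_def diag_pullback_def)

lemma \<beta>_eqI:
  assumes "u \<in> tangent_space A m" "v \<in> tangent_space A m"
    and "\<And>w. w \<in> tangent_space A m \<Longrightarrow> \<beta> (m, m) u w = \<beta> (m, m) v w"
  shows "u = v"
proof -
  have "lincomb 1 u (-1) v = (\<lambda>_. 0)"
    by (rule \<beta>_nondegenerate) (auto intro: lincomb_tangent assms simp: \<beta>_lin_left[OF diag_mem] assms)
  then show ?thesis by (simp add: lincomb_def fun_eq_iff)
qed

lemma eventually_W_left: "(m, n) \<in> W \<Longrightarrow> \<forall>\<^sub>F x in nhds m. (x, n) \<in> W"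
  by (rule eventually_slice_left[OF eventually_nhds_in_open[OF open_W]])

lemma eventually_W_right: "(m, n) \<in> W \<Longrightarrow> \<forall>\<^sub>F y in nhds n. (m, y) \<in> W"
  by (rule eventually_slice_right[OF eventually_nhds_in_open[OF open_W]])

lemma smooth_\<beta>_left:
  assumes "X \<in> vector_fields A" "w \<in> tangent_space A n" "(m, n) \<in> W"
  shows "smooth_at A m (\<lambda>x. \<beta> (x, n) (X x) w)"
  using smooth_slice_left[OF smooth_\<beta>[OF assms(1) field_through(1)[OF assms(2)] assms(3)]]
  by (simp add: field_through(2)[OF assms(2)])

lemma smooth_\<beta>_right:
  assumes "Y \<in> vector_fields A" "v \<in> tangent_space A m" "(m, n) \<in> W"
  shows "smooth_at A n (\<lambda>y. \<beta> (m, y) v (Y y))"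
  using smooth_slice_right[OF smooth_\<beta>[OF field_through(1)[OF assms(2)] assms(1,3)]]
  by (simp add: field_through(2)[OF assms(2)])

text \<open>Raising an index with the metric. In a local frame the equation is a linear system whose
  matrix is injective by nondegeneracy, so it has smooth local solutions. The pointwise solution is
  unique, hence coincides with each local one; the local solutions therefore fit together without
  any gluing.\<close>

lemma ex_sharp:
  assumes lin: "\<And>m u v a b. u \<in> tangent_space A m \<Longrightarrow> v \<in> tangent_space A m \<Longrightarrow>
      \<alpha> m (lincomb a u b v) = a * \<alpha> m u + b * \<alpha> m v"
    and sm: "\<And>m Y. Y \<in> vector_fields A \<Longrightarrow> smooth_at A m (\<lambda>m. \<alpha> m (Y m))"
  shows "\<exists>V. V \<in> vector_fields A \<and> (\<forall>m. \<forall>w\<in>tangent_space A m. \<beta> (m, m) (V m) w = \<alpha> m w)"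
proof -
  have local: "\<exists>V. (\<forall>f. smooth_at A m f \<longrightarrow> smooth_at A m (\<lambda>x. V x f)) \<and>
      (\<forall>\<^sub>F x in nhds m. V x \<in> tangent_space A x \<and> (\<forall>w\<in>tangent_space A x. \<beta> (x, x) (V x) w = \<alpha> x w))" for m
  proof -
    obtain P K and E :: "'e \<Rightarrow> 'a field" and u where F: "open P" "m \<in> P" "\<And>b. E b \<in> vector_fields A"
      "\<And>x b c. x \<in> P \<Longrightarrow> b \<in> onb \<Longrightarrow> c \<in> onb \<Longrightarrow> E b x (u c) = (if b = c then 1 else 0)"
      "\<And>x v f. x \<in> P \<Longrightarrow> v \<in> tangent_space A x \<Longrightarrow> v f = (\<Sum>b\<in>onb. v (u b) * E b x f)"
      by (rule local_frame[OF open_UNIV UNIV_I, of m]) blast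
    have Et: "E b x \<in> tangent_space A x" for b x by (rule field_tangent[OF F(3)])
    have expand: "(\<lambda>f. \<Sum>b\<in>onb. v (u b) * E b x f) = v" if "x \<in> P" "v \<in> tangent_space A x" for x v
      by (rule ext) (rule F(5)[OF that, symmetric])
    have "\<exists>c. (\<forall>b\<in>onb. smooth_at A m (c b)) \<and>
        (\<forall>d\<in>onb. \<forall>\<^sub>F x in nhds m. (\<Sum>b\<in>onb. \<beta> (x, x) (E b x) (E d x) * c b x) = \<alpha> x (E d x))"
    proof (rule smooth_linear_system[where G = "\<lambda>d b x. \<beta> (x, x) (E b x) (E d x)" and a = "\<lambda>d x. \<alpha> x (E d x)"])
      show "smooth_at A m (\<lambda>x. \<beta> (x, x) (E b x) (E d x))" for b d
        using smooth_diag[OF smooth_\<beta>[OF F(3) F(3) diag_mem], of m b d] by simp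
      show "smooth_at A m (\<lambda>x. \<alpha> x (E d x))" for d by (rule sm[OF F(3)])
      fix c :: "'e \<Rightarrow> real" and b :: 'e
      assume c: "\<And>d. d \<in> onb \<Longrightarrow> (\<Sum>b\<in>onb. \<beta> (m, m) (E b m) (E d m) * c b) = 0" and b: "b \<in> onb"
      define v where "v = (\<lambda>f. \<Sum>b\<in>onb. c b * E b m f)"
      have v: "v \<in> tangent_space A m" unfolding v_def by (rule sum_tangent) (rule Et)
      have "\<beta> (m, m) v (E d m) = 0" if "d \<in> onb" for d
        unfolding v_def using c[OF that] by (subst \<beta>_sum_left[OF diag_mem Et finite_onb Et]) (simp add: mult.commute)
      then have "\<beta> (m, m) v w = 0" if w: "w \<in> tangent_space A m" for w
        using \<beta>_sum_right[where v = "\<lambda>b. E b m" and c = "\<lambda>b. w (u b)", OF diag_mem v finite_onb Et]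
        by (simp add: expand[OF F(2) w])
      then have "v = (\<lambda>_. 0)" by (rule \<beta>_nondegenerate[OF v])
      then have "v (u b) = 0" by simp
      then show "c b = 0"
        using F(4)[OF F(2) _ b] b by (simp add: v_def sum.delta if_distrib cong: sum.cong if_cong)
    qed auto
    then obtain c where c: "\<And>b. b \<in> onb \<Longrightarrow> smooth_at A m (c b)"
      "\<And>d. d \<in> onb \<Longrightarrow> \<forall>\<^sub>F x in nhds m. (\<Sum>b\<in>onb. \<beta> (x, x) (E b x) (E d x) * c b x) = \<alpha> x (E d x)" by blast
    show ?thesis
    proof (intro exI[of _ "\<lambda>x f. \<Sum>b\<in>onb. c b x * E b x f"] conjI allI impI)
      show "smooth_at A m (\<lambda>x. \<Sum>b\<in>onb. c b x * E b x f)" if "smooth_at A m f" for f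
        by (intro smooth_at_sum smooth_at_mult c field_smooth_at[OF F(3) that])
      have "\<forall>\<^sub>F x in nhds m. \<forall>d\<in>onb. (\<Sum>b\<in>onb. \<beta> (x, x) (E b x) (E d x) * c b x) = \<alpha> x (E d x)"
        by (rule eventually_ball_finite[OF finite_onb]) (use c(2) in blast)
      with eventually_nhds_in_open[OF F(1,2)]
      show "\<forall>\<^sub>F x in nhds m. (\<lambda>f. \<Sum>b\<in>onb. c b x * E b x f) \<in> tangent_space A x \<and>
          (\<forall>w\<in>tangent_space A x. \<beta> (x, x) (\<lambda>f. \<Sum>b\<in>onb. c b x * E b x f) w = \<alpha> x w)"
      proof eventually_elim
        case (elim x)
        define v where "v = (\<lambda>f. \<Sum>b\<in>onb. c b x * E b x f)"
        have v: "v \<in> tangent_space A x" unfolding v_def by (rule sum_tangent) (rule Et)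
        have d: "\<beta> (x, x) v (E d x) = \<alpha> x (E d x)" if "d \<in> onb" for d
          unfolding v_def using elim(2) that
          by (subst \<beta>_sum_left[OF diag_mem Et finite_onb Et]) (simp add: mult.commute)
        have "\<beta> (x, x) v w = \<alpha> x w" if w: "w \<in> tangent_space A x" for w
        proof -
          have "\<beta> (x, x) v w = (\<Sum>b\<in>onb. w (u b) * \<beta> (x, x) v (E b x))"
            using \<beta>_sum_right[where v = "\<lambda>b. E b x" and c = "\<lambda>b. w (u b)", OF diag_mem v finite_onb Et]
            by (simp add: expand[OF elim(1) w])
          also have "\<dots> = (\<Sum>b\<in>onb. w (u b) * \<alpha> x (E b x))" by (intro sum.cong refl) (simp add: d)
          also have "\<dots> = \<alpha> x w"
            using functional_sum[where \<alpha> = "\<alpha> x" and v = "\<lambda>b. E b x" and c = "\<lambda>b. w (u b)", OF lin finite_onb Et]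
            by (simp add: expand[OF elim(1) w])
          finally show ?thesis .
        qed
        with v show ?case unfolding v_def by blast
      qed
    qed
  qed
  have ex: "\<exists>v. v \<in> tangent_space A m \<and> (\<forall>w\<in>tangent_space A m. \<beta> (m, m) v w = \<alpha> m w)" for m
    using local[of m] eventually_nhds_x_imp_x by fast
  then obtain V where V: "\<And>m. V m \<in> tangent_space A m" "\<And>m w. w \<in> tangent_space A m \<Longrightarrow> \<beta> (m, m) (V m) w = \<alpha> m w"
    by metis
  have "V \<in> vector_fields A"
  proof (rule vector_fieldsI)
    fix m f assume f: "smooth_at A m f"
    obtain V' where V': "smooth_at A m (\<lambda>x. V' x f)"
      "\<forall>\<^sub>F x in nhds m. V' x \<in> tangent_space A x \<and> (\<forall>w\<in>tangent_space A x. \<beta> (x, x) (V' x) w = \<alpha> x w)"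
      using local[of m] f by blast
    from V'(2) have "\<forall>\<^sub>F x in nhds m. V' x f = V x f"
    proof eventually_elim
      case (elim x)
      then have "V' x = V x" using V by (intro \<beta>_eqI) auto
      then show ?case by simp
    qed
    then show "smooth_at A m (\<lambda>x. V x f)" by (rule smooth_at_cong[OF V'(1)])
  qed (rule V)
  then show ?thesis using V(2) by blast
qed

text \<open>\<open>dL Z X m w\<close> is g(\<nabla>_Z X, w) and \<open>dR Z Y m v\<close> is g(v,
  \<nabla>'_Z Y), where \<nabla>' is the conjugate connection. The argument at the resting point is
  a single vector, not a field, which makes both expressions visibly linear in it and hence fit for
  \<open>ex_sharp\<close>.\<close>

definition dL :: "'a field \<Rightarrow> 'a field \<Rightarrow> 'a \<Rightarrow> 'a tangent \<Rightarrow> real" where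
  "dL Z X m w = Z m (\<lambda>x. \<beta> (x, m) (X x) w)"

definition dR :: "'a field \<Rightarrow> 'a field \<Rightarrow> 'a \<Rightarrow> 'a tangent \<Rightarrow> real" where
  "dR Z Y m v = Z m (\<lambda>y. \<beta> (m, y) v (Y y))"

lemma dL_lin:
  assumes Z: "Z \<in> vector_fields A" and X: "X \<in> vector_fields A" and uv: "u \<in> tangent_space A m" "v \<in> tangent_space A m"
  shows "dL Z X m (lincomb a u b v) = a * dL Z X m u + b * dL Z X m v"
proof -
  note s = smooth_\<beta>_left[OF X _ diag_mem]
  have "dL Z X m (lincomb a u b v) = Z m (\<lambda>x. a * \<beta> (x, m) (X x) u + b * \<beta> (x, m) (X x) v)"
    unfolding dL_def
    by (rule tangent_cong[OF field_tangent[OF Z] s[OF lincomb_tangent[OF uv]]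
        smooth_at_add[OF smooth_at_mult[OF smooth_at_const s[OF uv(1)]] smooth_at_mult[OF smooth_at_const s[OF uv(2)]]]],
        rule eventually_mono[OF eventually_W_left[OF diag_mem]]) (intro \<beta>_lin_right uv field_tangent[OF X])
  then show ?thesis using tangent_lin[OF field_tangent[OF Z] s[OF uv(1)] s[OF uv(2)]] by (simp add: dL_def)
qed

lemma dR_lin:
  assumes Z: "Z \<in> vector_fields A" and Y: "Y \<in> vector_fields A" and uv: "u \<in> tangent_space A m" "v \<in> tangent_space A m"
  shows "dR Z Y m (lincomb a u b v) = a * dR Z Y m u + b * dR Z Y m v"
proof -
  note s = smooth_\<beta>_right[OF Y _ diag_mem]
  have "dR Z Y m (lincomb a u b v) = Z m (\<lambda>y. a * \<beta> (m, y) u (Y y) + b * \<beta> (m, y) v (Y y))"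
    unfolding dR_def
    by (rule tangent_cong[OF field_tangent[OF Z] s[OF lincomb_tangent[OF uv]]
        smooth_at_add[OF smooth_at_mult[OF smooth_at_const s[OF uv(1)]] smooth_at_mult[OF smooth_at_const s[OF uv(2)]]]],
        rule eventually_mono[OF eventually_W_right[OF diag_mem]]) (intro \<beta>_lin_left uv field_tangent[OF Y])
  then show ?thesis using tangent_lin[OF field_tangent[OF Z] s[OF uv(1)] s[OF uv(2)]] by (simp add: dR_def)
qed

lemma dL_smooth:
  assumes Z: "Z \<in> vector_fields A" and X: "X \<in> vector_fields A" and Y: "Y \<in> vector_fields A"
  shows "smooth_at A m (\<lambda>m. dL Z X m (Y m))"
  using smooth_diag[OF smooth2_field_left[OF Z smooth_\<beta>[OF X Y diag_mem]]] by (simp add: dL_def)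

lemma dR_smooth:
  assumes Z: "Z \<in> vector_fields A" and X: "X \<in> vector_fields A" and Y: "Y \<in> vector_fields A"
  shows "smooth_at A m (\<lambda>m. dR Z Y m (X m))"
  using smooth_diag[OF smooth2_field_right[OF Z smooth_\<beta>[OF X Y diag_mem]]] by (simp add: dR_def)

lemma lie_deriv_\<beta>:
  assumes "X \<in> vector_fields A" "Y \<in> vector_fields A"
  shows "lie_deriv (left_lift A Z) (biform_eval \<omega> [X] [Y]) (m, m) = dL Z X m (Y m)"
proof -
  have "smooth2 (m, m) (biform_eval \<omega> [X] [Y])"
    using smooth_\<beta>[OF assms diag_mem] by (simp add: biform_eval_def case_prod_beta')
  from lie_deriv_left_lift[OF this] show ?thesis by (simp add: dL_def biform_eval_def)
qed

text \<open>Every tangent vector is the value of a global field, so the definitions, which test on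
  fields, can be read as tests on vectors.\<close>

lemma all_fields_iff:
  "(\<forall>Y\<in>vector_fields A. \<forall>m. Q m (Y m)) \<longleftrightarrow> (\<forall>m. \<forall>w\<in>tangent_space A m. Q m w)"
  using field_tangent field_through by metis

text \<open>Resolves the definite description: existence by raising an index of
  \<open>dL Z X\<close>, uniqueness by nondegeneracy.\<close>

lemma induced_connection:
  assumes Z: "Z \<in> vector_fields A" and X: "X \<in> vector_fields A"
  shows "induced_connection A \<omega> Z X \<in> vector_fields A"
    and "w \<in> tangent_space A m \<Longrightarrow> \<beta> (m, m) (induced_connection A \<omega> Z X m) w = dL Z X m w"
proof -
  define Q where "Q = (\<lambda>V. V \<in> vector_fields A \<and> (\<forall>Y\<in>vector_fields A. \<forall>m. induced_metric \<omega> m [V m, Y m] =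
        lie_deriv (left_lift A Z) (biform_eval \<omega> [X] [Y]) (m, m)))"
  have Q: "Q V \<longleftrightarrow> V \<in> vector_fields A \<and> (\<forall>m. \<forall>w\<in>tangent_space A m. \<beta> (m, m) (V m) w = dL Z X m w)" for V
    unfolding Q_def all_fields_iff[symmetric] by (auto simp: lie_deriv_\<beta>[OF X] diag_pullback_def)
  obtain V where V: "Q V"
    unfolding Q using ex_sharp[of "dL Z X", OF dL_lin[OF Z X] dL_smooth[OF Z X]] by blast
  have uniq: "V' = V" if "Q V'" for V'
  proof
    fix m show "V' m = V m"
      by (rule \<beta>_eqI) (use V that field_tangent in \<open>auto simp: Q\<close>)
  qed
  have "Q (THE V. Q V)" by (rule theI[of Q, OF V]) (rule uniq)
  then have "Q (induced_connection A \<omega> Z X)" unfolding induced_connection_def Q_def .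
  then show "induced_connection A \<omega> Z X \<in> vector_fields A"
    and "w \<in> tangent_space A m \<Longrightarrow> \<beta> (m, m) (induced_connection A \<omega> Z X m) w = dL Z X m w"
    by (auto simp: Q)
qed

text \<open>The splitting of a derivative along the diagonal. Since \<open>dL\<close> accounts for
  the induced connection, \<open>dR\<close> is what remains for its conjugate.\<close>

lemma metric_derivative:
  assumes Z: "Z \<in> vector_fields A" and X: "X \<in> vector_fields A" and Y: "Y \<in> vector_fields A"
  shows "Z m (\<lambda>x. \<beta> (x, x) (X x) (Y x)) = dL Z X m (Y m) + dR Z Y m (X m)"
  using tangent_diag[OF field_tangent[OF Z] smooth_\<beta>[OF X Y diag_mem]] by (simp add: dL_def dR_def)

lemma conjugate_connection:
  assumes Z: "Z \<in> vector_fields A" and Y: "Y \<in> vector_fields A"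
  defines "N \<equiv> conjugate_connection A (induced_metric \<omega>) (induced_connection A \<omega>)"
  shows "N Z Y \<in> vector_fields A"
    and "v \<in> tangent_space A m \<Longrightarrow> \<beta> (m, m) v (N Z Y m) = dR Z Y m v"
proof -
  define Q where "Q = (\<lambda>V. V \<in> vector_fields A \<and> (\<forall>X\<in>vector_fields A. \<forall>m.
    lie_deriv Z (\<lambda>x. induced_metric \<omega> x [X x, Y x]) m =
      induced_metric \<omega> m [induced_connection A \<omega> Z X m, Y m] + induced_metric \<omega> m [X m, V m]))"
  have Q: "Q V \<longleftrightarrow> V \<in> vector_fields A \<and> (\<forall>m. \<forall>v\<in>tangent_space A m. \<beta> (m, m) v (V m) = dR Z Y m v)" for V
    unfolding Q_def all_fields_iff[symmetric]
    by (auto simp: lie_deriv_def diag_pullback_def metric_derivative[OF Z _ Y]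
        induced_connection(2)[OF Z _ field_tangent[OF Y]])
  obtain V where "V \<in> vector_fields A" "\<And>m v. v \<in> tangent_space A m \<Longrightarrow> \<beta> (m, m) (V m) v = dR Z Y m v"
    using ex_sharp[of "dR Z Y", OF dR_lin[OF Z Y] dR_smooth[OF Z _ Y]] by blast
  then have V: "Q V" unfolding Q using \<beta>_sym field_tangent by metis
  have uniq: "V' = V" if "Q V'" for V'
  proof
    fix m show "V' m = V m"
    proof (rule \<beta>_eqI)
      show t: "V' m \<in> tangent_space A m" "V m \<in> tangent_space A m"
        using V that by (auto simp: Q intro: field_tangent)
      fix w assume w: "w \<in> tangent_space A m"
      have "\<beta> (m, m) w (V' m) = \<beta> (m, m) w (V m)" using V that w by (simp add: Q)
      then show "\<beta> (m, m) (V' m) w = \<beta> (m, m) (V m) w"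
        using \<beta>_sym[OF w t(1)] \<beta>_sym[OF w t(2)] by simp
    qed
  qed
  have "Q (THE V. Q V)" by (rule theI[of Q, OF V]) (rule uniq)
  then have "Q (N Z Y)" unfolding N_def conjugate_connection_def Q_def .
  then show "N Z Y \<in> vector_fields A"
    and "v \<in> tangent_space A m \<Longrightarrow> \<beta> (m, m) v (N Z Y m) = dR Z Y m v"
    by (auto simp: Q)
qed

lemma lincomb_field_apply:
  "Z \<in> vector_fields A \<Longrightarrow> Z' \<in> vector_fields A \<Longrightarrow> smooth_fun A UNIV f \<Longrightarrow> smooth_fun A UNIV h \<Longrightarrow>
    (\<lambda>m. lincomb (f m) (Z m) (h m) (Z' m)) \<in> vector_fields A"
  by (rule lincomb_vector_fields) (auto intro: smooth_fun_imp_smooth_at)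

lemma smooth_fun_const: "smooth_fun A UNIV (\<lambda>_. c)"
  by (simp add: smooth_fun_iff smooth_at_const)

lemma affine_induced_connection: "affine_connection A (induced_connection A \<omega>)"
proof -
  let ?N = "induced_connection A \<omega>"
  note N = induced_connection
  note Nt = field_tangent[OF N(1)]
  note s = smooth_\<beta>_left[OF _ _ diag_mem]
  have 1: "?N (\<lambda>m. lincomb (f m) (Z m) (h m) (Z' m)) X = (\<lambda>m. lincomb (f m) (?N Z X m) (h m) (?N Z' X m))"
    if Z: "Z \<in> vector_fields A" "Z' \<in> vector_fields A" "X \<in> vector_fields A"
      and f: "smooth_fun A UNIV f" "smooth_fun A UNIV h" for Z Z' X f h
  proof
    fix m
    have F: "(\<lambda>m. lincomb (f m) (Z m) (h m) (Z' m)) \<in> vector_fields A"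
      by (rule lincomb_field_apply[OF Z(1,2) f])
    show "?N (\<lambda>m. lincomb (f m) (Z m) (h m) (Z' m)) X m = lincomb (f m) (?N Z X m) (h m) (?N Z' X m)"
    proof (rule \<beta>_eqI[OF Nt[OF F Z(3)] lincomb_tangent[OF Nt[OF Z(1,3)] Nt[OF Z(2,3)]]])
      fix w assume w: "w \<in> tangent_space A m"
      show "\<beta> (m, m) (?N (\<lambda>m. lincomb (f m) (Z m) (h m) (Z' m)) X m) w
          = \<beta> (m, m) (lincomb (f m) (?N Z X m) (h m) (?N Z' X m)) w"
        using N(2)[OF F Z(3) w] N(2)[OF Z(1,3) w] N(2)[OF Z(2,3) w]
          \<beta>_lin_left[OF diag_mem Nt[OF Z(1,3)] Nt[OF Z(2,3)] w]
        by (simp add: dL_def lincomb_def)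
    qed
  qed
  have 2: "?N Z (\<lambda>m. lincomb a (X m) b (Y m)) = (\<lambda>m. lincomb a (?N Z X m) b (?N Z Y m))"
    if Z: "Z \<in> vector_fields A" "X \<in> vector_fields A" "Y \<in> vector_fields A" for Z X Y a b
  proof
    fix m
    have F: "(\<lambda>m. lincomb a (X m) b (Y m)) \<in> vector_fields A"
      by (rule lincomb_field_apply[OF Z(2,3) smooth_fun_const smooth_fun_const])
    show "?N Z (\<lambda>m. lincomb a (X m) b (Y m)) m = lincomb a (?N Z X m) b (?N Z Y m)"
    proof (rule \<beta>_eqI[OF Nt[OF Z(1) F] lincomb_tangent[OF Nt[OF Z(1,2)] Nt[OF Z(1,3)]]])
      fix w assume w: "w \<in> tangent_space A m"
      have "dL Z (\<lambda>m. lincomb a (X m) b (Y m)) m w = Z m (\<lambda>x. a * \<beta> (x, m) (X x) w + b * \<beta> (x, m) (Y x) w)"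
        unfolding dL_def
        by (rule tangent_cong[OF field_tangent[OF Z(1)] s[OF F w] smooth_at_add[OF smooth_at_mult[OF smooth_at_const s[OF Z(2) w]]
                smooth_at_mult[OF smooth_at_const s[OF Z(3) w]]]],
            rule eventually_mono[OF eventually_W_left[OF diag_mem]])
          (intro \<beta>_lin_left w field_tangent Z)
      also have "\<dots> = a * dL Z X m w + b * dL Z Y m w"
        unfolding dL_def by (rule tangent_lin[OF field_tangent[OF Z(1)] s[OF Z(2) w] s[OF Z(3) w]])
      finally show "\<beta> (m, m) (?N Z (\<lambda>m. lincomb a (X m) b (Y m)) m) w = \<beta> (m, m) (lincomb a (?N Z X m) b (?N Z Y m)) w"
        using N(2)[OF Z(1) F w] N(2)[OF Z(1,2) w] N(2)[OF Z(1,3) w]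
          \<beta>_lin_left[OF diag_mem Nt[OF Z(1,2)] Nt[OF Z(1,3)] w] by simp
    qed
  qed
  have 3: "?N Z (\<lambda>m v. f m * X m v) = (\<lambda>m. lincomb (f m) (?N Z X m) (lie_deriv Z f m) (X m))"
    if Z: "Z \<in> vector_fields A" "X \<in> vector_fields A" and f: "smooth_fun A UNIV f" for Z X f
  proof
    fix m
    have eq: "(\<lambda>m v. f m * X m v) = (\<lambda>m. lincomb (f m) (X m) 0 (X m))" by (simp add: lincomb_def)
    have F: "(\<lambda>m v. f m * X m v) \<in> vector_fields A"
      unfolding eq by (rule lincomb_field_apply[OF Z(2,2) f smooth_fun_const])
    have fm: "smooth_at A m f" by (rule smooth_fun_imp_smooth_at[OF f UNIV_I])
    show "?N Z (\<lambda>m v. f m * X m v) m = lincomb (f m) (?N Z X m) (lie_deriv Z f m) (X m)"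
    proof (rule \<beta>_eqI[OF Nt[OF Z(1) F] lincomb_tangent[OF Nt[OF Z] field_tangent[OF Z(2)]]])
      fix w assume w: "w \<in> tangent_space A m"
      have "dL Z (\<lambda>m v. f m * X m v) m w = Z m (\<lambda>x. f x * \<beta> (x, m) (X x) w)"
        unfolding dL_def
      proof (rule tangent_cong[OF field_tangent[OF Z(1)] s[OF F w] smooth_at_mult[OF fm s[OF Z(2) w]]],
          rule eventually_mono[OF eventually_W_left[OF diag_mem]])
        fix x assume x: "(x, m) \<in> W"
        from \<beta>_lin_left[OF x field_tangent[OF Z(2)] field_tangent[OF Z(2)] w, of "f x" 0]
        show "\<beta> (x, m) (\<lambda>v. f x * X x v) w = f x * \<beta> (x, m) (X x) w" by (simp add: lincomb_def)
      qed
      also have "\<dots> = Z m f * \<beta> (m, m) (X m) w + f m * dL Z X m w"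
        unfolding dL_def by (rule tangent_mult[OF field_tangent[OF Z(1)] fm s[OF Z(2) w]])
      finally show "\<beta> (m, m) (?N Z (\<lambda>m v. f m * X m v) m) w
          = \<beta> (m, m) (lincomb (f m) (?N Z X m) (lie_deriv Z f m) (X m)) w"
        using N(2)[OF Z(1) F w] N(2)[OF Z w] \<beta>_lin_left[OF diag_mem Nt[OF Z] field_tangent[OF Z(2)] w]
        by (simp add: lie_deriv_def)
    qed
  qed
  show ?thesis
    unfolding affine_connection_def using N(1) 1 2 3 by blast
qed

text \<open>By nondegeneracy an identity of vectors may be tested with the metric. This turns the
  torsion condition into a relation between left derivatives of the bi-form on the diagonal.\<close>

lemma torsion_free_induced_iff:
  "torsion_free A (induced_connection A \<omega>) \<longleftrightarrow>
    (\<forall>X\<in>vector_fields A. \<forall>Y\<in>vector_fields A. \<forall>m. \<forall>w\<in>tangent_space A m.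
      dL X Y m w - dL Y X m w = \<beta> (m, m) (lie_bracket A X Y m) w)"
proof -
  let ?N = "induced_connection A \<omega>"
  have "(\<lambda>m. lincomb 1 (?N X Y m) (-1) (?N Y X m)) = lie_bracket A X Y \<longleftrightarrow>
      (\<forall>m. \<forall>w\<in>tangent_space A m. dL X Y m w - dL Y X m w = \<beta> (m, m) (lie_bracket A X Y m) w)"
    if XY: "X \<in> vector_fields A" "Y \<in> vector_fields A" for X Y
  proof -
    note t = field_tangent[OF induced_connection(1)[OF XY]] field_tangent[OF induced_connection(1)[OF XY(2,1)]]
    have *: "\<beta> (m, m) (lincomb 1 (?N X Y m) (-1) (?N Y X m)) w = dL X Y m w - dL Y X m w"
      if "w \<in> tangent_space A m" for m w
      using \<beta>_lin_left[OF diag_mem t that] induced_connection(2)[OF XY that] induced_connection(2)[OF XY(2,1) that] by simp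
    show ?thesis
    proof
      assume eq: "(\<lambda>m. lincomb 1 (?N X Y m) (-1) (?N Y X m)) = lie_bracket A X Y"
      show "\<forall>m. \<forall>w\<in>tangent_space A m. dL X Y m w - dL Y X m w = \<beta> (m, m) (lie_bracket A X Y m) w"
        using *  unfolding fun_cong[OF eq] by simp
    next
      assume R: "\<forall>m. \<forall>w\<in>tangent_space A m. dL X Y m w - dL Y X m w = \<beta> (m, m) (lie_bracket A X Y m) w"
      show "(\<lambda>m. lincomb 1 (?N X Y m) (-1) (?N Y X m)) = lie_bracket A X Y"
        by (rule ext, rule \<beta>_eqI[OF lincomb_tangent[OF t] lie_bracket_tangent[OF XY]]) (use * R  in simp)
    qed
  qed
  then show ?thesis unfolding torsion_free_def by blast
qed

lemma torsion_free_conjugate_iff: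
  "torsion_free A (conjugate_connection A (induced_metric \<omega>) (induced_connection A \<omega>)) \<longleftrightarrow>
    (\<forall>X\<in>vector_fields A. \<forall>Y\<in>vector_fields A. \<forall>m. \<forall>v\<in>tangent_space A m.
      dR X Y m v - dR Y X m v = \<beta> (m, m) v (lie_bracket A X Y m))"
proof -
  let ?N = "conjugate_connection A (induced_metric \<omega>) (induced_connection A \<omega>)"
  have "(\<lambda>m. lincomb 1 (?N X Y m) (-1) (?N Y X m)) = lie_bracket A X Y \<longleftrightarrow>
      (\<forall>m. \<forall>v\<in>tangent_space A m. dR X Y m v - dR Y X m v = \<beta> (m, m) v (lie_bracket A X Y m))"
    if XY: "X \<in> vector_fields A" "Y \<in> vector_fields A" for X Y
  proof -
    note t = field_tangent[OF conjugate_connection(1)[OF XY]] field_tangent[OF conjugate_connection(1)[OF XY(2,1)]]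
    have *: "\<beta> (m, m) (lincomb 1 (?N X Y m) (-1) (?N Y X m)) v = dR X Y m v - dR Y X m v"
      if "v \<in> tangent_space A m" for m v
      using \<beta>_lin_right[OF diag_mem t that] conjugate_connection(2)[OF XY that] conjugate_connection(2)[OF XY(2,1) that]
        \<beta>_sym[OF lincomb_tangent[OF t] that] by simp
    have **: "\<beta> (m, m) (lie_bracket A X Y m) v = \<beta> (m, m) v (lie_bracket A X Y m)" if "v \<in> tangent_space A m" for m v
      by (rule \<beta>_sym[OF lie_bracket_tangent[OF XY] that])
    show ?thesis
    proof
      assume eq: "(\<lambda>m. lincomb 1 (?N X Y m) (-1) (?N Y X m)) = lie_bracket A X Y"
      show "\<forall>m. \<forall>v\<in>tangent_space A m. dR X Y m v - dR Y X m v = \<beta> (m, m) v (lie_bracket A X Y m)"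
        using * ** unfolding fun_cong[OF eq] by simp
    next
      assume R: "\<forall>m. \<forall>v\<in>tangent_space A m. dR X Y m v - dR Y X m v = \<beta> (m, m) v (lie_bracket A X Y m)"
      show "(\<lambda>m. lincomb 1 (?N X Y m) (-1) (?N Y X m)) = lie_bracket A X Y"
        by (rule ext, rule \<beta>_eqI[OF lincomb_tangent[OF t] lie_bracket_tangent[OF XY]]) (use * R ** in simp)
    qed
  qed
  then show ?thesis unfolding torsion_free_def by blast
qed

end

section \<open>Bi-exact contrast bi-forms are statistical\<close>

context smooth_manifold
begin

text \<open>With one left argument the defining formula consists of a single Lie derivative; the sum
  over a < b < 1 is empty.\<close>

lemma left_diff_10:
  assumes "smooth2 (m, n) (\<lambda>z. F z [] [])" "v \<in> tangent_space A m"
  shows "left_diff A F (m, n) [v] [] = v (\<lambda>x. F (x, n) [] [])"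
proof -
  have "biform_eval F [] [] = (\<lambda>z. F z [] [])" by (simp add: biform_eval_def case_prod_beta')
  then show ?thesis
    using lie_deriv_left_lift[OF assms(1), of "field_through A m v"] field_through(2)[OF assms(2)]
    by (simp add: left_diff_def left_diff_fields_def nths_singleton)
qed

lemma left_diff_11:
  assumes "\<And>Y. Y \<in> vector_fields A \<Longrightarrow> smooth2 (m, n) (\<lambda>z. \<eta> z [] [Y (snd z)])"
    and "v \<in> tangent_space A m" "w \<in> tangent_space A n"
  shows "left_diff A \<eta> (m, n) [v] [w] = v (\<lambda>x. \<eta> (x, n) [] [w])"
proof -
  let ?Y = "field_through A n w"
  have "biform_eval \<eta> [] [?Y] = (\<lambda>z. \<eta> z [] [?Y (snd z)])" by (simp add: biform_eval_def case_prod_beta')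
  then show ?thesis
    using lie_deriv_left_lift[OF assms(1)[OF field_through(1)[OF assms(3)]], of "field_through A m v"]
      field_through(2)[OF assms(2)] field_through(2)[OF assms(3)]
    by (simp add: left_diff_def left_diff_fields_def nths_singleton)
qed

lemma right_diff_01:
  assumes "smooth2 (m, n) (\<lambda>z. F z [] [])" "w \<in> tangent_space A n"
  shows "right_diff A F (m, n) [] [w] = w (\<lambda>y. F (m, y) [] [])"
proof -
  have "smooth2 (n, m) (\<lambda>z. swap_biform F z [] [])"
    using smooth2_swap[of "(n, m)" "\<lambda>z. F z [] []"] assms(1) by (simp add: swap_biform_def case_prod_beta')
  from left_diff_10[where F = "swap_biform F", OF this assms(2)] show ?thesis
    by (simp add: right_diff_def swap_biform_def)
qed

lemma left_right_diff:
  assumes F: "\<And>z. smooth2 z (\<lambda>z. F z [] [])" and v: "v \<in> tangent_space A m" and w: "w \<in> tangent_space A n"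
  shows "left_diff A (right_diff A F) (m, n) [v] [w] = v (\<lambda>x. w (\<lambda>y. F (x, y) [] []))"
proof -
  have "smooth2 (m, n) (\<lambda>z. right_diff A F z [] [Y (snd z)])" if Y: "Y \<in> vector_fields A" for Y
  proof -
    have "right_diff A F z [] [Y (snd z)] = Y (snd z) (\<lambda>y. F (fst z, y) [] [])" for z
      using right_diff_01[where F = F and m = "fst z" and n = "snd z", OF _ field_tangent[OF Y]] F by simp
    then show ?thesis using smooth2_field_right[OF Y F] by simp
  qed
  from left_diff_11[where \<eta> = "right_diff A F", OF this v w] show ?thesis
    using right_diff_01[where F = F, OF F w] by simp
qed

lemma smooth2_biform_00:
  assumes "F \<in> biforms A UNIV 0 0"
  shows "smooth2 z (\<lambda>z. F z [] [])"
proof -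
  have "smooth_fun (prod_atlas A A) UNIV (biform_eval F [] [])"
    using assms by (simp add: biforms_def)
  from smooth_fun_imp_smooth_at[OF this UNIV_I] show ?thesis by (simp add: biform_eval_def case_prod_beta')
qed

end

context contrast
begin

lemma statistical_if_bi_exact:
  assumes F: "F \<in> biforms A UNIV 0 0" and eq: "biform_eq_on A W 1 1 \<omega> (left_diff A (right_diff A F))"
  shows "statistical_manifold A (induced_metric \<omega>) (induced_connection A \<omega>)"
proof -
  define f where "f = (\<lambda>z. F z [] [])"
  have f: "smooth2 z f" for z unfolding f_def by (rule smooth2_biform_00[OF F])
  have \<beta>: "\<beta> (m, n) v w = v (\<lambda>x. w (\<lambda>y. f (x, y)))"
    if "(m, n) \<in> W" "v \<in> tangent_space A m" "w \<in> tangent_space A n" for m n v w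
    using eq that left_right_diff[where F = F, OF smooth2_biform_00[OF F] that(2,3)]
    by (auto simp: biform_eq_on_def args_def f_def)
  have 1: "dL X Y m w - dL Y X m w = \<beta> (m, m) (lie_bracket A X Y m) w"
    if X: "X \<in> vector_fields A" and Y: "Y \<in> vector_fields A" and w: "w \<in> tangent_space A m" for X Y m w
  proof -
    \<comment> \<open>With w frozen, the bi-form near the diagonal is a left vector applied to this
      one function, and the torsion identity becomes the definition of the bracket applied to
      it.\<close>
    define \<phi> where "\<phi> = (\<lambda>x. w (\<lambda>y. f (x, y)))"
    have \<phi>: "smooth_at A x \<phi>" for x unfolding \<phi>_def by (rule smooth_tangent_right[OF w f])
    have "dL X Y m w = X m (\<lambda>x. Y x \<phi>)" if X: "X \<in> vector_fields A" and Y: "Y \<in> vector_fields A" for X Y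
      unfolding dL_def
      by (rule tangent_cong[OF field_tangent[OF X] smooth_\<beta>_left[OF Y w diag_mem] field_smooth_at[OF Y \<phi>]],
          rule eventually_mono[OF eventually_W_left[OF diag_mem]]) (simp add: \<beta> field_tangent[OF Y] w \<phi>_def)
    then show ?thesis
      using X Y \<beta>[OF diag_mem lie_bracket_tangent[OF X Y] w] \<phi>
      by (simp add: \<phi>_def[symmetric] lie_bracket_def lie_deriv_def)
  qed
  have 2: "dR X Y m v - dR Y X m v = \<beta> (m, m) v (lie_bracket A X Y m)"
    if X: "X \<in> vector_fields A" and Y: "Y \<in> vector_fields A" and v: "v \<in> tangent_space A m" for X Y m v
  proof -
    define \<psi> where "\<psi> = (\<lambda>y. v (\<lambda>x. f (x, y)))"
    have \<psi>: "smooth_at A y \<psi>" for y unfolding \<psi>_def by (rule smooth_tangent_left[OF v f])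
    \<comment> \<open>Here the right point moves, so its vector must act last. Exchanging the two
      derivations is what makes the previous argument apply to the conjugate connection.\<close>
    have \<beta>': "\<beta> (m, n) v w = w \<psi>" if "(m, n) \<in> W" "w \<in> tangent_space A n" for n w
      using \<beta>[OF that(1) v that(2)] tangent_commute[OF v that(2) f] by (simp add: \<psi>_def)
    have "dR X Y m v = X m (\<lambda>y. Y y \<psi>)" if X: "X \<in> vector_fields A" and Y: "Y \<in> vector_fields A" for X Y
      unfolding dR_def
      by (rule tangent_cong[OF field_tangent[OF X] smooth_\<beta>_right[OF Y v diag_mem] field_smooth_at[OF Y \<psi>]],
          rule eventually_mono[OF eventually_W_right[OF diag_mem]]) (simp add: \<beta>' field_tangent[OF Y])
    then show ?thesis
      using X Y \<beta>'[OF diag_mem lie_bracket_tangent[OF X Y]] \<psi>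
      by (simp add: lie_bracket_def lie_deriv_def)
  qed
  show ?thesis
    unfolding statistical_manifold_def torsion_free_induced_iff torsion_free_conjugate_iff
    using smooth_manifold_axioms metric affine_induced_connection 1 2 by blast
qed

section \<open>Potentials with prescribed second-order behaviour on the diagonal\<close>

text \<open>The jet of F at (m, m) that the theorem needs: value and first derivatives zero, mixed
  second derivatives equal to the metric, and one family of third derivatives, twice left and once
  right, equal to the lowered connection. It constrains F at one diagonal point only, and is
  therefore suited to patching.\<close>

definition osculates :: "('a \<times> 'a \<Rightarrow> real) \<Rightarrow> 'a \<Rightarrow> bool" where
  "osculates F m \<longleftrightarrow> F (m, m) = 0 \<and> (\<forall>v\<in>tangent_space A m. v (\<lambda>x. F (x, m)) = 0) \<and>
     (\<forall>w\<in>tangent_space A m. w (\<lambda>y. F (m, y)) = 0) \<and>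
     (\<forall>v\<in>tangent_space A m. \<forall>w\<in>tangent_space A m. v (\<lambda>x. w (\<lambda>y. F (x, y))) = \<beta> (m, m) v w) \<and>
     (\<forall>Z\<in>vector_fields A. \<forall>X\<in>vector_fields A. \<forall>w\<in>tangent_space A m.
        Z m (\<lambda>x. X x (\<lambda>x'. w (\<lambda>y. F (x', y)))) = dL Z X m w)"

text \<open>Tensors are functions on all lists and \<open>cotensor_eq\<close> compares only the
  meaningful ones, so the metric property has to be transferred explicitly.\<close>

lemma pseudo_riemannian_cong:
  assumes eq: "cotensor_eq A 2 g h" and h: "pseudo_riemannian A h"
  shows "pseudo_riemannian A g"
proof -
  have g: "g m vs = h m vs" if "vs \<in> args 2 (tangent_space A m)" for m vs
    using eq that by (simp add: cotensor_eq_def)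
  have g2: "g m [u, v] = h m [u, v]" if "u \<in> tangent_space A m" "v \<in> tangent_space A m" for m u v
    by (rule g) (use that in \<open>simp add: args_def\<close>)
  have upd: "vs[i := u] \<in> args 2 (tangent_space A m)"
    if "vs \<in> args 2 (tangent_space A m)" "u \<in> tangent_space A m" for vs i u m
    using that set_update_subset_insert[of vs i u] by (auto simp: args_def)
  have "g \<in> cotensors A 2"
    unfolding cotensors_def mem_Collect_eq
  proof (intro conjI allI impI)
    fix m
    have "multilinear 2 (tangent_space A m) (h m)" using h by (auto simp: pseudo_riemannian_def cotensors_def)
    then show "multilinear 2 (tangent_space A m) (g m)"
      unfolding multilinear_def by (simp add: g upd lincomb_tangent)
  next
    fix Xs :: "'a field list" assume Xs: "length Xs = 2 \<and> set Xs \<subseteq> vector_fields A"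
    have "g m (map (\<lambda>X. X m) Xs) = h m (map (\<lambda>X. X m) Xs)" for m
      by (rule g) (use Xs in \<open>auto simp: args_def intro: field_tangent\<close>)
    then show "smooth_fun A UNIV (\<lambda>m. g m (map (\<lambda>X. X m) Xs))"
      using h Xs by (simp add: pseudo_riemannian_def cotensors_def)
  qed
  then show ?thesis
    using h unfolding pseudo_riemannian_def by (simp add: g2)
qed

text \<open>Since d^L d^R F evaluated on v, w is the iterated derivative of f by w in the right and
  v in the left variable, each clause of \<open>osculates\<close> is read off as one clause of the
  conclusion. F may ignore its argument lists because in degree (0, 0) only empty ones
  occur.\<close>

lemma contrast_biform_of_potential:
  assumes sm: "\<And>z. smooth2 z f" and osc: "\<And>m. osculates f m"
  defines "F \<equiv> \<lambda>z vs ws. f z"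
  shows "F \<in> biforms A UNIV 0 0 \<and>
    contrast_biform A UNIV (left_diff A (right_diff A F)) \<and>
    cotensor_eq A 2 (induced_metric (left_diff A (right_diff A F))) (induced_metric \<omega>) \<and>
    connection_eq A (induced_connection A (left_diff A (right_diff A F))) (induced_connection A \<omega>) \<and>
    cotensor_eq A 1 (diag_pullback 1 (left_diff A F)) (\<lambda>m vs. 0) \<and>
    cotensor_eq A 1 (diag_pullback 0 (right_diff A F)) (\<lambda>m vs. 0) \<and>
    cotensor_eq A 0 (diag_pullback 0 F) (\<lambda>m vs. 0)"
proof -
  define \<eta> where "\<eta> = left_diff A (right_diff A F)"
  have smF: "smooth2 z (\<lambda>z. F z [] [])" for z unfolding F_def by (rule sm)
  have \<eta>: "\<eta> (m, n) [v] [w] = v (\<lambda>x. w (\<lambda>y. f (x, y)))"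
    if "v \<in> tangent_space A m" "w \<in> tangent_space A n" for m n v w
    using left_right_diff[where F = F, OF smF that] by (simp add: \<eta>_def F_def)
  have args1: "vs \<in> args 1 T \<longleftrightarrow> (\<exists>v\<in>T. vs = [v])" for vs and T :: "'a tangent set"
    by (auto simp: args_def length_Suc_conv)
  note args1' = args1[unfolded One_nat_def]
  have "smooth_fun (prod_atlas A A) UNIV f"
    by (simp add: smooth_manifold.smooth_fun_iff[OF prod_manifold] sm)
  then have F: "F \<in> biforms A UNIV 0 0"
    by (auto simp: biforms_def multilinear_def alternating_def biform_eval_def F_def)
  have s\<eta>: "smooth2 z (biform_eval \<eta> [X] [Y])" if X: "X \<in> vector_fields A" and Y: "Y \<in> vector_fields A" for X Y z
  proof -
    have "biform_eval \<eta> [X] [Y] = (\<lambda>z. X (fst z) (\<lambda>x. Y (snd z) (\<lambda>y. f (x, y))))"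
      using \<eta>[OF field_tangent[OF X] field_tangent[OF Y]] by (auto simp: biform_eval_def)
    then show ?thesis
      using smooth2_field_left[OF X smooth2_field_right[OF Y sm]] by simp
  qed
  have "\<eta> \<in> biforms A UNIV 1 1"
    unfolding biforms_def mem_Collect_eq
  proof (intro conjI allI impI)
    show "\<forall>(m, n)\<in>UNIV.
        (\<forall>ws\<in>args 1 (tangent_space A n). multilinear 1 (tangent_space A m) (\<lambda>vs. \<eta> (m, n) vs ws) \<and>
           alternating 1 (tangent_space A m) (\<lambda>vs. \<eta> (m, n) vs ws)) \<and>
        (\<forall>vs\<in>args 1 (tangent_space A m). multilinear 1 (tangent_space A n) (\<eta> (m, n) vs) \<and>
           alternating 1 (tangent_space A n) (\<eta> (m, n) vs))"
    proof (intro ballI, clarify, intro conjI ballI)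
      fix m n ws assume "ws \<in> args 1 (tangent_space A n)"
      then obtain w where w: "w \<in> tangent_space A n" "ws = [w]" unfolding args1 by blast
      show "multilinear 1 (tangent_space A m) (\<lambda>vs. \<eta> (m, n) vs ws)"
        by (auto simp: multilinear_def args1' w(2) \<eta> lincomb_tangent w(1)) (simp add: lincomb_def)
      show "alternating 1 (tangent_space A m) (\<lambda>vs. \<eta> (m, n) vs ws)" by (simp add: alternating_def)
    next
      fix m n vs assume "vs \<in> args 1 (tangent_space A m)"
      then obtain v where v: "v \<in> tangent_space A m" "vs = [v]" unfolding args1 by blast
      have "v (\<lambda>x. lincomb a u b w (\<lambda>y. f (x, y))) = a * v (\<lambda>x. u (\<lambda>y. f (x, y))) + b * v (\<lambda>x. w (\<lambda>y. f (x, y)))"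
        if "u \<in> tangent_space A n" "w \<in> tangent_space A n" for a b u w
        unfolding lincomb_def
        by (rule tangent_lin[OF v(1) smooth_tangent_right[OF that(1) sm] smooth_tangent_right[OF that(2) sm]])
      then show "multilinear 1 (tangent_space A n) (\<eta> (m, n) vs)"
        by (auto simp: multilinear_def args1' v(2) \<eta> lincomb_tangent v(1))
      show "alternating 1 (tangent_space A n) (\<eta> (m, n) vs)" by (simp add: alternating_def)
    qed
    fix Xs Ys assume "length Xs = 1 \<and> set Xs \<subseteq> vector_fields A \<and> length Ys = 1 \<and> set Ys \<subseteq> vector_fields A"
    then obtain X Y where "Xs = [X]" "Ys = [Y]" "X \<in> vector_fields A" "Y \<in> vector_fields A"
      by (auto simp: length_Suc_conv)
    then show "smooth_fun (prod_atlas A A) UNIV (biform_eval \<eta> Xs Ys)"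
      by (simp add: smooth_manifold.smooth_fun_iff[OF prod_manifold] s\<eta>)
  qed simp
  moreover have \<eta>\<omega>: "\<eta> (m, m) [v] [w] = \<beta> (m, m) v w" if "v \<in> tangent_space A m" "w \<in> tangent_space A m" for m v w
    using osc[of m] \<eta>[OF that] that by (simp add: osculates_def)
  have eq: "cotensor_eq A 2 (induced_metric \<eta>) (induced_metric \<omega>)"
    unfolding cotensor_eq_def
  proof (intro allI ballI)
    fix m vs assume "vs \<in> args 2 (tangent_space A m)"
    then obtain v w where "vs = [v, w]" "v \<in> tangent_space A m" "w \<in> tangent_space A m"
      by (auto simp: args_def numeral_2_eq_2 length_Suc_conv)
    then show "induced_metric \<eta> m vs = induced_metric \<omega> m vs" using \<eta>\<omega> by (simp add: diag_pullback_def)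
  qed
  moreover have "contrast_biform A UNIV \<eta>"
    unfolding contrast_biform_def using calculation pseudo_riemannian_cong[OF eq metric] by simp
  moreover have "connection_eq A (induced_connection A \<eta>) (induced_connection A \<omega>)"
    unfolding connection_eq_def
  proof (intro ballI)
    fix Z X assume Z: "Z \<in> vector_fields A" and X: "X \<in> vector_fields A"
    have l: "lie_deriv (left_lift A Z) (biform_eval \<eta> [X] [Y]) (m, m)
        = lie_deriv (left_lift A Z) (biform_eval \<omega> [X] [Y]) (m, m)" if Y: "Y \<in> vector_fields A" for Y m
    proof -
      have "lie_deriv (left_lift A Z) (biform_eval \<eta> [X] [Y]) (m, m) = Z m (\<lambda>x. X x (\<lambda>x'. Y m (\<lambda>y. f (x', y))))"
        using lie_deriv_left_lift[where m = m and n = m and X = Z, OF s\<eta>[OF X Y]] \<eta>[OF field_tangent[OF X] field_tangent[OF Y]]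
        by (simp add: biform_eval_def)
      also have "\<dots> = dL Z X m (Y m)" using osc[of m] Z X field_tangent[OF Y, of m] by (simp add: osculates_def)
      finally show ?thesis by (simp add: lie_deriv_\<beta>[OF X Y])
    qed
    \<comment> \<open>The two definite descriptions have equivalent defining properties, so the
      connections agree as terms, with no appeal to existence or uniqueness.\<close>
    have "(V \<in> vector_fields A \<and> (\<forall>Y\<in>vector_fields A. \<forall>m. induced_metric \<eta> m [V m, Y m] =
          lie_deriv (left_lift A Z) (biform_eval \<eta> [X] [Y]) (m, m))) \<longleftrightarrow>
        (V \<in> vector_fields A \<and> (\<forall>Y\<in>vector_fields A. \<forall>m. induced_metric \<omega> m [V m, Y m] =
          lie_deriv (left_lift A Z) (biform_eval \<omega> [X] [Y]) (m, m)))" for V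
      by (rule conj_cong[OF refl]) (simp add: l diag_pullback_def \<eta>\<omega> field_tangent)
    then show "induced_connection A \<eta> Z X = induced_connection A \<omega> Z X"
      unfolding induced_connection_def by simp
  qed
  moreover have "cotensor_eq A 1 (diag_pullback 1 (left_diff A F)) (\<lambda>m vs. 0)"
    using osc left_diff_10[where F = F, OF smF]
    by (auto simp: cotensor_eq_def args1' diag_pullback_def osculates_def F_def)
  moreover have "cotensor_eq A 1 (diag_pullback 0 (right_diff A F)) (\<lambda>m vs. 0)"
    using osc right_diff_01[where F = F, OF smF]
    by (auto simp: cotensor_eq_def args1' diag_pullback_def osculates_def F_def)
  moreover have "cotensor_eq A 0 (diag_pullback 0 F) (\<lambda>m vs. 0)"
    using osc by (auto simp: cotensor_eq_def diag_pullback_def osculates_def F_def)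
  ultimately show ?thesis using F unfolding \<eta>_def by blast
qed

end

context smooth_manifold
begin

section \<open>Second derivatives along two fields\<close>

lemma field_field_mult:
  assumes Z: "Z \<in> vector_fields A" and X: "X \<in> vector_fields A" and f: "smooth_at A m f" and g: "smooth_at A m g"
  shows "Z m (\<lambda>x. X x (\<lambda>y. f y * g y)) =
    Z m (\<lambda>x. X x f) * g m + X m f * Z m g + Z m f * X m g + f m * Z m (\<lambda>x. X x g)"
proof -
  note Zt = field_tangent[OF Z] and Xf = field_smooth_at[OF X f] and Xg = field_smooth_at[OF X g]
  have "Z m (\<lambda>x. X x (\<lambda>y. f y * g y)) = Z m (\<lambda>x. X x f * g x + f x * X x g)"
  proof (rule tangent_cong[OF Zt field_smooth_at[OF X smooth_at_mult[OF f g]]])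
    show "smooth_at A m (\<lambda>x. X x f * g x + f x * X x g)" by (intro smooth_at_add smooth_at_mult Xf Xg f g)
    show "\<forall>\<^sub>F x in nhds m. X x (\<lambda>y. f y * g y) = X x f * g x + f x * X x g"
      using eventually_smooth_at[OF f] eventually_smooth_at[OF g]
      by eventually_elim (rule tangent_mult[OF field_tangent[OF X]])
  qed
  also have "\<dots> = Z m (\<lambda>x. X x f * g x) + Z m (\<lambda>x. f x * X x g)"
    by (rule tangent_add[OF Zt smooth_at_mult[OF Xf g] smooth_at_mult[OF f Xg]])
  finally show ?thesis
    using tangent_mult[OF Zt Xf g] tangent_mult[OF Zt f Xg] by simp
qed

lemma field_field_cong:
  assumes Z: "Z \<in> vector_fields A" and X: "X \<in> vector_fields A" and f: "smooth_at A m f"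
    and eq: "\<forall>\<^sub>F x in nhds m. f x = g x"
  shows "Z m (\<lambda>x. X x f) = Z m (\<lambda>x. X x g)"
proof -
  have g: "smooth_at A m g" by (rule smooth_at_cong[OF f eq])
  have "\<forall>\<^sub>F x in nhds m. \<forall>\<^sub>F y in nhds x. f y = g y" using eq by (simp add: eventually_eventually)
  then have "\<forall>\<^sub>F x in nhds m. X x f = X x g"
    using eventually_smooth_at[OF f] eventually_smooth_at[OF g]
    by eventually_elim (rule tangent_cong[OF field_tangent[OF X]])
  then show ?thesis by (rule tangent_cong[OF field_tangent[OF Z] field_smooth_at[OF X f] field_smooth_at[OF X g]])
qed

lemma field_field_lin:
  assumes Z: "Z \<in> vector_fields A" and X: "X \<in> vector_fields A" and f: "smooth_at A m f" and g: "smooth_at A m g"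
  shows "Z m (\<lambda>x. X x (\<lambda>y. a * f y + b * g y)) = a * Z m (\<lambda>x. X x f) + b * Z m (\<lambda>x. X x g)"
proof -
  note Xf = field_smooth_at[OF X f] and Xg = field_smooth_at[OF X g]
  have "Z m (\<lambda>x. X x (\<lambda>y. a * f y + b * g y)) = Z m (\<lambda>x. a * X x f + b * X x g)"
  proof (rule tangent_cong[OF field_tangent[OF Z]])
    show "smooth_at A m (\<lambda>x. X x (\<lambda>y. a * f y + b * g y))"
      by (intro field_smooth_at[OF X] smooth_at_add smooth_at_mult smooth_at_const f g)
    show "smooth_at A m (\<lambda>x. a * X x f + b * X x g)"
      by (intro smooth_at_add smooth_at_mult smooth_at_const Xf Xg)
    show "\<forall>\<^sub>F x in nhds m. X x (\<lambda>y. a * f y + b * g y) = a * X x f + b * X x g"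
      using eventually_smooth_at[OF f] eventually_smooth_at[OF g]
      by eventually_elim (rule tangent_lin[OF field_tangent[OF X]])
  qed
  also have "\<dots> = a * Z m (\<lambda>x. X x f) + b * Z m (\<lambda>x. X x g)"
    by (rule tangent_lin[OF field_tangent[OF Z] Xf Xg])
  finally show ?thesis .
qed

lemma field_field_const:
  assumes Z: "Z \<in> vector_fields A" and X: "X \<in> vector_fields A"
  shows "Z m (\<lambda>x. X x (\<lambda>_. c)) = 0"
  using tangent_const[OF field_tangent[OF X]] tangent_const[OF field_tangent[OF Z]] by simp

lemma field_field_sum:
  assumes Z: "Z \<in> vector_fields A" and X: "X \<in> vector_fields A" and f: "\<And>i. i \<in> I \<Longrightarrow> smooth_at A m (f i)"
  shows "Z m (\<lambda>x. X x (\<lambda>y. \<Sum>i\<in>I. f i y)) = (\<Sum>i\<in>I. Z m (\<lambda>x. X x (f i)))"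
  using f
proof (induction I rule: infinite_finite_induct)
  case (insert i I)
  have "Z m (\<lambda>x. X x (\<lambda>y. 1 * f i y + 1 * (\<Sum>i\<in>I. f i y)))
      = 1 * Z m (\<lambda>x. X x (f i)) + 1 * Z m (\<lambda>x. X x (\<lambda>y. \<Sum>i\<in>I. f i y))"
    by (rule field_field_lin[OF Z X]) (use insert in \<open>auto intro: smooth_at_sum\<close>)
  then show ?case using insert by simp
qed (simp_all add: field_field_const[OF Z X])

text \<open>The shape of \<open>w (\<lambda>y. P (x, y) * (a y - a x) * (b y - b x))\<close> as a function of \<open>x\<close>.\<close>

lemma quadratic_term_derivs:
  fixes a b :: real
  assumes s: "smooth_at A m q" "smooth_at A m r" "smooth_at A m d" "smooth_at A m e"
    and 0: "d m = 0" "e m = 0"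
  defines "K \<equiv> \<lambda>x. q x * (d x * e x) + r x * (a * e x + b * d x)"
  shows "smooth_at A m K" and "v \<in> tangent_space A m \<Longrightarrow> v K = r m * (a * v e + b * v d)"
    and "Z \<in> vector_fields A \<Longrightarrow> X \<in> vector_fields A \<Longrightarrow> Z m (\<lambda>x. X x K) =
      q m * (X m d * Z m e + Z m d * X m e) + X m r * (a * Z m e + b * Z m d) + Z m r * (a * X m e + b * X m d)
        + r m * (a * Z m (\<lambda>x. X x e) + b * Z m (\<lambda>x. X x d))"
proof -
  \<comment> \<open>The term is split by its order of vanishing at m: k is linear and l quadratic in
    the differences. Thus l contributes only its second derivative, weighted by q, while k also
    meets the first derivatives of r.\<close>
  define k where "k = (\<lambda>x. a * e x + b * d x)"
  define l where "l = (\<lambda>x. d x * e x)"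
  have k: "smooth_at A m k" unfolding k_def by (intro smooth_at_add smooth_at_mult smooth_at_const s)
  have l: "smooth_at A m l" unfolding l_def by (intro smooth_at_mult s)
  have K: "K = (\<lambda>x. 1 * (q x * l x) + 1 * (r x * k x))" by (simp add: K_def k_def l_def)
  have ql: "smooth_at A m (\<lambda>x. q x * l x)" and rk: "smooth_at A m (\<lambda>x. r x * k x)"
    by (intro smooth_at_mult s k l)+
  have kl0: "k m = 0" "l m = 0" using 0 by (simp_all add: k_def l_def)
  show "smooth_at A m K" unfolding K by (intro smooth_at_add smooth_at_mult smooth_at_const ql rk)
  have vk: "v k = a * v e + b * v d" and vl: "v l = 0" if v: "v \<in> tangent_space A m" for v
    using tangent_lin[OF v s(4,3)] tangent_mult[OF v s(3,4)] 0 by (simp_all add: k_def l_def)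
  show "v K = r m * (a * v e + b * v d)" if v: "v \<in> tangent_space A m"
    unfolding K tangent_lin[OF v ql rk] tangent_mult[OF v s(1) l] tangent_mult[OF v s(2) k]
    by (simp add: kl0 vk[OF v] vl[OF v])
  show "Z m (\<lambda>x. X x K) =
      q m * (X m d * Z m e + Z m d * X m e) + X m r * (a * Z m e + b * Z m d) + Z m r * (a * X m e + b * X m d)
        + r m * (a * Z m (\<lambda>x. X x e) + b * Z m (\<lambda>x. X x d))"
    if Z: "Z \<in> vector_fields A" and X: "X \<in> vector_fields A"
  proof -
    note t = field_tangent[OF Z, of m] field_tangent[OF X, of m]
    have "Z m (\<lambda>x. X x l) = X m d * Z m e + Z m d * X m e"
      using field_field_mult[OF Z X s(3,4)] 0 by (simp add: l_def)
    moreover have "Z m (\<lambda>x. X x k) = a * Z m (\<lambda>x. X x e) + b * Z m (\<lambda>x. X x d)"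
      unfolding k_def by (rule field_field_lin[OF Z X s(4,3)])
    ultimately show ?thesis
      unfolding K field_field_lin[OF Z X ql rk] field_field_mult[OF Z X s(1) l] field_field_mult[OF Z X s(2) k]
      by (simp add: kl0 vk[OF t(1)] vk[OF t(2)] vl[OF t(1)] vl[OF t(2)])
  qed
qed

end

section \<open>Contractions of coefficient arrays with two and three indices\<close>

definition bil :: "'i set \<Rightarrow> ('i \<Rightarrow> 'i \<Rightarrow> real) \<Rightarrow> ('i \<Rightarrow> real) \<Rightarrow> ('i \<Rightarrow> real) \<Rightarrow> real" where
  "bil I C y z = (\<Sum>i\<in>I. \<Sum>j\<in>I. C i j * (y i * z j))"

definition tri :: "'i set \<Rightarrow> ('i \<Rightarrow> 'i \<Rightarrow> 'i \<Rightarrow> real) \<Rightarrow> ('i \<Rightarrow> real) \<Rightarrow> ('i \<Rightarrow> real) \<Rightarrow> ('i \<Rightarrow> real) \<Rightarrow> real" where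
  "tri I C x y z = (\<Sum>k\<in>I. \<Sum>i\<in>I. \<Sum>j\<in>I. C k i j * (x k * (y i * z j)))"

lemma bil_sym: "bil I C y z = bil I (\<lambda>i j. C j i) z y"
  unfolding bil_def by (subst sum.swap) (simp add: mult_ac)

lemma bil_cong: "(\<And>i j. i \<in> I \<Longrightarrow> j \<in> I \<Longrightarrow> C i j = D i j) \<Longrightarrow> bil I C y z = bil I D y z"
  unfolding bil_def by (intro sum.cong refl) simp

lemma bil_contract: "bil I (\<lambda>i j. \<Sum>k\<in>I. x k * C k i j) y z = tri I C x y z"
proof -
  have "tri I C x y z = (\<Sum>i\<in>I. \<Sum>k\<in>I. \<Sum>j\<in>I. C k i j * (x k * (y i * z j)))"
    unfolding tri_def by (rule sum.swap)
  also have "\<dots> = (\<Sum>i\<in>I. \<Sum>j\<in>I. \<Sum>k\<in>I. C k i j * (x k * (y i * z j)))"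
    by (rule sum.cong[OF refl], rule sum.swap)
  finally show ?thesis by (simp add: bil_def sum_distrib_right sum_distrib_left mult_ac)
qed

lemma tri_swap12: "tri I C x y z = tri I (\<lambda>k i j. C i k j) y x z"
  unfolding tri_def by (subst sum.swap) (simp add: mult_ac)

lemma tri_swap23: "tri I C x y z = tri I (\<lambda>k i j. C k j i) x z y"
proof -
  have "(\<Sum>i\<in>I. \<Sum>j\<in>I. C k i j * (x k * (y i * z j))) = (\<Sum>i\<in>I. \<Sum>j\<in>I. C k j i * (x k * (z i * y j)))" for k
    by (subst sum.swap) (simp add: mult_ac)
  then show ?thesis by (simp add: tri_def)
qed

lemma tri_swap13: "tri I C x y z = tri I (\<lambda>k i j. C j i k) z y x"
  using tri_swap12[of I C x y z] tri_swap23[of I "\<lambda>k i j. C i k j" y x z]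
    tri_swap12[of I "\<lambda>k i j. C j k i" y z x] by simp

lemma tri_cong:
  "(\<And>k i j. k \<in> I \<Longrightarrow> i \<in> I \<Longrightarrow> j \<in> I \<Longrightarrow> C k i j = D k i j) \<Longrightarrow> tri I C x y z = tri I D x y z"
  unfolding tri_def by (intro sum.cong refl) simp

lemma tri_add: "tri I (\<lambda>k i j. C k i j + D k i j) x y z = tri I C x y z + tri I D x y z"
  by (simp add: tri_def sum.distrib distrib_right)

text \<open>Fix x, z, w. By the first symmetry a value of A depends only on the vector in its last
  slot, by the second a value of B only on the vector in its middle slot; call these A_s and B_s.
  The third says that A_s - B_s is the same number c for s = x, z, w: the totally symmetric cubic
  form of a statistical structure. With weights a, b in place of 1/3, 1/6, the left side without its
  g terms is (2a + 2b) A_w + (2a - 4b) c. To obtain A_w whatever c is, one needs a + b = 1/2 and a =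
  2b, which gives exactly these constants.\<close>

lemma tri_combination:
  assumes A: "\<And>x y z. tri I A x y z = tri I A y x z" and B: "\<And>x y z. tri I B x y z = tri I B z y x"
    and AB: "\<And>x y z. tri I A x y z + tri I B x y z = tri I A x z y + tri I B x z y"
    and g: "\<And>y z. bil I g y z = bil I g z y"
  defines "p \<equiv> \<lambda>x i j. - (1/3) * (\<Sum>k\<in>I. x k * A k i j) - (1/6) * (\<Sum>k\<in>I. x k * B k i j)"
    and "q \<equiv> \<lambda>x i j. - (1/3) * (\<Sum>k\<in>I. x k * B k i j) - (1/6) * (\<Sum>k\<in>I. x k * A k i j)"
  shows "(\<Sum>i\<in>I. \<Sum>j\<in>I. q w i j * (x i * z j + z i * x j) - p x i j * (w i * z j + w j * z i)
      - p z i j * (w i * x j + w j * x i) + (1/2) * g i j * (w i * d j + w j * d i))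
    = tri I A z x w + bil I g d w"
proof -
  have sp: "bil I (p a) y v = - (1/3) * tri I A a y v - (1/6) * tri I B a y v" for a y v
    unfolding bil_contract[symmetric] p_def
    by (simp add: bil_def sum.distrib sum_subtractf sum_negf sum_distrib_left algebra_simps)
  have sq: "bil I (q a) y v = - (1/3) * tri I B a y v - (1/6) * tri I A a y v" for a y v
    unfolding bil_contract[symmetric] q_def
    by (simp add: bil_def sum.distrib sum_subtractf sum_negf sum_distrib_left algebra_simps)
  have "(\<Sum>i\<in>I. \<Sum>j\<in>I. q w i j * (x i * z j + z i * x j) - p x i j * (w i * z j + w j * z i)
      - p z i j * (w i * x j + w j * x i) + (1/2) * g i j * (w i * d j + w j * d i))
    = bil I (q w) x z + bil I (q w) z x - bil I (p x) w z - bil I (p x) z w - bil I (p z) w x - bil I (p z) x w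
      + (1/2) * (bil I g w d + bil I g d w)"
    unfolding bil_def by (simp add: sum.distrib sum_subtractf sum_distrib_left algebra_simps)
  also have "\<dots> = tri I A z x w + bil I g d w"
    unfolding sp sq
    using A[of w x z] A[of w z x] A[of x z w] B[of w x z] B[of w z x] B[of x w z]
      AB[of w x z] AB[of x w z] AB[of z w x] g[of w d] by argo
  finally show ?thesis .
qed

context contrast
begin

lemma osculatesI:
  assumes "F (m, m) = 0"
    and "\<And>v. v \<in> tangent_space A m \<Longrightarrow> v (\<lambda>x. F (x, m)) = 0"
    and "\<And>w. w \<in> tangent_space A m \<Longrightarrow> w (\<lambda>y. F (m, y)) = 0"
    and "\<And>v w. v \<in> tangent_space A m \<Longrightarrow> w \<in> tangent_space A m \<Longrightarrow> v (\<lambda>x. w (\<lambda>y. F (x, y))) = \<beta> (m, m) v w"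
    and "\<And>Z X w. Z \<in> vector_fields A \<Longrightarrow> X \<in> vector_fields A \<Longrightarrow> w \<in> tangent_space A m \<Longrightarrow>
      Z m (\<lambda>x. X x (\<lambda>x'. w (\<lambda>y. F (x', y)))) = dL Z X m w"
  shows "osculates F m"
  using assms by (simp add: osculates_def)

text \<open>In coordinates \<open>u\<close> near the diagonal, the potential is
  \<open>- \<Sum>i j. (2/3 \<omega>\<^sub>i\<^sub>j(x, y) + 1/3 \<omega>\<^sub>i\<^sub>j(y, x)) (u\<^sub>i(y) - u\<^sub>i(x)) (u\<^sub>j(y) - u\<^sub>j(x)) / 2\<close>. Taking the
  coefficients at \<open>(x, x)\<close> instead would give the metric too; it is the weights 2/3 and 1/3 that also make
  the third derivatives come out right.\<close>

lemma ex_local_potential: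
  assumes tf: "torsion_free A (induced_connection A \<omega>)"
    and tf': "torsion_free A (conjugate_connection A (induced_metric \<omega>) (induced_connection A \<omega>))"
  shows "\<exists>\<rho> P K G. (\<forall>x. smooth_at A x \<rho>) \<and> open P \<and> m0 \<in> P \<and> (\<forall>x\<in>P. \<rho> x = 1) \<and>
    closed K \<and> (\<forall>x. x \<notin> K \<longrightarrow> \<rho> x = 0) \<and> (\<forall>z. smooth2 z G) \<and> (\<forall>m\<in>K. osculates G m)"
proof -
  obtain N1 N2 where N12: "open N1" "open N2" "(m0, m0) \<in> N1 \<times> N2" "N1 \<times> N2 \<subseteq> W"
    using open_prod_elim[OF open_W diag_mem] by metis
  define N where "N = N1 \<inter> N2"
  have N: "open N" "m0 \<in> N" "N \<times> N \<subseteq> W" using N12 by (auto simp: N_def)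
  obtain P K and E :: "'e \<Rightarrow> 'a field" and u where F: "open P" "m0 \<in> P" "closed K" "K \<subseteq> N"
    "\<And>b. E b \<in> vector_fields A" "\<And>b x. x \<notin> K \<Longrightarrow> E b x = (\<lambda>_. 0)" "\<And>b x. smooth_at A x (u b)"
    "\<And>x v f. x \<in> P \<Longrightarrow> v \<in> tangent_space A x \<Longrightarrow> v f = (\<Sum>b\<in>onb. v (u b) * E b x f)"
    "\<And>x b c. x \<in> P \<Longrightarrow> lie_bracket A (E b) (E c) x = (\<lambda>_. 0)"
    by (rule local_frame[OF N(1,2)]) blast
  have Et: "E b x \<in> tangent_space A x" for b x by (rule field_tangent[OF F(5)])
  have expand: "(\<lambda>f. \<Sum>b\<in>onb. v (u b) * E b x f) = v" if "x \<in> P" "v \<in> tangent_space A x" for x v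
    by (rule ext) (rule F(8)[OF that, symmetric])
  obtain U \<phi> where c: "(U, \<phi>) \<in> A" "m0 \<in> U" using ex_chart by blast
  \<comment> \<open>A second, smaller cutoff. The frame identities hold on P only, while patching
    needs osculation on a closed set off which the cutoff vanishes; K' inside P provides
    this.\<close>
  obtain \<rho> P' K' where r: "\<And>x. smooth_at A x \<rho>" "open P'" "m0 \<in> P'" "\<And>x. x \<in> P' \<Longrightarrow> \<rho> x = 1"
    "closed K'" "P' \<subseteq> K'" "K' \<subseteq> P \<inter> U" "\<And>x. x \<notin> K' \<Longrightarrow> \<rho> x = 0"
    by (rule manifold_bump[OF c F(1,2)]) (rule that)
  \<comment> \<open>Off K \<times> K one of the two frame fields vanishes, and K \<times> K lies in
    N \<times> N and hence in W. So the extension by zero is smooth on the whole product, although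
    the bi-form is given on W only.\<close>
  define \<Omega> where "\<Omega> = (\<lambda>i j z. if z \<in> W then \<beta> z (E i (fst z)) (E j (snd z)) else 0)"
  have \<beta>0: "\<beta> (x, y) (\<lambda>_. 0) w = 0" if "(x, y) \<in> W" "w \<in> tangent_space A y" for x y w
    using \<beta>_lin_left[OF that(1) zero_tangent zero_tangent that(2), of 0 0] by (simp add: lincomb_def)
  have \<beta>0': "\<beta> (x, y) v (\<lambda>_. 0) = 0" if "(x, y) \<in> W" "v \<in> tangent_space A x" for x y v
    using \<beta>_lin_right[OF that(1) zero_tangent zero_tangent that(2), of 0 0] by (simp add: lincomb_def)
  have \<Omega>: "smooth2 z (\<Omega> i j)" for z i j
  proof (cases "z \<in> W")
    case True
    show ?thesis
      by (rule smooth2_cong[OF smooth_\<beta>[OF F(5) F(5) True, of i j]],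
          rule eventually_mono[OF eventually_nhds_in_open[OF open_W True]]) (simp add: \<Omega>_def)
  next
    case False
    then have z: "z \<in> - (K \<times> K)" using F(4) N(3) by blast
    have "open (- (K \<times> K))" by (intro open_Compl closed_Times F)
    show ?thesis
    proof (rule smooth2_cong[OF smooth2_const[of _ 0]],
        rule eventually_mono[OF eventually_nhds_in_open[OF \<open>open (- (K \<times> K))\<close> z]])
      fix y assume y: "y \<in> - (K \<times> K)"
      obtain y1 y2 where y12: "y = (y1, y2)" by (cases y)
      show "0 = \<Omega> i j y"
        using y F(6)[of y1] F(6)[of y2] \<beta>0[OF _ Et] \<beta>0'[OF _ Et] by (auto simp: \<Omega>_def y12)
    qed
  qed
  \<comment> \<open>The weights add up to -1/2, which makes the coefficient -g/2 on the diagonal and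
    the mixed second derivative equal to g. Their ratio 2 : 1 is the one required by
    \<open>tri_combination\<close>.\<close>
  define p where "p = (\<lambda>i j z. (- (1/3)) * \<Omega> i j z + (- (1/6)) * \<Omega> i j (snd z, fst z))"
  have p: "smooth2 z (p i j)" for z i j
    unfolding p_def by (intro smooth2_add smooth2_mult smooth2_const \<Omega> smooth2_swap)
  define Q where "Q = (\<lambda>i j z. p i j z * ((u i (snd z) - u i (fst z)) * (u j (snd z) - u j (fst z))))"
  have Q: "smooth2 z (Q i j)" for z i j
    unfolding Q_def by (intro smooth2_mult smooth2_diff p smooth2_fst smooth2_snd F(7))
  define G where "G = (\<lambda>z. \<Sum>i\<in>onb. \<Sum>j\<in>onb. Q i j z)"
  have G: "smooth2 z G" for z unfolding G_def by (intro smooth2_sum Q)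
  have "osculates G m" if "m \<in> K'" for m
  proof -
    have mP: "m \<in> P" using that r(7) by blast
    define L where "L = (\<lambda>(v :: 'a tangent) i j. v (\<lambda>x. \<beta> (x, m) (E i x) (E j m)))"
    define R where "R = (\<lambda>(v :: 'a tangent) i j. v (\<lambda>y. \<beta> (m, y) (E i m) (E j y)))"
    define g where "g = (\<lambda>i j. \<beta> (m, m) (E i m) (E j m))"
    \<comment> \<open>Lowered Christoffel symbols in the frame: \<open>aA k i j\<close> is
      g(\<nabla>_k E_i, E_j), and \<open>bB k i j\<close> below is g(E_i, \<nabla>'_k E_j) for the
      conjugate connection \<nabla>'.\<close>
    define aA where "aA = (\<lambda>k i j. dL (E k) (E i) m (E j m))"
    define bB where "bB = (\<lambda>k i j. dR (E k) (E j) m (E i m))"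
    note sL = smooth_\<beta>_left[OF F(5) Et diag_mem, of m] and sR = smooth_\<beta>_right[OF F(5) Et diag_mem, of m]
    have L: "L v i j = (\<Sum>k\<in>onb. v (u k) * aA k i j)" if "v \<in> tangent_space A m" for v i j
      unfolding L_def aA_def dL_def by (rule F(8)[OF mP that])
    have R: "R v i j = (\<Sum>k\<in>onb. v (u k) * bB k i j)" if "v \<in> tangent_space A m" for v i j
      unfolding R_def bB_def dR_def by (rule F(8)[OF mP that])
    \<comment> \<open>The frame fields commute at m, so torsion-freeness is a plain symmetry of the
      symbols.\<close>
    have A12: "aA k i j = aA i k j" for k i j
      using tf F(5) Et F(9)[OF mP] \<beta>0[OF diag_mem Et]
      unfolding torsion_free_induced_iff aA_def by (metis eq_iff_diff_eq_0)
    have B13: "bB k i j = bB j i k" for k i j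
      using tf' F(5) Et F(9)[OF mP] \<beta>0'[OF diag_mem Et]
      unfolding torsion_free_conjugate_iff bB_def by (metis eq_iff_diff_eq_0)
    have AB23: "aA k i j + bB k i j = aA k j i + bB k j i" for k i j
    proof -
      have "(\<lambda>x. \<beta> (x, x) (E i x) (E j x)) = (\<lambda>x. \<beta> (x, x) (E j x) (E i x))"
        by (rule ext) (rule \<beta>_sym[OF Et Et])
      then show ?thesis
        using metric_derivative[OF F(5)[of k] F(5)[of i] F(5)[of j], of m]
          metric_derivative[OF F(5)[of k] F(5)[of j] F(5)[of i], of m] by (simp add: aA_def bB_def)
    qed
    have pL: "v (\<lambda>x. p i j (x, m)) = - (1/3) * L v i j - (1/6) * R v i j" if v: "v \<in> tangent_space A m" for v i j
    proof -
      have "v (\<lambda>x. p i j (x, m)) = v (\<lambda>x. (- (1/3)) * \<beta> (x, m) (E i x) (E j m) + (- (1/6)) * \<beta> (m, x) (E i m) (E j x))"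
      proof (rule tangent_cong[OF v smooth_slice_left[OF p]])
        show "smooth_at A m (\<lambda>x. (- (1/3)) * \<beta> (x, m) (E i x) (E j m) + (- (1/6)) * \<beta> (m, x) (E i m) (E j x))"
          by (intro smooth_at_add smooth_at_mult smooth_at_const sL sR)
        show "\<forall>\<^sub>F x in nhds m. p i j (x, m) = (- (1/3)) * \<beta> (x, m) (E i x) (E j m) + (- (1/6)) * \<beta> (m, x) (E i m) (E j x)"
          using eventually_W_left[OF diag_mem] eventually_W_right[OF diag_mem]
          by eventually_elim (simp add: p_def \<Omega>_def)
      qed
      also have "\<dots> = (- (1/3)) * L v i j + (- (1/6)) * R v i j"
        unfolding L_def R_def by (rule tangent_lin[OF v sL sR])
      finally show ?thesis by simp
    qed
    have pR: "v (\<lambda>y. p i j (m, y)) = - (1/3) * R v i j - (1/6) * L v i j" if v: "v \<in> tangent_space A m" for v i j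
    proof -
      have "v (\<lambda>y. p i j (m, y)) = v (\<lambda>y. (- (1/3)) * \<beta> (m, y) (E i m) (E j y) + (- (1/6)) * \<beta> (y, m) (E i y) (E j m))"
      proof (rule tangent_cong[OF v smooth_slice_right[OF p]])
        show "smooth_at A m (\<lambda>y. (- (1/3)) * \<beta> (m, y) (E i m) (E j y) + (- (1/6)) * \<beta> (y, m) (E i y) (E j m))"
          by (intro smooth_at_add smooth_at_mult smooth_at_const sL sR)
        show "\<forall>\<^sub>F y in nhds m. p i j (m, y) = (- (1/3)) * \<beta> (m, y) (E i m) (E j y) + (- (1/6)) * \<beta> (y, m) (E i y) (E j m)"
          using eventually_W_left[OF diag_mem] eventually_W_right[OF diag_mem]
          by eventually_elim (simp add: p_def \<Omega>_def)
      qed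
      also have "\<dots> = (- (1/3)) * R v i j + (- (1/6)) * L v i j"
        unfolding L_def R_def by (rule tangent_lin[OF v sR sL])
      finally show ?thesis by simp
    qed
    have pm: "p i j (m, m) = - (1/2) * g i j" for i j
      using diag_mem[of m] by (simp add: p_def \<Omega>_def g_def)
    \<comment> \<open>The right point rests at m and the left one moves, so the derivatives of
      \<open>d i\<close> are those of \<open>u i\<close> with opposite sign. This is where the minus
      signs in \<open>tri_combination\<close> come from.\<close>
    define d where "d = (\<lambda>i x. u i m - u i x)"
    have d: "smooth_at A m (d i)" "d i m = 0" for i
      unfolding d_def by (intro smooth_at_diff smooth_at_const F(7)) simp
    have vd: "v (d i) = - v (u i)" if "v \<in> tangent_space A m" for v i
      unfolding d_def using tangent_diff[OF that smooth_at_const F(7)] tangent_const[OF that] by simp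
    \<comment> \<open>The outcome of letting w differentiate \<open>Q i j\<close> in the right
      variable: either the coefficient or one of the two differences is hit.\<close>
    define K where "K = (\<lambda>(w :: 'a tangent) i j x. w (\<lambda>y. p i j (x, y)) * (d i x * d j x) + p i j (x, m) * (w (u i) * d j x + w (u j) * d i x))"
    have wQ: "w (\<lambda>y. Q i j (x, y)) = K w i j x" if w: "w \<in> tangent_space A m" for w i j x
    proof -
      have s: "smooth_at A m (\<lambda>y. u i y - u i x)" for i by (intro smooth_at_diff smooth_at_const F(7))
      have wu: "w (\<lambda>y. u i y - u i x) = w (u i)" for i
        using tangent_diff[OF w F(7) smooth_at_const] tangent_const[OF w] by simp
      show ?thesis
        unfolding Q_def fst_conv snd_conv tangent_mult[OF w smooth_slice_right[OF p] smooth_at_mult[OF s s]]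
          tangent_mult[OF w s s] wu K_def d_def by simp
    qed
    have wG: "(\<lambda>x. w (\<lambda>y. G (x, y))) = (\<lambda>x. \<Sum>i\<in>onb. \<Sum>j\<in>onb. K w i j x)" if w: "w \<in> tangent_space A m" for w
    proof
      fix x
      have "w (\<lambda>y. G (x, y)) = (\<Sum>i\<in>onb. \<Sum>j\<in>onb. w (\<lambda>y. Q i j (x, y)))"
        unfolding G_def by (simp add: tangent_sum[OF w] smooth_at_sum smooth_slice_right[OF Q])
      then show "w (\<lambda>y. G (x, y)) = (\<Sum>i\<in>onb. \<Sum>j\<in>onb. K w i j x)" by (simp add: wQ[OF w])
    qed
    note Kd = quadratic_term_derivs[OF smooth_tangent_right[OF _ p] smooth_slice_left[OF p] d(1) d(1) d(2) d(2)]
    have sK: "smooth_at A m (K w i j)" if "w \<in> tangent_space A m" for w i j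
      using Kd(1)[OF that] by (simp add: K_def)
    show ?thesis
    proof (rule osculatesI)
      show "G (m, m) = 0" by (simp add: G_def Q_def)
      show "w (\<lambda>y. G (m, y)) = 0" if w: "w \<in> tangent_space A m" for w
        using fun_cong[OF wG[OF w], of m] d(2) by (simp add: K_def)
      show "v (\<lambda>x. G (x, m)) = 0" if v: "v \<in> tangent_space A m" for v
      proof -
        have "v (\<lambda>x. Q i j (x, m)) = 0" for i j
          using tangent_mult[OF v smooth_slice_left[OF p] smooth_at_mult[OF d(1) d(1)], of i j m i j]
            tangent_mult[OF v d(1) d(1), of i j] d(2) by (simp add: Q_def d_def)
        then show ?thesis
          unfolding G_def by (simp add: tangent_sum[OF v] smooth_at_sum smooth_slice_left[OF Q])
      qed
      have wexp: "\<beta> (x, m) v w = (\<Sum>j\<in>onb. w (u j) * \<beta> (x, m) v (E j m))"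
        if "(x, m) \<in> W" "v \<in> tangent_space A x" "w \<in> tangent_space A m" for x v w
        using \<beta>_sum_right[where v = "\<lambda>b. E b m" and c = "\<lambda>b. w (u b)", OF that(1,2) finite_onb Et]
        by (simp add: expand[OF mP that(3)])
      have vexp: "\<beta> (x, m) v w = (\<Sum>i\<in>onb. v (u i) * \<beta> (x, m) (E i x) w)"
        if "(x, m) \<in> W" "x \<in> P" "v \<in> tangent_space A x" "w \<in> tangent_space A m" for x v w
        using \<beta>_sum_left[where v = "\<lambda>b. E b x" and c = "\<lambda>b. v (u b)", OF that(1,4) finite_onb Et]
        by (simp add: expand[OF that(2,3)])
      have \<beta>bil: "\<beta> (m, m) v w = bil onb g (\<lambda>i. v (u i)) (\<lambda>j. w (u j))"
        if "v \<in> tangent_space A m" "w \<in> tangent_space A m" for v w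
        unfolding vexp[OF diag_mem mP that] wexp[OF diag_mem Et that(2)] bil_def g_def
        by (simp add: sum_distrib_left mult_ac)
      have gsym: "g i j = g j i" for i j unfolding g_def by (rule \<beta>_sym[OF Et Et])
      have bgsym: "bil onb g y z = bil onb g z y" for y z
        using bil_sym[of onb g y z] gsym by simp
      show "v (\<lambda>x. w (\<lambda>y. G (x, y))) = \<beta> (m, m) v w"
        if v: "v \<in> tangent_space A m" and w: "w \<in> tangent_space A m" for v w
      proof -
        have "v (\<lambda>x. w (\<lambda>y. G (x, y))) = (\<Sum>i\<in>onb. \<Sum>j\<in>onb. v (K w i j))"
          unfolding wG[OF w] by (simp add: tangent_sum[OF v] smooth_at_sum sK[OF w])
        also have "\<dots> = (\<Sum>i\<in>onb. \<Sum>j\<in>onb. (1/2) * (g i j * (w (u i) * v (u j))) + (1/2) * (g i j * (v (u i) * w (u j))))"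
          unfolding K_def Kd(2)[OF w v] by (simp add: pm vd[OF v] algebra_simps)
        also have "\<dots> = (1/2) * (bil onb g (\<lambda>i. w (u i)) (\<lambda>j. v (u j)) + bil onb g (\<lambda>i. v (u i)) (\<lambda>j. w (u j)))"
          unfolding bil_def by (simp add: sum.distrib sum_distrib_left distrib_left)
        also have "\<dots> = \<beta> (m, m) v w"
          unfolding \<beta>bil[OF v w] using bgsym[of "\<lambda>i. w (u i)" "\<lambda>j. v (u j)"] by simp
        finally show ?thesis .
      qed
      show "Z m (\<lambda>x. X x (\<lambda>x'. w (\<lambda>y. G (x', y)))) = dL Z X m w"
        if Z: "Z \<in> vector_fields A" and X: "X \<in> vector_fields A" and w: "w \<in> tangent_space A m" for Z X w
      proof -
        note Zt = field_tangent[OF Z, of m] and Xt = field_tangent[OF X, of m]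
        \<comment> \<open>The derivative along Z of the i-th component of X. It is the part of the
          covariant derivative that is not captured by Christoffel symbols, and has to come out of
          the potential as well.\<close>
        define D where "D = (\<lambda>i. Z m (\<lambda>x. X x (u i)))"
        have Dd: "Z m (\<lambda>x. X x (d i)) = - D i" for i
          using field_field_lin[OF Z X smooth_at_const F(7), of m 1 "u i m" "-1" i] field_field_const[OF Z X]
          by (simp add: d_def D_def)
        define pp where "pp = (\<lambda>x i j. - (1/3) * (\<Sum>k\<in>onb. x k * aA k i j) - (1/6) * (\<Sum>k\<in>onb. x k * bB k i j))"
        define qq where "qq = (\<lambda>x i j. - (1/3) * (\<Sum>k\<in>onb. x k * bB k i j) - (1/6) * (\<Sum>k\<in>onb. x k * aA k i j))"
        have "Z m (\<lambda>x. X x (\<lambda>x'. w (\<lambda>y. G (x', y)))) = (\<Sum>i\<in>onb. \<Sum>j\<in>onb. Z m (\<lambda>x. X x (K w i j)))"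
          unfolding wG[OF w] by (simp add: field_field_sum[OF Z X] smooth_at_sum sK[OF w])
        also have "\<dots> = (\<Sum>i\<in>onb. \<Sum>j\<in>onb. qq (\<lambda>i. w (u i)) i j * (X m (u i) * Z m (u j) + Z m (u i) * X m (u j))
            - pp (\<lambda>i. X m (u i)) i j * (w (u i) * Z m (u j) + w (u j) * Z m (u i))
            - pp (\<lambda>i. Z m (u i)) i j * (w (u i) * X m (u j) + w (u j) * X m (u i))
            + (1/2) * g i j * (w (u i) * D j + w (u j) * D i))"
        proof (intro sum.cong refl)
          fix i j
          have 1: "w (\<lambda>y. p i j (m, y)) = qq (\<lambda>i. w (u i)) i j"
            unfolding pR[OF w] qq_def L[OF w] R[OF w] ..
          have 2: "v (\<lambda>x. p i j (x, m)) = pp (\<lambda>i. v (u i)) i j" if "v \<in> tangent_space A m" for v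
            unfolding pL[OF that] pp_def L[OF that] R[OF that] ..
          show "Z m (\<lambda>x. X x (K w i j)) = qq (\<lambda>i. w (u i)) i j * (X m (u i) * Z m (u j) + Z m (u i) * X m (u j))
            - pp (\<lambda>i. X m (u i)) i j * (w (u i) * Z m (u j) + w (u j) * Z m (u i))
            - pp (\<lambda>i. Z m (u i)) i j * (w (u i) * X m (u j) + w (u j) * X m (u i))
            + (1/2) * g i j * (w (u i) * D j + w (u j) * D i)"
            unfolding K_def Kd(3)[OF w Z X] 1 2[OF Xt] 2[OF Zt] pm vd[OF Zt] vd[OF Xt] Dd
            by (simp add: algebra_simps)
        qed
        also have "\<dots> = tri onb aA (\<lambda>i. Z m (u i)) (\<lambda>i. X m (u i)) (\<lambda>i. w (u i)) + bil onb g D (\<lambda>i. w (u i))"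
          unfolding pp_def qq_def
        proof (rule tri_combination)
          show "tri onb aA x y z = tri onb aA y x z" for x y z
            using tri_swap12[of onb aA x y z] A12 by simp
          show "tri onb bB x y z = tri onb bB z y x" for x y z
            using tri_swap13[of onb bB x y z] tri_cong[of onb "\<lambda>k i j. bB j i k" bB z y x] B13 by simp
          show "tri onb aA x y z + tri onb bB x y z = tri onb aA x z y + tri onb bB x z y" for x y z
            using tri_swap23[of onb "\<lambda>k i j. aA k i j + bB k i j" x y z]
              tri_cong[of onb "\<lambda>k i j. aA k j i + bB k j i" "\<lambda>k i j. aA k i j + bB k i j" x z y] AB23
            by (simp add: tri_add)
          show "bil onb g y z = bil onb g z y" for y z by (rule bgsym)
        qed
        also have "\<dots> = dL Z X m w"
        proof -
          \<comment> \<open>Writing X in the frame and applying the product rule to components times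
            \<open>B i\<close> separates \<open>dL Z X m w\<close> into the term with D and the term
            with Christoffel symbols.\<close>
          define B where "B = (\<lambda>i x. \<Sum>j\<in>onb. w (u j) * \<beta> (x, m) (E i x) (E j m))"
          have sB: "smooth_at A m (B i)" for i
            unfolding B_def by (intro smooth_at_sum smooth_at_mult smooth_at_const sL)
          have sXu: "smooth_at A m (\<lambda>x. X x (u i))" for i by (rule field_smooth_at[OF X F(7)])
          have ZB: "Z m (B i) = (\<Sum>j\<in>onb. w (u j) * L (Z m) i j)" for i
            unfolding B_def L_def
            by (simp add: tangent_sum[OF Zt] smooth_at_mult smooth_at_const sL tangent_scale[OF Zt])
          have "dL Z X m w = Z m (\<lambda>x. \<Sum>i\<in>onb. X x (u i) * B i x)"
            unfolding dL_def
          proof (rule tangent_cong[OF Zt smooth_\<beta>_left[OF X w diag_mem]])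
            show "smooth_at A m (\<lambda>x. \<Sum>i\<in>onb. X x (u i) * B i x)"
              by (intro smooth_at_sum smooth_at_mult sXu sB)
            show "\<forall>\<^sub>F x in nhds m. \<beta> (x, m) (X x) w = (\<Sum>i\<in>onb. X x (u i) * B i x)"
              using eventually_W_left[OF diag_mem] eventually_nhds_in_open[OF F(1) mP]
            proof eventually_elim
              case (elim x)
              show ?case
                unfolding vexp[OF elim field_tangent[OF X] w] wexp[OF elim(1) Et w] B_def ..
            qed
          qed
          also have "\<dots> = (\<Sum>i\<in>onb. D i * B i m + X m (u i) * Z m (B i))"
            by (simp add: tangent_sum[OF Zt] smooth_at_mult sXu sB tangent_mult[OF Zt sXu sB] D_def)
          also have "\<dots> = bil onb (L (Z m)) (\<lambda>i. X m (u i)) (\<lambda>i. w (u i)) + bil onb g D (\<lambda>i. w (u i))"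
            unfolding ZB by (simp add: bil_def B_def g_def sum.distrib sum_distrib_left mult_ac)
          also have "bil onb (L (Z m)) (\<lambda>i. X m (u i)) (\<lambda>i. w (u i))
              = tri onb aA (\<lambda>i. Z m (u i)) (\<lambda>i. X m (u i)) (\<lambda>i. w (u i))"
            unfolding bil_contract[symmetric] by (rule bil_cong) (rule L[OF Zt])
          finally show ?thesis ..
        qed
        finally show ?thesis .
      qed
    qed
  qed
  then show ?thesis using r G by blast
qed

text \<open>Patching with the partition of unity \<open>\<theta> n = \<rho> n * (\<Prod>k<n. 1 - \<rho> k)\<close>, which needs no paracompactness:
  near a point where \<open>\<rho> k = 1\<close>, all \<open>\<theta> n\<close> with \<open>n > k\<close> vanish.\<close>

lemma ex_potential:
  assumes tf: "torsion_free A (induced_connection A \<omega>)"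
    and tf': "torsion_free A (conjugate_connection A (induced_metric \<omega>) (induced_connection A \<omega>))"
  shows "\<exists>f. (\<forall>z. smooth2 z f) \<and> (\<forall>m. osculates f m)"
proof -
  have "\<forall>m0. \<exists>\<rho> P K G. (\<forall>x. smooth_at A x \<rho>) \<and> open P \<and> m0 \<in> P \<and> (\<forall>x\<in>P. \<rho> x = 1) \<and>
      closed K \<and> (\<forall>x. x \<notin> K \<longrightarrow> \<rho> x = 0) \<and> (\<forall>z. smooth2 z G) \<and> (\<forall>m\<in>K. osculates G m)"
    using ex_local_potential[OF tf tf'] by blast
  then obtain \<rho>0 P0 K0 G0 where loc: "\<And>c x. smooth_at A x (\<rho>0 c)" "\<And>c. open (P0 c)" "\<And>c. c \<in> P0 c"
    "\<And>c x. x \<in> P0 c \<Longrightarrow> \<rho>0 c x = 1" "\<And>c. closed (K0 c)" "\<And>c x. x \<notin> K0 c \<Longrightarrow> \<rho>0 c x = 0"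
    "\<And>c z. smooth2 z (G0 c)" "\<And>c m. m \<in> K0 c \<Longrightarrow> osculates (G0 c) m"
    by metis
  \<comment> \<open>Second countability yields a countable subcover. Its enumeration may repeat
    members, which the telescoping sum below tolerates.\<close>
  obtain \<F> where \<F>: "\<F> \<subseteq> range P0" "countable \<F>" "\<Union>\<F> = \<Union>(range P0)"
    by (rule Lindelof[of "range P0"]) (use loc(2) in auto)
  have cov: "\<Union>\<F> = UNIV" using \<F>(3) loc(3) by auto
  then have ne: "\<F> \<noteq> {}" by auto
  have "\<forall>n. \<exists>c. from_nat_into \<F> n = P0 c" using from_nat_into[OF ne] \<F>(1) by blast
  then obtain p where p: "\<And>n. from_nat_into \<F> n = P0 (p n)" by metis
  have cover: "\<exists>k. x \<in> P0 (p k)" for x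
  proof -
    have "x \<in> \<Union>(range (from_nat_into \<F>))" using cov range_from_nat_into[OF ne \<F>(2)] by simp
    then show ?thesis using p by auto
  qed
  define \<theta> where "\<theta> = (\<lambda>n x. \<rho>0 (p n) x * (\<Prod>k<n. 1 - \<rho>0 (p k) x))"
  \<comment> \<open>The sum telescopes: \<open>\<theta> n\<close> is the difference of the products
    over k < n and over k < n + 1.\<close>
  have sum\<theta>: "(\<Sum>n<N. \<theta> n x) = 1 - (\<Prod>k<N. 1 - \<rho>0 (p k) x)" for N x
    by (induction N) (simp_all add: \<theta>_def algebra_simps)
  have "smooth_at A x (\<lambda>x. \<Prod>k<n. 1 - \<rho>0 (p k) x)" for x n
    by (induction n) (auto intro!: smooth_at_const smooth_at_mult smooth_at_diff loc(1))
  then have \<theta>: "smooth_at A x (\<theta> n)" for x n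
    unfolding \<theta>_def by (intro smooth_at_mult loc(1))
  have \<theta>0: "\<theta> n x = 0" if "x \<in> P0 (p k)" "k < n" for n k x
    using that loc(4) by (auto simp: \<theta>_def)
  have \<theta>1: "(\<Sum>n<Suc k. \<theta> n x) = 1" if "x \<in> P0 (p k)" for k x
    using that loc(4) unfolding sum\<theta> by auto
  have \<theta>K: "\<forall>\<^sub>F x in nhds m. \<theta> n x = 0" if "m \<notin> K0 (p n)" for n m
    by (rule eventually_mono[OF eventually_nhds_in_open[OF open_Compl[OF loc(5)]]])
      (use that loc(6) in \<open>auto simp: \<theta>_def\<close>)
  \<comment> \<open>The weights depend on the left point alone, so a vector acting on the right
    variable passes through them. At each left point only finitely many are nonzero; near
    \<open>P0 (p k)\<close> the index set can be replaced by the fixed range n \<le> k, which is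
    what makes f differentiable term by term.\<close>
  define f where "f = (\<lambda>z. \<Sum>n\<in>{n. \<theta> n (fst z) \<noteq> 0}. \<theta> n (fst z) * G0 (p n) z)"
  have f: "f (x, y) = (\<Sum>n<Suc k. \<theta> n x * G0 (p n) (x, y))" if "x \<in> P0 (p k)" for x y k
    unfolding f_def fst_conv
  proof (rule sum.mono_neutral_left)
    show "{n. \<theta> n x \<noteq> 0} \<subseteq> {..<Suc k}" using \<theta>0[OF that] by (auto simp: not_less_eq[symmetric] intro: ccontr)
  qed auto
  have nearP: "\<forall>\<^sub>F x in nhds m. x \<in> P0 (p k)" if "m \<in> P0 (p k)" for m k
    by (rule eventually_nhds_in_open[OF loc(2) that])
  have "smooth2 z f" for z
  proof -
    obtain k where k: "fst z \<in> P0 (p k)" using cover by blast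
    have "smooth2 z (\<lambda>z. \<Sum>n<Suc k. \<theta> n (fst z) * G0 (p n) z)"
      by (intro smooth2_sum smooth2_mult smooth2_fst \<theta> loc(7))
    then show ?thesis
    proof (rule smooth2_cong)
      have "\<forall>\<^sub>F y in nhds z. y \<in> P0 (p k) \<times> UNIV"
        by (rule eventually_nhds_in_open) (use loc(2) k in \<open>auto simp: open_Times mem_Times_iff\<close>)
      then show "\<forall>\<^sub>F y in nhds z. (\<Sum>n<Suc k. \<theta> n (fst y) * G0 (p n) y) = f y"
        by (rule eventually_mono) (use f[of "fst y" k "snd y" for y] in \<open>auto simp: mem_Times_iff\<close>)
    qed
  qed
  moreover have "osculates f m" for m
  proof -
    obtain k where k: "m \<in> P0 (p k)" using cover by blast
    define G where "G = (\<lambda>n. G0 (p n))"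
    have G: "smooth2 z (G n)" for n z unfolding G_def by (rule loc(7))
    have fG: "f (x, y) = (\<Sum>n<Suc k. \<theta> n x * G n (x, y))" if "x \<in> P0 (p k)" for x y
      unfolding G_def by (rule f[OF that])
    have osc: "osculates (G n) m" if "m \<in> K0 (p n)" for n unfolding G_def by (rule loc(8)[OF that])
    \<comment> \<open>Where the n-th local potential is not known to osculate, the weight vanishes
      as a germ, hence together with its derivatives.\<close>
    have out: "\<theta> n m = 0" "v \<in> tangent_space A m \<Longrightarrow> v (\<theta> n) = 0" if "m \<notin> K0 (p n)" for n v
    proof -
      show "\<theta> n m = 0" using eventually_nhds_x_imp_x[OF \<theta>K[OF that]] .
      show "v (\<theta> n) = 0" if v: "v \<in> tangent_space A m"
        using tangent_cong[OF v \<theta> smooth_at_const \<theta>K[OF \<open>m \<notin> K0 (p n)\<close>]] tangent_const[OF v] by simp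
    qed
    have unity: "v (\<lambda>x. \<Sum>n<Suc k. \<theta> n x) = 0" if v: "v \<in> tangent_space A m" for v
    proof -
      have "v (\<lambda>x. \<Sum>n<Suc k. \<theta> n x) = v (\<lambda>_. 1)"
        by (rule tangent_cong[OF v smooth_at_sum[OF \<theta>] smooth_at_const],
            rule eventually_mono[OF nearP[OF k]]) (rule \<theta>1)
      then show ?thesis using tangent_const[OF v] by simp
    qed
    define g where "g = (\<lambda>(w :: 'a tangent) n x. w (\<lambda>y. G n (x, y)))"
    have sg: "smooth_at A m (g w n)" if "w \<in> tangent_space A m" for w n
      unfolding g_def by (rule smooth_tangent_right[OF that G])
    have wf: "\<forall>\<^sub>F x in nhds m. (\<Sum>n<Suc k. \<theta> n x * g w n x) = w (\<lambda>y. f (x, y))" if w: "w \<in> tangent_space A m" for w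
    proof (rule eventually_mono[OF nearP[OF k]])
      fix x assume x: "x \<in> P0 (p k)"
      have "w (\<lambda>y. \<Sum>n<Suc k. \<theta> n x * G n (x, y)) = (\<Sum>n<Suc k. \<theta> n x * w (\<lambda>y. G n (x, y)))"
        by (subst tangent_sum[OF w])
          (auto intro!: smooth_at_mult smooth_at_const smooth_slice_right[OF G] sum.cong
            tangent_scale[OF w smooth_slice_right[OF G]] simp del: sum.lessThan_Suc)
      then show "(\<Sum>n<Suc k. \<theta> n x * g w n x) = w (\<lambda>y. f (x, y))"
        unfolding g_def fG[OF x] ..
    qed
    have sfw: "smooth_at A m (\<lambda>x. \<Sum>n<Suc k. \<theta> n x * g w n x)" if "w \<in> tangent_space A m" for w
      by (intro smooth_at_sum smooth_at_mult \<theta> sg that)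
    have sterm: "smooth_at A m (\<lambda>x. \<theta> n x * g w n x)" if "w \<in> tangent_space A m" for w n
      by (intro smooth_at_mult \<theta> sg that)
    have g0: "g w n m = 0" if "m \<in> K0 (p n)" "w \<in> tangent_space A m" for w n
      using osc[OF that(1)] that(2) by (simp add: osculates_def g_def)
    have vg: "v (g w n) = \<beta> (m, m) v w"
      if "m \<in> K0 (p n)" "v \<in> tangent_space A m" "w \<in> tangent_space A m" for v w n
      using osc[OF that(1)] that(2,3) by (simp add: osculates_def g_def)
    show ?thesis
    proof (rule osculatesI)
      show "f (m, m) = 0"
        unfolding fG[OF k]
      proof (rule sum.neutral, rule ballI)
        fix n show "\<theta> n m * G n (m, m) = 0"
          using osc[of n] out(1)[of n] by (cases "m \<in> K0 (p n)") (auto simp: osculates_def)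
      qed
      show "v (\<lambda>x. f (x, m)) = 0" if v: "v \<in> tangent_space A m" for v
      proof -
        have "v (\<lambda>x. f (x, m)) = v (\<lambda>x. \<Sum>n<Suc k. \<theta> n x * G n (x, m))"
          by (rule tangent_cong[OF v smooth_slice_left[OF \<open>smooth2 (m, m) f\<close>]
              smooth_at_sum[OF smooth_at_mult[OF \<theta> smooth_slice_left[OF G]]]],
              rule eventually_mono[OF nearP[OF k]]) (rule fG)
        also have "\<dots> = (\<Sum>n<Suc k. v (\<theta> n) * G n (m, m) + \<theta> n m * v (\<lambda>x. G n (x, m)))"
          by (simp only: tangent_sum[OF v smooth_at_mult[OF \<theta> smooth_slice_left[OF G]]]
              tangent_mult[OF v \<theta> smooth_slice_left[OF G]])
        also have "\<dots> = 0"
        proof (rule sum.neutral, rule ballI)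
          fix n show "v (\<theta> n) * G n (m, m) + \<theta> n m * v (\<lambda>x. G n (x, m)) = 0"
            using osc[of n] out(1)[of n] out(2)[of n v] v by (cases "m \<in> K0 (p n)") (auto simp: osculates_def)
        qed
        finally show ?thesis .
      qed
      show "w (\<lambda>y. f (m, y)) = 0" if w: "w \<in> tangent_space A m" for w
      proof -
        have "(\<Sum>n<Suc k. \<theta> n m * g w n m) = 0"
        proof (rule sum.neutral, rule ballI)
          fix n show "\<theta> n m * g w n m = 0"
            using g0[of n w] out(1)[of n] w by (cases "m \<in> K0 (p n)") auto
        qed
        then show ?thesis using eventually_nhds_x_imp_x[OF wf[OF w]] by simp
      qed
      show "v (\<lambda>x. w (\<lambda>y. f (x, y))) = \<beta> (m, m) v w"
        if v: "v \<in> tangent_space A m" and w: "w \<in> tangent_space A m" for v w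
      proof -
        have "v (\<lambda>x. w (\<lambda>y. f (x, y))) = v (\<lambda>x. \<Sum>n<Suc k. \<theta> n x * g w n x)"
          by (rule tangent_cong[OF v sfw[OF w] smooth_at_cong[OF sfw[OF w] wf[OF w]] wf[OF w], symmetric])
        also have "\<dots> = (\<Sum>n<Suc k. v (\<theta> n) * g w n m + \<theta> n m * v (g w n))"
          by (simp only: tangent_sum[OF v sterm[OF w]] tangent_mult[OF v \<theta> sg[OF w]])
        also have "\<dots> = (\<Sum>n<Suc k. \<theta> n m * \<beta> (m, m) v w)"
        proof (rule sum.cong[OF refl])
          fix n show "v (\<theta> n) * g w n m + \<theta> n m * v (g w n) = \<theta> n m * \<beta> (m, m) v w"
            using g0[of n w] vg[of n v w] out(1)[of n] out(2)[of n v] v w by (cases "m \<in> K0 (p n)") auto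
        qed
        also have "\<dots> = \<beta> (m, m) v w"
          unfolding sum_distrib_right[symmetric] \<theta>1[OF k] by simp
        finally show ?thesis .
      qed
      show "Z m (\<lambda>x. X x (\<lambda>x'. w (\<lambda>y. f (x', y)))) = dL Z X m w"
        if Z: "Z \<in> vector_fields A" and X: "X \<in> vector_fields A" and w: "w \<in> tangent_space A m" for Z X w
      proof -
        note Zt = field_tangent[OF Z, of m] and Xt = field_tangent[OF X, of m]
        have "Z m (\<lambda>x. X x (\<lambda>x'. w (\<lambda>y. f (x', y)))) = Z m (\<lambda>x. X x (\<lambda>x. \<Sum>n<Suc k. \<theta> n x * g w n x))"
          by (rule field_field_cong[OF Z X sfw[OF w] wf[OF w], symmetric])
        also have "\<dots> = (\<Sum>n<Suc k. Z m (\<lambda>x. X x (\<lambda>x. \<theta> n x * g w n x)))"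
          by (rule field_field_sum[OF Z X sterm[OF w]])
        also have "\<dots> = (\<Sum>n<Suc k. X m (\<theta> n) * \<beta> (m, m) (Z m) w + Z m (\<theta> n) * \<beta> (m, m) (X m) w + \<theta> n m * dL Z X m w)"
        \<comment> \<open>No second derivative of the weight appears: in the product rule it is
          multiplied by \<open>g w n m\<close>, which vanishes for an osculating potential. Off
          \<open>K0 (p n)\<close> both sides are zero, so the formula is uniform in n and can be
          summed.\<close>
        proof (rule sum.cong[OF refl])
          fix n
          show "Z m (\<lambda>x. X x (\<lambda>x. \<theta> n x * g w n x))
              = X m (\<theta> n) * \<beta> (m, m) (Z m) w + Z m (\<theta> n) * \<beta> (m, m) (X m) w + \<theta> n m * dL Z X m w"
          proof (cases "m \<in> K0 (p n)")
            case True
            have "Z m (\<lambda>x. X x (g w n)) = dL Z X m w"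
              using osc[OF True] Z X w by (simp add: osculates_def g_def)
            then show ?thesis
              unfolding field_field_mult[OF Z X \<theta> sg[OF w]]
              by (simp add: g0[OF True w] vg[OF True Zt w] vg[OF True Xt w])
          next
            case False
            have "Z m (\<lambda>x. X x (\<lambda>x. \<theta> n x * g w n x)) = Z m (\<lambda>x. X x (\<lambda>_. 0))"
              by (rule field_field_cong[OF Z X sterm[OF w]], rule eventually_mono[OF \<theta>K[OF False]]) simp
            then show ?thesis
              using field_field_const[OF Z X] out(1)[OF False] out(2)[OF False Zt] out(2)[OF False Xt] by simp
          qed
        qed
        also have "\<dots> = (\<Sum>n<Suc k. X m (\<theta> n)) * \<beta> (m, m) (Z m) w + (\<Sum>n<Suc k. Z m (\<theta> n)) * \<beta> (m, m) (X m) w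
            + (\<Sum>n<Suc k. \<theta> n m) * dL Z X m w"
          by (simp only: sum.distrib sum_distrib_right)
        also have "\<dots> = dL Z X m w"
          unfolding tangent_sum[OF Zt \<theta>, symmetric] tangent_sum[OF Xt \<theta>, symmetric] unity[OF Zt] unity[OF Xt] \<theta>1[OF k]
          by simp
        finally show ?thesis .
      qed
    qed
  qed
  ultimately show ?thesis by blast
qed

end

theorem theorem2:
  fixes A :: "('a::{t2_space,second_countable_topology}, 'e::{real_inner,heine_borel}) chart set"
    and W :: "('a \<times> 'a) set"
    and \<omega> :: "'a biform"
  assumes "smooth_manifold A"
    and "contrast_biform A W \<omega>"
  shows "((\<exists>F \<in> biforms A UNIV 0 0. biform_eq_on A W 1 1 \<omega> (left_diff A (right_diff A F))) \<longrightarrow>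
            statistical_manifold A (induced_metric \<omega>) (induced_connection A \<omega>)) \<and>
         (statistical_manifold A (induced_metric \<omega>) (induced_connection A \<omega>) \<longrightarrow>
            (\<exists>F \<in> biforms A UNIV 0 0.
               contrast_biform A UNIV (left_diff A (right_diff A F)) \<and>
               cotensor_eq A 2 (induced_metric (left_diff A (right_diff A F))) (induced_metric \<omega>) \<and>
               connection_eq A (induced_connection A (left_diff A (right_diff A F)))
                 (induced_connection A \<omega>) \<and>
               cotensor_eq A 1 (diag_pullback 1 (left_diff A F)) (\<lambda>m vs. 0) \<and>
               cotensor_eq A 1 (diag_pullback 0 (right_diff A F)) (\<lambda>m vs. 0) \<and>
               cotensor_eq A 0 (diag_pullback 0 F) (\<lambda>m vs. 0)))"
proof -
  interpret contrast A W \<omega>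
    using assms by (intro contrast.intro contrast_axioms.intro)
  show ?thesis
  proof (intro conjI impI)
    assume "\<exists>F \<in> biforms A UNIV 0 0. biform_eq_on A W 1 1 \<omega> (left_diff A (right_diff A F))"
    then show "statistical_manifold A (induced_metric \<omega>) (induced_connection A \<omega>)"
      using statistical_if_bi_exact by blast
  next
    assume "statistical_manifold A (induced_metric \<omega>) (induced_connection A \<omega>)"
    then obtain f where f: "\<And>z. smooth2 z f" "\<And>m. osculates f m"
      using ex_potential unfolding statistical_manifold_def by blast
    show "\<exists>F \<in> biforms A UNIV 0 0.
               contrast_biform A UNIV (left_diff A (right_diff A F)) \<and>
               cotensor_eq A 2 (induced_metric (left_diff A (right_diff A F))) (induced_metric \<omega>) \<and>
               connection_eq A (induced_connection A (left_diff A (right_diff A F)))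
                 (induced_connection A \<omega>) \<and>
               cotensor_eq A 1 (diag_pullback 1 (left_diff A F)) (\<lambda>m vs. 0) \<and>
               cotensor_eq A 1 (diag_pullback 0 (right_diff A F)) (\<lambda>m vs. 0) \<and>
               cotensor_eq A 0 (diag_pullback 0 F) (\<lambda>m vs. 0)"
      using contrast_biform_of_potential[OF f] by blast
  qed
qed

end
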